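(* If $G$ is a planar graph with girth $g\geq 13$, then $\chi'_{\mathrm{inj}}(G)\leq 6$.
   Context: All graphs are finite and simple. The girth of a graph is the length of a shortest cycle contained in it. Three edges $e_1,e_2,e_3$ of a graph are consecutive if they form (in this order) a path of length three or a cycle of length three. An injective edge-coloring of $G$ with $k$ colors is a map $c:E(G)\to\{1,\dots,k\}$ (not necessarily a proper edge-coloring) such that $c(e_1)\neq c(e_3)$ whenever $e_1,e_2,e_3$ are consecutive edges in $G$. The injective chromatic index $\chi'_{\mathrm{inj}}(G)$ is the minimum $k$ such that $G$ has an injective edge-coloring with $k$ colors. *)

theory Defs
  imports "HOL-Analysis.Analysis" "HOL-Library.Extended_Nat"
begin

text \<open>A graph is given by its vertex set \<open>V\<close> and its edge set \<open>E\<close>, an edge being the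
  two-element set of its ends.\<close>

definition finite_simple_graph :: "'a set \<Rightarrow> 'a set set \<Rightarrow> bool" where
  "finite_simple_graph V E \<longleftrightarrow> finite V \<and> (\<forall>e\<in>E. e \<subseteq> V \<and> card e = 2)"

text \<open>A cycle is the cyclic list of its pairwise distinct vertices; its length is the length of
  that list.\<close>

definition is_cycle :: "'a set set \<Rightarrow> 'a list \<Rightarrow> bool" where
  "is_cycle E xs \<longleftrightarrow> 3 \<le> length xs \<and> distinct xs \<and>
     (\<forall>i<length xs. {xs ! i, xs ! ((i + 1) mod length xs)} \<in> E)"

text \<open>An infimum over the empty set is \<open>\<infinity>\<close>, so a graph without cycles has girth \<open>\<infinity>\<close>.\<close>

definition girth :: "'a set set \<Rightarrow> enat" where
  "girth E = (INF xs\<in>{xs. is_cycle E xs}. enat (length xs))"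

text \<open>A plane drawing places the vertices at distinct points \<open>p v\<close> of the plane (here the complex
  numbers) and draws every edge \<open>e\<close> as an injective arc \<open>\<gamma> e\<close> joining the points of its ends, such
  that the interior of an edge contains no vertex and no point of any other edge.\<close>

definition plane_drawing ::
    "'a set \<Rightarrow> 'a set set \<Rightarrow> ('a \<Rightarrow> complex) \<Rightarrow> ('a set \<Rightarrow> real \<Rightarrow> complex) \<Rightarrow> bool" where
  "plane_drawing V E p \<gamma> \<longleftrightarrow>
     inj_on p V \<and>
     (\<forall>e\<in>E. arc (\<gamma> e) \<and> {pathstart (\<gamma> e), pathfinish (\<gamma> e)} = p ` e) \<and>
     (\<forall>e\<in>E. (path_image (\<gamma> e) - p ` e) \<inter> p ` V = {}) \<and>
     (\<forall>e\<in>E. \<forall>f\<in>E. e \<noteq> f \<longrightarrow> (path_image (\<gamma> e) - p ` e) \<inter> path_image (\<gamma> f) = {})"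

definition planar :: "'a set \<Rightarrow> 'a set set \<Rightarrow> bool" where
  "planar V E \<longleftrightarrow> (\<exists>p \<gamma>. plane_drawing V E p \<gamma>)"

text \<open>The first disjunct is a path of length three, the second a cycle of length three.\<close>

definition consecutive_edges :: "'a set set \<Rightarrow> 'a set \<Rightarrow> 'a set \<Rightarrow> 'a set \<Rightarrow> bool" where
  "consecutive_edges E e1 e2 e3 \<longleftrightarrow> {e1, e2, e3} \<subseteq> E \<and>
     ((\<exists>a b c d. distinct [a, b, c, d] \<and> e1 = {a, b} \<and> e2 = {b, c} \<and> e3 = {c, d}) \<or>
      (\<exists>a b c. distinct [a, b, c] \<and> e1 = {a, b} \<and> e2 = {b, c} \<and> e3 = {c, a}))"

definition injective_edge_coloring :: "'a set set \<Rightarrow> nat \<Rightarrow> ('a set \<Rightarrow> nat) \<Rightarrow> bool" where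
  "injective_edge_coloring E k c \<longleftrightarrow> c ` E \<subseteq> {1..k} \<and>
     (\<forall>e1 e2 e3. consecutive_edges E e1 e2 e3 \<longrightarrow> c e1 \<noteq> c e3)"

definition injective_chromatic_index :: "'a set set \<Rightarrow> nat" where
  "injective_chromatic_index E = (LEAST k. \<exists>c. injective_edge_coloring E k c)"

text \<open>The minimum is attained for every finite simple graph: give all edges different colors.\<close>

lemma injective_edge_coloring_exists:
  assumes "finite_simple_graph V E"
  shows "\<exists>k c. injective_edge_coloring E k c"
proof -
  have "E \<subseteq> Pow V" "finite V"
    using assms by (auto simp: finite_simple_graph_def)
  then have "finite E"
    by (meson finite_Pow_iff finite_subset)
  then obtain h where h: "bij_betw h E {1..card E}"
    using ex_bij_betw_finite_nat finite_same_card_bij[of E "{1..card E}"] by auto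
  have "h e1 \<noteq> h e3" if "consecutive_edges E e1 e2 e3" for e1 e2 e3
  proof -
    have "e1 \<in> E" "e3 \<in> E" "e1 \<noteq> e3"
      using that by (auto simp: consecutive_edges_def doubleton_eq_iff)
    with h show ?thesis
      by (auto simp: bij_betw_def inj_on_def)
  qed
  with h have "injective_edge_coloring E (card E) h"
    by (auto simp: injective_edge_coloring_def bij_betw_def)
  then show ?thesis by blast
qed

end

theory Submission
  imports Defs
begin

text \<open>
  A planar graph of girth at least 13 has a partition of its vertices into a set of pairwise distance
  at least 3 and a set inducing a forest. Colouring the forest by depth modulo 3 and the other set by
  a fourth colour gives a colouring without a two-coloured path on four vertices; an edge then
  receives the pair of colours of its ends, which leaves \<open>4 choose 2 = 6\<close> colours.

  For the partition take a minimal counterexample. Between vertices of degree at least 3 run threads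
  of vertices of degree 2, and short arguments restrict the threads at such a vertex; in particular no
  thread has three inner vertices. With \<open>n\<close> vertices, \<open>m\<close> edges and \<open>k\<close> faces of length 13, Euler's
  formula gives \<open>24 m - 28 n < 2 k\<close>. Give a vertex of degree \<open>d\<close> the charge \<open>12 d - 28\<close>; charge 4 moves
  to each vertex of degree 2 from the ends of its thread, and what is left at the other vertices pays 2
  to every face of length 13. Only one kind of 13-cycle may be left unpaid: its vertices
  of degree at least 3 have degree exactly 3, two of them are adjacent, and all other threads along it
  have two inner vertices. Such a cycle can be deleted and the partition extended to it.
\<close>

section \<open>Cycles and forests\<close>

text \<open>The faces of a drawing are never constructed. Their boundaries need not be cycles, and
  boundary walks would call for a rotation system. Discharging only needs many cycles that together
  use each edge at most twice; they are found by choosing sample points in different faces and, for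
  each point, a cycle among the edges at its face. The theorems of Jordan and Janiszewski carry
  this.

  The constants compare every cycle with length 14: \<open>m - n + 2\<close> cycles, all but
  \<open>k\<close> of them of length at least 14, give \<open>14 (m - n + 2) <= 2 m + k\<close>.
  Doubling yields the bound on \<open>24 m - 28 n\<close>, and \<open>12 d - 28\<close> is the
  charge with this sum. It is negative, namely -4, only at degree 2.

  The obstacle is degree 3: its charge is only 8, and threads with two inner vertices can consume
  all of it. A 13-cycle made of such vertices gets nothing and has to be reduced as a whole.\<close>

fun walk_edges :: "'a list \<Rightarrow> 'a set set" where
  "walk_edges (x # y # zs) = insert {x, y} (walk_edges (y # zs))"
| "walk_edges _ = {}"

definition cycle_edges :: "'a list \<Rightarrow> 'a set set" where
  "cycle_edges xs = (\<lambda>i. {xs ! i, xs ! ((i + 1) mod length xs)}) ` {..<length xs}"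

lemma is_cycle_iff:
  "is_cycle E xs \<longleftrightarrow> 3 \<le> length xs \<and> distinct xs \<and> cycle_edges xs \<subseteq> E"
  by (auto simp: is_cycle_def cycle_edges_def)

lemma walk_edges_conv_nth: "walk_edges xs = (\<lambda>i. {xs ! i, xs ! Suc i}) ` {..<length xs - 1}"
proof (induction xs rule: walk_edges.induct)
  case (1 x y zs)
  have "{..<length (x # y # zs) - 1} = insert 0 (Suc ` {..<length (y # zs) - 1})"
    by (simp add: lessThan_Suc_eq_insert_0)
  with 1 show ?case by (simp add: image_image)
qed auto

lemma cycle_edges_eq_insert:
  assumes "xs \<noteq> []"
  shows "cycle_edges xs = insert {last xs, hd xs} (walk_edges xs)"
proof -
  obtain n where n: "length xs = Suc n" using assms by (cases xs) auto
  have "{..<length xs} = insert n {..<length xs - 1}" using n by auto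
  moreover have "{xs ! n, xs ! ((n + 1) mod length xs)} = {last xs, hd xs}"
    using n assms by (simp add: last_conv_nth hd_conv_nth)
  moreover have "(\<lambda>i. {xs ! i, xs ! ((i + 1) mod length xs)}) ` {..<length xs - 1} = walk_edges xs"
    unfolding walk_edges_conv_nth using n by (intro image_cong) auto
  ultimately show ?thesis unfolding cycle_edges_def by simp
qed

lemma walk_edges_Cons:
  "zs \<noteq> [] \<Longrightarrow> walk_edges (x # zs) = insert {x, hd zs} (walk_edges zs)"
  by (cases zs) auto

lemma walk_edges_snoc:
  "zs \<noteq> [] \<Longrightarrow> walk_edges (zs @ [x]) = insert {last zs, x} (walk_edges zs)"
  by (induction zs rule: walk_edges.induct) auto

lemma walk_edges_append: "walk_edges xs \<subseteq> walk_edges (xs @ zs)"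
  by (induction xs rule: walk_edges.induct) auto

lemma walk_edges_subset: "e \<in> walk_edges xs \<Longrightarrow> e \<subseteq> set xs"
  by (induction xs rule: walk_edges.induct) auto

lemma cycle_edges_rotate1: "cycle_edges (rotate1 xs) = cycle_edges xs"
proof (cases "length xs \<le> 1")
  case True
  then show ?thesis by (cases xs) auto
next
  case False
  then obtain x zs where xs: "xs = x # zs" and zs: "zs \<noteq> []" by (cases xs) auto
  show ?thesis
    unfolding xs using zs
    by (simp add: cycle_edges_eq_insert walk_edges_Cons walk_edges_snoc insert_commute)
qed

lemma cycle_edges_rotate: "cycle_edges (rotate n xs) = cycle_edges xs"
  by (induction n) (auto simp: cycle_edges_rotate1)

lemma is_cycle_rotate: "is_cycle E (rotate n xs) \<longleftrightarrow> is_cycle E xs"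
  by (simp add: is_cycle_iff cycle_edges_rotate)

lemma is_cycle_mono: "is_cycle E xs \<Longrightarrow> E \<subseteq> E' \<Longrightarrow> is_cycle E' xs"
  by (auto simp: is_cycle_iff)

text \<open>Rotation turns any chosen edge into the closing one; the other edges are then a walk
  along the list, which can be drawn as an arc.\<close>

lemma cycle_close_at:
  assumes "is_cycle E xs" "e \<in> cycle_edges xs"
  obtains ys where "is_cycle E ys" "cycle_edges ys = cycle_edges xs" "e = {last ys, hd ys}"
proof -
  from assms(2) obtain i where i: "i < length xs" "e = {xs ! i, xs ! ((i + 1) mod length xs)}"
    by (auto simp: cycle_edges_def)
  define ys where "ys = rotate (Suc i) xs"
  have ne: "xs \<noteq> []" using i by auto
  have "hd ys = xs ! (Suc i mod length xs)"
    unfolding ys_def by (simp only: hd_rotate_conv_nth[OF ne])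
  moreover have "last ys = xs ! i"
  proof -
    have "last ys = ys ! (length xs - 1)" using ne by (simp add: ys_def last_conv_nth)
    also have "\<dots> = xs ! ((Suc i + (length xs - 1)) mod length xs)"
      unfolding ys_def using ne by (subst nth_rotate) auto
    also have "Suc i + (length xs - 1) = i + length xs" using i by simp
    finally show ?thesis using i by simp
  qed
  ultimately have "e = {last ys, hd ys}" using i by simp
  moreover have "is_cycle E ys" "cycle_edges ys = cycle_edges xs"
    using assms(1) by (simp_all only: ys_def is_cycle_rotate cycle_edges_rotate)
  ultimately show ?thesis using that by blast
qed

lemma closing_edge_notin_walk:
  assumes "distinct xs" "3 \<le> length xs"
  shows "{last xs, hd xs} \<notin> walk_edges xs"
proof
  assume "{last xs, hd xs} \<in> walk_edges xs"
  then obtain i where i: "Suc i < length xs" "{last xs, hd xs} = {xs ! i, xs ! Suc i}"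
    unfolding walk_edges_conv_nth by force
  have "xs \<noteq> []" using assms by auto
  then have "last xs = xs ! (length xs - 1)" "hd xs = xs ! 0"
    by (auto simp: last_conv_nth hd_conv_nth)
  with i have "{xs ! (length xs - 1), xs ! 0} = {xs ! i, xs ! Suc i}" by simp
  moreover have "xs ! j = xs ! k \<longleftrightarrow> j = k" if "j < length xs" "k < length xs" for j k
    using assms(1) that by (rule nth_eq_iff_index_eq)
  ultimately show False
    using assms(2) i(1) \<open>xs \<noteq> []\<close> by (auto simp: doubleton_eq_iff)
qed

lemma card_cycle_edges:
  assumes "distinct xs" "3 \<le> length xs"
  shows "card (cycle_edges xs) = length xs"
proof -
  define n where "n = length xs"
  have nth: "xs ! i = xs ! j \<longleftrightarrow> i = j" if "i < n" "j < n" for i j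
    using that assms(1) by (simp add: nth_eq_iff_index_eq n_def)
  have "inj_on (\<lambda>i. {xs ! i, xs ! ((i + 1) mod n)}) {..<n}"
  proof (rule inj_onI)
    fix i j assume i: "i \<in> {..<n}" and j: "j \<in> {..<n}"
      and eq: "{xs ! i, xs ! ((i + 1) mod n)} = {xs ! j, xs ! ((j + 1) mod n)}"
    have lt: "(i + 1) mod n < n" "(j + 1) mod n < n" using i by auto
    \<comment> \<open>Equal edges in opposite orientation would make \<open>i\<close> and
      \<open>j\<close> successors of each other, which needs a period of at most 2.\<close>
    from eq have "i = j \<or> i = (j + 1) mod n \<and> (i + 1) mod n = j"
      using nth i j lt by (auto simp: doubleton_eq_iff)
    then show "i = j"
    proof
      assume a: "i = (j + 1) mod n \<and> (i + 1) mod n = j"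
      have "k + 1 = n \<and> (k + 1) mod n = 0 \<or> (k + 1) mod n = k + 1" if "k < n" for k
        using that by (cases "k + 1 = n") auto
      from this[of i] this[of j] a i j assms(2) show ?thesis
        unfolding n_def[symmetric] by auto
    qed
  qed
  then show ?thesis by (simp add: cycle_edges_def n_def card_image)
qed

text \<open>A longest path cannot be prolonged, so a second neighbour of its first vertex closes a cycle.\<close>

lemma acyclic_leaf_edge:
  assumes fin: "finite F" and ne: "F \<noteq> {}" and two: "\<And>e. e \<in> F \<Longrightarrow> card e = 2"
    and acyc: "\<And>xs. \<not> is_cycle F xs"
  obtains a b where "a \<noteq> b" "{a, b} \<in> F" "\<And>e. e \<in> F \<Longrightarrow> b \<in> e \<Longrightarrow> e = {a, b}"
proof -
  define P where "P = {xs. 2 \<le> length xs \<and> distinct xs \<and> walk_edges xs \<subseteq> F}"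
  have finV: "finite (\<Union>F)"
    using fin two by (auto intro!: finite_Union) (metis card.infinite zero_neq_numeral)
  have subV: "set xs \<subseteq> \<Union>F" if "xs \<in> P" for xs
  proof
    fix z assume "z \<in> set xs"
    then obtain i where i: "i < length xs" "z = xs ! i" by (auto simp: in_set_conv_nth)
    \<comment> \<open>Every vertex of the path lies on one of its edges: the edge leaving it, or the
      last edge in the case of the final vertex.\<close>
    define k where "k = (if Suc i < length xs then i else i - 1)"
    have "{xs ! k, xs ! Suc k} \<in> walk_edges xs"
      unfolding walk_edges_conv_nth using i that by (auto simp: k_def P_def)
    moreover have "z \<in> {xs ! k, xs ! Suc k}"
      using i that by (auto simp: k_def P_def)
    ultimately show "z \<in> \<Union>F" using that by (auto simp: P_def)
  qed
  have bound: "\<forall>xs. xs \<in> P \<longrightarrow> length xs < Suc (card (\<Union>F))"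
  proof (intro allI impI)
    fix xs assume "xs \<in> P"
    then have "card (set xs) = length xs" by (simp add: P_def distinct_card)
    with card_mono[OF finV subV[OF \<open>xs \<in> P\<close>]] show "length xs < Suc (card (\<Union>F))" by simp
  qed
  have "P \<noteq> {}"
  proof -
    from ne obtain e where "e \<in> F" by auto
    with two obtain u v where "e = {u, v}" "u \<noteq> v" by (meson card_2_iff)
    with \<open>e \<in> F\<close> have "[u, v] \<in> P" by (simp add: P_def)
    then show ?thesis by auto
  qed
  then obtain xs0 where "xs0 \<in> P" by blast
  from ex_has_greatest_nat[OF this bound]
  obtain xs where xs: "xs \<in> P" and max: "\<And>ys. ys \<in> P \<Longrightarrow> length ys \<le> length xs"
    by blast
  have "2 \<le> length xs" using xs by (simp add: P_def)
  then obtain b a zs where xs_eq: "xs = b # a # zs"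
    by (metis One_nat_def Suc_1 Suc_le_length_iff)
  have "e = {a, b}" if e: "e \<in> F" "b \<in> e" for e
  proof -
    from two[OF e(1)] e(2) obtain z where z: "e = {b, z}" "z \<noteq> b"
      by (auto simp: card_2_iff)
    have "z \<in> set xs"
    proof (rule ccontr)
      assume "z \<notin> set xs"
      then have "z # xs \<in> P"
        using xs z e by (auto simp: P_def xs_eq insert_commute)
      from max[OF this] show False by simp
    qed
    then obtain j where j: "j < length xs" "z = xs ! j" by (auto simp: in_set_conv_nth)
    have "j = 1"
    proof (rule ccontr)
      assume "j \<noteq> 1"
      with z j have j2: "2 \<le> j" by (cases j) (auto simp: xs_eq)
      define ys where "ys = take (Suc j) xs"
      have len: "length ys = Suc j" using j by (simp add: ys_def)
      have "walk_edges ys \<subseteq> walk_edges (ys @ drop (Suc j) xs)"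
        by (rule walk_edges_append)
      then have "walk_edges ys \<subseteq> F" using xs by (auto simp: ys_def P_def)
      moreover have "last ys = z" "hd ys = b"
        using j by (simp_all add: last_conv_nth ys_def xs_eq)
      moreover have "ys \<noteq> []" using len by auto
      ultimately have "cycle_edges ys \<subseteq> F"
        using e z by (simp add: cycle_edges_eq_insert insert_commute)
      then have "is_cycle F ys"
        using j2 xs unfolding is_cycle_iff len by (simp add: ys_def P_def)
      then show False using acyc by blast
    qed
    then show ?thesis using z j by (auto simp: xs_eq)
  qed
  moreover have "a \<noteq> b" "{a, b} \<in> F" using xs by (auto simp: P_def xs_eq insert_commute)
  ultimately show ?thesis using that by blast
qed

text \<open>Deleting a leaf together with its edge lowers both sides by one. \<open>W\<close> may
  contain vertices on no edge, so only an inequality can hold.\<close>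

lemma acyclic_card_less:
  assumes "finite W" "W \<noteq> {}" "F \<subseteq> Pow W" "\<And>e. e \<in> F \<Longrightarrow> card e = 2" "\<And>xs. \<not> is_cycle F xs"
  shows "card F < card W"
  using assms
proof (induction "card F" arbitrary: F W)
  case 0
  then show ?case by (metis card_gt_0_iff)
next
  case (Suc n)
  have finF: "finite F" using Suc.prems(1,3) by (meson finite_Pow_iff finite_subset)
  have "F \<noteq> {}" using Suc.hyps(2) by auto
  then obtain a b where ab: "a \<noteq> b" "{a, b} \<in> F" "\<And>e. e \<in> F \<Longrightarrow> b \<in> e \<Longrightarrow> e = {a, b}"
    using acyclic_leaf_edge[OF finF _ Suc.prems(4,5)] by metis
  have "card (F - {{a, b}}) < card (W - {b})"
  proof (rule Suc.hyps(1))
    show "n = card (F - {{a, b}})" using Suc.hyps(2) ab(2) finF by simp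
    show "W - {b} \<noteq> {}" using ab Suc.prems(3) by blast
    show "F - {{a, b}} \<subseteq> Pow (W - {b})" using ab Suc.prems(3) by blast
    show "\<not> is_cycle (F - {{a, b}}) xs" for xs
      using Suc.prems(5) is_cycle_mono[of "F - {{a, b}}" xs F] by blast
  qed (use Suc.prems in auto)
  moreover have "b \<in> W" using ab Suc.prems(3) by blast
  ultimately show ?case using ab(2) finF Suc.prems(1) by (simp add: card_Diff_singleton)
qed

section \<open>Plane drawings\<close>

locale plane_graph =
  fixes V :: "'a set" and E :: "'a set set" and p :: "'a \<Rightarrow> complex"
    and \<gamma> :: "'a set \<Rightarrow> real \<Rightarrow> complex"
  assumes simple_graph: "finite_simple_graph V E"
    and drawing: "plane_drawing V E p \<gamma>"
begin

definition drawn :: "'a set set \<Rightarrow> complex set" where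
  "drawn F = (\<Union>e\<in>F. path_image (\<gamma> e))"

definition open_arc :: "'a set \<Rightarrow> complex set" where
  "open_arc e = path_image (\<gamma> e) - p ` e"

lemma finite_V: "finite V"
  and edge_subset: "e \<in> E \<Longrightarrow> e \<subseteq> V"
  and card_edge: "e \<in> E \<Longrightarrow> card e = 2"
  using simple_graph by (auto simp: finite_simple_graph_def)

lemma finite_E: "finite E"
  using finite_V edge_subset by (meson Pow_iff finite_Pow_iff finite_subset subsetI)

lemma arc_edge: "e \<in> E \<Longrightarrow> arc (\<gamma> e)"
  and ends_edge: "e \<in> E \<Longrightarrow> {pathstart (\<gamma> e), pathfinish (\<gamma> e)} = p ` e"
  using drawing by (auto simp: plane_drawing_def)

lemma ends_subset: "e \<in> E \<Longrightarrow> p ` e \<subseteq> path_image (\<gamma> e)"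
  using ends_edge[of e] by (metis insert_subset empty_subsetI pathfinish_in_path_image pathstart_in_path_image)

text \<open>The drawing condition is used in both orders: a common point is interior to neither arc,
  hence an end of both, and injectivity of \<open>p\<close> identifies the vertices.\<close>

lemma edges_meet:
  assumes "e \<in> E" "f \<in> E" "e \<noteq> f"
  shows "path_image (\<gamma> e) \<inter> path_image (\<gamma> f) \<subseteq> p ` (e \<inter> f)"
proof -
  have "path_image (\<gamma> e) \<inter> path_image (\<gamma> f) \<subseteq> p ` e \<inter> p ` f"
    using drawing assms unfolding plane_drawing_def by blast
  also have "\<dots> = p ` (e \<inter> f)"
    using drawing assms edge_subset by (intro inj_on_image_Int[symmetric, of p V]) (auto simp: plane_drawing_def)
  finally show ?thesis .
qed

lemma drawn_insert: "drawn (insert e F) = path_image (\<gamma> e) \<union> drawn F"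
  and drawn_Un: "drawn (F \<union> G) = drawn F \<union> drawn G"
  and drawn_mono: "F \<subseteq> G \<Longrightarrow> drawn F \<subseteq> drawn G"
  and drawn_empty [simp]: "drawn {} = {}"
  by (auto simp: drawn_def)

lemma compact_drawn: "F \<subseteq> E \<Longrightarrow> compact (drawn F)"
  unfolding drawn_def using finite_E arc_edge
  by (intro compact_UN) (auto intro: finite_subset compact_arc_image)

lemma closed_drawn: "F \<subseteq> E \<Longrightarrow> closed (drawn F)"
  by (simp add: compact_drawn compact_imp_closed)

lemma open_arc_disjoint: "e \<in> E \<Longrightarrow> F \<subseteq> E \<Longrightarrow> e \<notin> F \<Longrightarrow> open_arc e \<inter> drawn F = {}"
  using edges_meet[of e] by (fastforce simp: drawn_def open_arc_def)

lemma connected_open_arc: "e \<in> E \<Longrightarrow> connected (open_arc e)"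
  unfolding open_arc_def ends_edge[symmetric]
  by (intro connected_simple_path_endless arc_imp_simple_path arc_edge)

lemma open_arc_nonempty:
  assumes "e \<in> E"
  shows "open_arc e \<noteq> {}"
proof -
  have inj: "inj_on (\<gamma> e) {0..1}" using arc_edge[OF assms] by (simp add: arc_def)
  have "\<gamma> e (1/2) \<noteq> \<gamma> e 0" "\<gamma> e (1/2) \<noteq> \<gamma> e 1"
    using inj_onD[OF inj, of "1/2" 0] inj_onD[OF inj, of "1/2" 1] by auto
  then have "\<gamma> e (1/2) \<in> open_arc e"
    unfolding open_arc_def ends_edge[OF assms, symmetric]
    by (auto simp: path_image_def pathstart_def pathfinish_def)
  then show ?thesis by auto
qed

lemma oriented_edge_arc:
  assumes "{x, y} \<in> E"
  obtains g where "arc g" "pathstart g = p x" "pathfinish g = p y"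
    "path_image g = path_image (\<gamma> {x, y})"
proof -
  have "{pathstart (\<gamma> {x, y}), pathfinish (\<gamma> {x, y})} = {p x, p y}"
    using ends_edge[OF assms] by simp
  then consider "pathstart (\<gamma> {x, y}) = p x" "pathfinish (\<gamma> {x, y}) = p y"
    | "pathstart (\<gamma> {x, y}) = p y" "pathfinish (\<gamma> {x, y}) = p x"
    by (auto simp: doubleton_eq_iff)
  then show ?thesis
  proof cases
    case 1
    then show ?thesis using that arc_edge[OF assms] by blast
  next
    case 2
    then show ?thesis using that[of "reversepath (\<gamma> {x, y})"] arc_edge[OF assms]
      by (simp add: arc_reversepath)
  qed
qed

lemma walk_arc:
  assumes "2 \<le> length xs" "distinct xs" "walk_edges xs \<subseteq> E"
  shows "\<exists>g. arc g \<and> pathstart g = p (hd xs) \<and> pathfinish g = p (last xs) \<and>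
    path_image g = drawn (walk_edges xs)"
  using assms
proof (induction xs rule: walk_edges.induct)
  case (1 x y zs)
  from 1 have "{x, y} \<in> E" by simp
  then obtain g where g: "arc g" "pathstart g = p x" "pathfinish g = p y"
    "path_image g = path_image (\<gamma> {x, y})" by (rule oriented_edge_arc)
  show ?case
  proof (cases zs)
    case Nil
    with g show ?thesis by (auto simp: drawn_def)
  next
    case (Cons z ws)
    with 1 obtain h where h: "arc h" "pathstart h = p y" "pathfinish h = p (last (y # zs))"
      "path_image h = drawn (walk_edges (y # zs))" by fastforce
    \<comment> \<open>The walk does not return to \<open>x\<close>, so a later edge shares at most
      \<open>y\<close> with the first one.\<close>
    have "path_image g \<inter> path_image h \<subseteq> {pathstart h}"
    proof
      fix z assume z: "z \<in> path_image g \<inter> path_image h"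
      then obtain f where f: "f \<in> walk_edges (y # zs)" "z \<in> path_image (\<gamma> f)"
        by (auto simp: h drawn_def)
      have fs: "f \<subseteq> set (y # zs)" "f \<in> E" using walk_edges_subset[OF f(1)] f(1) 1 by auto
      have "x \<notin> f" using fs(1) 1 by auto
      then have "{x, y} \<noteq> f" "{x, y} \<inter> f \<subseteq> {y}" by auto
      with edges_meet[OF \<open>{x, y} \<in> E\<close> fs(2)] z f(2) show "z \<in> {pathstart h}"
        by (auto simp: g h)
    qed
    with g h have "arc (g +++ h)" by (intro arc_join) auto
    with g h Cons show ?thesis
      by (intro exI[of _ "g +++ h"]) (auto simp: path_image_join drawn_insert)
  qed
qed auto

text \<open>The edges other than \<open>e\<close> form one arc, which is connected and contains the
  ends of \<open>e\<close>; joined with \<open>e\<close> it is a Jordan curve. The facts about the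
  arc alone serve in \<open>touching_same_side\<close>.\<close>

lemma cycle_curve:
  assumes cyc: "is_cycle E xs" and e: "e \<in> cycle_edges xs"
  obtains g where "simple_path g" "pathfinish g = pathstart g"
    "path_image g = drawn (cycle_edges xs)"
    "connected (drawn (cycle_edges xs - {e}))" "p ` e \<subseteq> drawn (cycle_edges xs - {e})"
proof -
  from cyc e obtain ys where ys: "is_cycle E ys" "cycle_edges ys = cycle_edges xs"
    "e = {last ys, hd ys}" by (rule cycle_close_at)
  have ne: "ys \<noteq> []" and len: "3 \<le> length ys" and dist: "distinct ys"
    using ys(1) by (auto simp: is_cycle_iff)
  have ce: "cycle_edges xs = insert e (walk_edges ys)"
    using ys(2,3) cycle_edges_eq_insert[OF ne] by simp
  have eE: "e \<in> E" and wE: "walk_edges ys \<subseteq> E"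
    using ys(1) ce ys(2) by (auto simp: is_cycle_iff)
  have notin: "e \<notin> walk_edges ys"
    using closing_edge_notin_walk[OF dist len] ys(3) by simp
  have rest: "cycle_edges xs - {e} = walk_edges ys" using notin ce by auto
  obtain g where g: "arc g" "pathstart g = p (hd ys)" "pathfinish g = p (last ys)"
    "path_image g = drawn (walk_edges ys)"
    using walk_arc[OF _ dist wE] len by auto
  obtain h where h: "arc h" "pathstart h = p (last ys)" "pathfinish h = p (hd ys)"
    "path_image h = path_image (\<gamma> e)"
    using oriented_edge_arc[of "last ys" "hd ys"] eE ys(3) by auto
  have "path_image g \<inter> path_image h \<subseteq> {pathstart g, pathstart h}"
  proof
    fix z assume z: "z \<in> path_image g \<inter> path_image h"
    then obtain f where f: "f \<in> walk_edges ys" "z \<in> path_image (\<gamma> f)"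
      by (auto simp: g drawn_def)
    then have "z \<in> p ` (e \<inter> f)" using edges_meet[OF eE, of f] wE notin z by (auto simp: h)
    then show "z \<in> {pathstart g, pathstart h}" by (auto simp: g h ys(3))
  qed
  then have "simple_path (g +++ h)" using g h by (intro simple_path_join_loop) auto
  moreover have "pathfinish (g +++ h) = pathstart (g +++ h)" using g h by simp
  moreover have "path_image (g +++ h) = drawn (cycle_edges xs)"
    using g h by (simp add: path_image_join ce drawn_insert Un_commute)
  moreover have "connected (drawn (cycle_edges xs - {e}))"
    using connected_arc_image[OF g(1)] by (simp add: rest g)
  moreover have "p ` e \<subseteq> drawn (cycle_edges xs - {e})"
    unfolding rest using pathstart_in_path_image[of g] pathfinish_in_path_image[of g]
    by (simp add: g ys(3))
  ultimately show ?thesis by (rule that)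
qed

text \<open>A leaf edge meets the rest of the drawing in at most one point. An arc does not separate
  the plane, and the intersection is connected, so Janiszewski's theorem lets the edge be
  added.\<close>

lemma connected_complement_acyclic:
  assumes "F \<subseteq> E" "\<And>xs. \<not> is_cycle F xs"
  shows "connected (- drawn F)"
proof -
  have "finite F" using assms(1) finite_E finite_subset by blast
  then show ?thesis using assms
  proof (induction "card F" arbitrary: F)
    case 0
    then show ?case by (simp add: connected_UNIV)
  next
    case (Suc n)
    have "F \<noteq> {}" using Suc.hyps(2) by auto
    then obtain a b where ab: "a \<noteq> b" "{a, b} \<in> F" "\<And>e. e \<in> F \<Longrightarrow> b \<in> e \<Longrightarrow> e = {a, b}"
      using acyclic_leaf_edge[OF Suc.prems(1) _ _ Suc.prems(3)] card_edge Suc.prems(2) by (metis subsetD)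
    define G where "G = F - {{a, b}}"
    have F: "F = insert {a, b} G" and abE: "{a, b} \<in> E" and GE: "G \<subseteq> E"
      using ab(2) Suc.prems(2) by (auto simp: G_def)
    have "\<not> is_cycle G xs" for xs
      using is_cycle_mono[of G xs F] Suc.prems(3) F by blast
    then have conn: "connected (- drawn G)"
      using Suc.hyps(1)[of G] Suc.hyps(2) Suc.prems(1) GE ab(2) by (simp add: G_def)
    have "path_image (\<gamma> {a, b}) \<inter> drawn G \<subseteq> {p a}"
    proof
      fix z assume z: "z \<in> path_image (\<gamma> {a, b}) \<inter> drawn G"
      then obtain f where f: "f \<in> G" "z \<in> path_image (\<gamma> f)" by (auto simp: drawn_def)
      then have "{a, b} \<inter> f \<subseteq> {a}" "f \<noteq> {a, b}" using ab(3) by (auto simp: G_def)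
      with edges_meet[OF abE, of f] f z GE show "z \<in> {p a}" by auto
    qed
    then have "connected (path_image (\<gamma> {a, b}) \<inter> drawn G)"
      by (metis connected_empty connected_sing subset_singletonD)
    moreover have "connected (- path_image (\<gamma> {a, b}))"
      by (rule connected_arc_complement[OF arc_edge[OF abE]]) simp
    ultimately show ?case
      unfolding F drawn_insert
      by (intro Janiszewski_connected conn compact_arc_image arc_edge abE closed_drawn GE)
  qed
qed

end

section \<open>Sample points of faces and Euler's inequality\<close>

lemma connected_component_Compl_mono:
  "connected_component (- T) x y \<Longrightarrow> S \<subseteq> T \<Longrightarrow> connected_component (- S) x y"
  using connected_component_mono[of "- T" "- S"] by auto

context plane_graph
begin

text \<open>Sample points of pairwise different faces: a finite witness for a lower bound on the
  number of faces.\<close>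

definition separated :: "'a set set \<Rightarrow> complex set \<Rightarrow> bool" where
  "separated F P \<longleftrightarrow> finite P \<and> P \<subseteq> - drawn F \<and>
     (\<forall>x\<in>P. \<forall>y\<in>P. connected_component (- drawn F) x y \<longrightarrow> x = y)"

lemma jordan_cycle:
  assumes "is_cycle E xs" "C = drawn (cycle_edges xs)"
  shows "inside C \<inter> outside C = {}" "inside C \<union> outside C = - C"
    "frontier (inside C) = C" "frontier (outside C) = C"
    "connected (inside C)" "connected (outside C)" "open (inside C)" "open (outside C)"
proof -
  have "cycle_edges xs \<noteq> {}"
    using assms(1) by (subst cycle_edges_eq_insert) (auto simp: is_cycle_def)
  then obtain e where "e \<in> cycle_edges xs" by blast
  with assms(1) obtain g where "simple_path g" "pathfinish g = pathstart g"
    "path_image g = drawn (cycle_edges xs)" by (rule cycle_curve)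
  from Jordan_inside_outside[OF this(1,2)] this(3) assms(2)
  show "inside C \<inter> outside C = {}" "inside C \<union> outside C = - C"
    "frontier (inside C) = C" "frontier (outside C) = C"
    "connected (inside C)" "connected (outside C)" "open (inside C)" "open (outside C)"
    by simp_all
qed

lemma inside_outside_not_connected:
  assumes "is_cycle E xs" "x \<in> inside (drawn (cycle_edges xs))" "y \<in> outside (drawn (cycle_edges xs))"
  shows "\<not> connected_component (- drawn (cycle_edges xs)) x y"
proof
  assume "connected_component (- drawn (cycle_edges xs)) x y"
  then obtain T where T: "connected T" "T \<subseteq> - drawn (cycle_edges xs)" "x \<in> T" "y \<in> T"
    by (auto simp: connected_component_def)
  note jc = jordan_cycle[OF assms(1) refl]
  have "inside (drawn (cycle_edges xs)) \<inter> T = {} \<or> outside (drawn (cycle_edges xs)) \<inter> T = {}"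
    using T(1) jc(7,8) by (rule connectedD) (use jc(1,2) T(2) in auto)
  then show False using T assms by auto
qed

text \<open>The interior of \<open>e\<close> lies in one old face \<open>W\<close>. Near a point
  \<open>q\<close> of it there are points on both sides of the Jordan curve \<open>C\<close>, so
  \<open>W\<close> is split and \<open>x\<close>, \<open>y\<close> represent its parts. The other
  sample points are moved off the new arc inside their old faces.\<close>

lemma separated_insert_cycle_edge:
  assumes F: "F \<subseteq> E" and e: "e \<in> E" "e \<notin> F" and sep: "separated F P"
    and cyc: "is_cycle (insert e F) xs" "e \<in> cycle_edges xs"
  obtains P' where "separated (insert e F) P'" "card P < card P'"
proof -
  define X where "X = drawn F"
  define Y where "Y = drawn (insert e F)"
  define C where "C = drawn (cycle_edges xs)"
  have cycE: "is_cycle E xs" using is_cycle_mono[OF cyc(1)] F e(1) by auto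
  note jc = jordan_cycle[OF cycE C_def]
  have Y: "Y = path_image (\<gamma> e) \<union> X" by (simp add: X_def Y_def drawn_insert)
  have CY: "C \<subseteq> Y" unfolding C_def Y_def
    using cyc(1) by (intro drawn_mono) (simp add: is_cycle_iff)
  have eC: "path_image (\<gamma> e) \<subseteq> C" using cyc(2) by (auto simp: C_def drawn_def)
  have opX: "open (- X)" using closed_drawn[OF F] by (simp add: X_def open_Compl)
  have fin: "finite P" and PX: "P \<subseteq> - X"
    and uniq: "\<And>x y. x \<in> P \<Longrightarrow> y \<in> P \<Longrightarrow> connected_component (- X) x y \<Longrightarrow> x = y"
    using sep by (auto simp: separated_def X_def)
  \<comment> \<open>The arc cannot cover an open face: it lies on \<open>C\<close>, and each point
    of \<open>C\<close> is a limit of points inside \<open>C\<close>, which are off the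
    curve.\<close>
  have ex: "\<exists>z'. connected_component (- X) z z' \<and> z' \<notin> Y" if "z \<in> P" for z
  proof (rule ccontr)
    assume "\<nexists>z'. connected_component (- X) z z' \<and> z' \<notin> Y"
    then have sub: "connected_component_set (- X) z \<subseteq> C"
      using connected_component_subset[of "- X" z] eC by (auto simp: Y)
    have z: "z \<in> connected_component_set (- X) z" using that PX by auto
    then have "z \<in> closure (inside C)" using sub jc(3) unfolding frontier_def by blast
    then have "connected_component_set (- X) z \<inter> inside C \<noteq> {}"
      using open_Int_closure_eq_empty[OF open_connected_component[OF opX]] z by blast
    then show False using sub jc(2) by blast
  qed
  then obtain m where m: "\<And>z. z \<in> P \<Longrightarrow> connected_component (- X) z (m z)"
    "\<And>z. z \<in> P \<Longrightarrow> m z \<notin> Y" by metis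
  obtain q where q: "q \<in> open_arc e" using open_arc_nonempty[OF e(1)] by blast
  then have qX: "q \<in> - X" using open_arc_disjoint[OF e(1) F e(2)] by (auto simp: X_def)
  have qC: "q \<in> C" using q eC by (auto simp: open_arc_def)
  define W where "W = connected_component_set (- X) q"
  have W: "open W" "q \<in> W" "W \<subseteq> - X"
    unfolding W_def using opX qX by (auto intro: open_connected_component dest: connected_component_in)
  have "q \<in> closure (inside C)" "q \<in> closure (outside C)"
    using qC jc(3,4) unfolding frontier_def by blast+
  then have "W \<inter> inside C \<noteq> {}" "W \<inter> outside C \<noteq> {}"
    using open_Int_closure_eq_empty[OF W(1)] W(2) by blast+
  then obtain x y where x: "x \<in> W" "x \<in> inside C" and y: "y \<in> W" "y \<in> outside C" by blast
  have xY: "x \<notin> Y" "y \<notin> Y" using x y W(3) jc(2) eC unfolding Y by blast+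
  have "\<not> connected_component (- C) x y"
    using inside_outside_not_connected[OF cycE, of x y] x y by (simp add: C_def)
  then have nxy: "\<not> connected_component (- Y) x y" "\<not> connected_component (- Y) y x"
    using connected_component_Compl_mono[OF _ CY] connected_component_sym by blast+
  have XY: "X \<subseteq> Y" by (simp add: Y)
  \<comment> \<open>The sample points outside \<open>W\<close>. Distinct ones lie in distinct faces,
    so at most one is dropped, while two new ones are gained.\<close>
  define Q where "Q = {z \<in> P. \<not> connected_component (- X) z q}"
  have Wxy: "connected_component (- X) x q" "connected_component (- X) y q"
    using x y connected_component_sym by (auto simp: W_def)
  have inj: "inj_on m Q"
  proof (rule inj_onI)
    fix a b assume "a \<in> Q" "b \<in> Q" "m a = m b"
    then have ab: "a \<in> P" "b \<in> P" and "connected_component (- X) b (m a)"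
      using m(1)[of b] by (auto simp: Q_def)
    then have "connected_component (- X) a b"
      using m(1)[OF ab(1)] connected_component_sym connected_component_trans by blast
    with ab show "a = b" by (rule uniq)
  qed
  have QX: "connected_component (- X) z w \<longrightarrow> z = w"
    if "z \<in> m ` Q" "w \<in> m ` Q" for z w
  proof -
    from that obtain a b where ab: "a \<in> Q" "z = m a" "b \<in> Q" "w = m b" by auto
    show ?thesis
    proof
      assume "connected_component (- X) z w"
      then have "connected_component (- X) a b"
        using m(1)[of a] m(1)[of b] ab connected_component_trans connected_component_sym
        unfolding Q_def by blast
      then show "z = w" using uniq ab by (auto simp: Q_def)
    qed
  qed
  have Qq: "\<not> connected_component (- X) z q" if "z \<in> m ` Q" for z
  proof -
    from that obtain a where "a \<in> Q" "z = m a" by auto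
    then show ?thesis using m(1)[of a] connected_component_trans by (fastforce simp: Q_def)
  qed
  define P' where "P' = insert x (insert y (m ` Q))"
  have "separated (insert e F) P'"
    unfolding separated_def Y_def[symmetric]
  proof (intro conjI ballI impI)
    show "finite P'" using fin by (simp add: P'_def Q_def)
    show "P' \<subseteq> - Y" using m(2) xY by (auto simp: P'_def Q_def)
    fix z w assume zw: "z \<in> P'" "w \<in> P'" and c: "connected_component (- Y) z w"
    then have cX: "connected_component (- X) z w" "connected_component (- X) w z"
      using connected_component_Compl_mono[OF _ XY] connected_component_sym by blast+
    have "z = w" if "z \<in> m ` Q" "w \<in> {x, y}"
      using Qq[OF that(1)] cX Wxy that(2) connected_component_trans by blast
    moreover have "z = w" if "w \<in> m ` Q" "z \<in> {x, y}"
      using Qq[OF that(1)] cX Wxy that(2) connected_component_trans by blast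
    ultimately show "z = w" using zw c nxy QX cX by (auto simp: P'_def)
  qed
  moreover have "card P < card P'"
  proof -
    have "x \<notin> m ` Q" "y \<notin> m ` Q" using Qq Wxy by blast+
    moreover have "x \<noteq> y" using x y jc(1) by blast
    moreover have "finite Q" using fin by (simp add: Q_def)
    ultimately have "card P' = card Q + 2"
      by (simp add: P'_def card_image[OF inj])
    moreover have "card (P - Q) \<le> 1"
    proof -
      have "a = b" if "a \<in> P - Q" "b \<in> P - Q" for a b
        using that uniq[of a b] connected_component_trans connected_component_sym
        by (fastforce simp: Q_def)
      then show ?thesis by (metis card_le_Suc0_iff_eq fin finite_Diff One_nat_def)
    qed
    moreover have "card P = card Q + card (P - Q)"
      using fin by (metis (no_types, lifting) Q_def card_Diff_subset card_mono finite_subset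
          le_add_diff_inverse mem_Collect_eq subsetI)
    ultimately show ?thesis by linarith
  qed
  ultimately show ?thesis by (rule that)
qed

text \<open>The drawing of \<open>T\<close> is bounded, so one point off it starts the count; each
  further edge closes a cycle with \<open>T\<close> and adds a face.\<close>

lemma separated_many:
  assumes T: "T \<subseteq> E" and max: "\<And>e. e \<in> E - T \<Longrightarrow> \<exists>xs. is_cycle (insert e T) xs \<and> e \<in> cycle_edges xs"
  obtains P where "separated E P" "Suc (card (E - T)) \<le> card P"
proof -
  have "\<exists>P. separated (T \<union> D) P \<and> Suc (card D) \<le> card P" if "D \<subseteq> E - T" "finite D" for D
    using that(2,1)
  proof (induction D)
    case empty
    have "bounded (drawn T)" using compact_drawn[OF T] compact_imp_bounded by blast
    then obtain z where "z \<notin> drawn T" by (metis UNIV_eq_I not_bounded_UNIV)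
    then have "separated T {z}" by (simp add: separated_def)
    then show ?case by (intro exI[of _ "{z}"]) simp
  next
    case (insert e D)
    then obtain P where P: "separated (T \<union> D) P" "Suc (card D) \<le> card P" by auto
    from insert.prems max obtain xs where xs: "is_cycle (insert e T) xs" "e \<in> cycle_edges xs" by blast
    obtain P' where "separated (insert e (T \<union> D)) P'" "card P < card P'"
    proof (rule separated_insert_cycle_edge[OF _ _ _ P(1) _ xs(2)])
      show "is_cycle (insert e (T \<union> D)) xs" by (rule is_cycle_mono[OF xs(1)]) auto
    qed (use insert T in auto)
    with P insert show ?case by (intro exI[of _ P']) auto
  qed
  from this[of "E - T"] finite_E T obtain P where "separated (T \<union> (E - T)) P" "Suc (card (E - T)) \<le> card P"
    by auto
  moreover have "T \<union> (E - T) = E" using T by auto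
  ultimately show ?thesis using that by simp
qed

text \<open>An edge must meet the boundary of the face of \<open>z\<close> in an interior point.
  Boundary points at vertices are ignored: there are finitely many of them.\<close>

definition touching :: "complex \<Rightarrow> 'a set set" where
  "touching z = {e \<in> E. open_arc e \<inter> frontier (connected_component_set (- drawn E) z) \<noteq> {}}"

text \<open>If the edges touching a face were acyclic, their complement would be connected, and then the
  face would be the whole complement of the drawing.\<close>

lemma touching_cycle:
  assumes sep: "separated E P" and two: "2 \<le> card P" and z: "z \<in> P"
  shows "\<exists>xs. is_cycle (touching z) xs"
proof (rule ccontr)
  assume "\<nexists>xs. is_cycle (touching z) xs"
  then have acyc: "\<And>xs. \<not> is_cycle (touching z) xs" by auto
  define U where "U = connected_component_set (- drawn E) z"
  \<comment> \<open>The vertices are removed too, so that a frontier point found in \<open>M\<close>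
    is interior to an edge; a countable set does not disconnect a connected open set of the
    plane.\<close>
  define M where "M = - drawn (touching z) - p ` \<Union>E"
  have sub: "touching z \<subseteq> E" by (auto simp: touching_def)
  have "finite (\<Union>E)"
    using finite_E finite_V edge_subset by (meson Union_least finite_subset)
  then have "connected M" unfolding M_def
    using connected_complement_acyclic[OF sub acyc] closed_drawn[OF sub]
    by (intro connected_open_diff_countable) (auto simp: open_Compl intro: countable_finite)
  have EM: "- drawn E \<subseteq> M"
    using drawn_mono[OF sub] ends_subset by (auto simp: M_def) (fastforce simp: drawn_def)
  have "z \<in> - drawn E" using sep z by (auto simp: separated_def)
  then have "M \<inter> U \<noteq> {}" using EM by (auto simp: U_def)
  moreover have "M - U \<noteq> {}"
  proof -
    from two obtain w where "w \<in> P" "w \<noteq> z"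
      using z by (metis Suc_1 card_1_singletonE card_le_Suc0_iff_eq card.infinite not_less_eq_eq
          One_nat_def le_zero_eq nat.distinct(1))
    then have "w \<in> - drawn E" "w \<notin> U"
      using sep z by (auto simp: separated_def U_def)
    then show ?thesis using EM by auto
  qed
  ultimately have "M \<inter> frontier U \<noteq> {}" using \<open>connected M\<close> by (intro connected_Int_frontier)
  then obtain w where w: "w \<in> M" "w \<in> frontier U" by blast
  have "frontier U \<subseteq> drawn E"
    using frontier_of_connected_component_subset[of "- drawn E" z] closed_drawn[OF subset_refl]
    by (auto simp: U_def frontier_subset_closed frontier_complement
        dest: frontier_subset_closed[THEN subsetD, rotated])
  with w obtain e where e: "e \<in> E" "w \<in> path_image (\<gamma> e)" by (auto simp: drawn_def)
  with w have "w \<in> open_arc e" by (auto simp: open_arc_def M_def)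
  with e w have "e \<in> touching z" by (auto simp: touching_def U_def)
  with e w show False by (auto simp: M_def drawn_def)
qed

text \<open>Without \<open>e\<close> the two faces merge along its open arc. They are also joined
  off the cycle by \<open>side\<close>. The cycle and the drawing without \<open>e\<close> meet
  exactly in the arc of the other cycle edges, which is connected, so Janiszewski's theorem joins
  \<open>z\<close> and \<open>w\<close> off the whole drawing.\<close>

lemma touching_same_side:
  assumes sep: "separated E P" and z: "z \<in> P" "w \<in> P"
    and e: "e \<in> touching z" "e \<in> touching w"
    and cyc: "is_cycle E xs" "e \<in> cycle_edges xs"
    and side: "connected_component (- drawn (cycle_edges xs)) z w"
  shows "z = w"
proof -
  define X where "X = drawn (E - {e})"
  have eE: "e \<in> E" using e by (simp add: touching_def)
  have oX: "open_arc e \<subseteq> - X" using open_arc_disjoint[OF eE, of "E - {e}"] by (auto simp: X_def)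
  have opX: "open (- X)" using closed_drawn[of "E - {e}"] by (simp add: X_def open_Compl)
  have XE: "X \<subseteq> drawn E" by (auto simp: X_def drawn_def)
  have reach: "\<exists>q\<in>open_arc e. connected_component (- X) u q" if "u \<in> P" "e \<in> touching u" for u
  proof -
    from that(2) obtain q where q: "q \<in> open_arc e" "q \<in> closure (connected_component_set (- drawn E) u)"
      by (auto simp: touching_def frontier_def)
    have "open (connected_component_set (- X) q)" by (rule open_connected_component[OF opX])
    moreover have "q \<in> connected_component_set (- X) q" using q oX by auto
    ultimately have "connected_component_set (- X) q \<inter> connected_component_set (- drawn E) u \<noteq> {}"
      using q(2) open_Int_closure_eq_empty by blast
    then obtain v where "connected_component (- X) q v" "connected_component (- drawn E) u v" by auto
    then have "connected_component (- X) u q"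
      using connected_component_Compl_mono[OF _ XE] connected_component_trans connected_component_sym
      by blast
    with q show ?thesis by blast
  qed
  from reach[OF z(1) e(1)] reach[OF z(2) e(2)] obtain q r
    where qr: "q \<in> open_arc e" "r \<in> open_arc e" "connected_component (- X) z q" "connected_component (- X) w r"
    by blast
  have "connected_component (- X) q r"
    using qr(1,2) connected_open_arc[OF eE] oX by (auto simp: connected_component_def)
  with qr have zwX: "connected_component (- X) z w"
    using connected_component_trans connected_component_sym by blast
  obtain g where g: "connected (drawn (cycle_edges xs - {e}))" "p ` e \<subseteq> drawn (cycle_edges xs - {e})"
    using cyc by (rule cycle_curve)
  have sub: "cycle_edges xs \<subseteq> E" using cyc(1) by (simp add: is_cycle_iff)
  have ce: "cycle_edges xs = insert e (cycle_edges xs - {e})" using cyc(2) by auto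
  have "drawn (cycle_edges xs) \<inter> X = drawn (cycle_edges xs - {e})"
  proof
    have "path_image (\<gamma> e) \<inter> X \<subseteq> p ` e" using oX by (auto simp: open_arc_def)
    then show "drawn (cycle_edges xs) \<inter> X \<subseteq> drawn (cycle_edges xs - {e})"
      using g(2) drawn_insert[of e "cycle_edges xs - {e}"] unfolding ce[symmetric] by blast
    show "drawn (cycle_edges xs - {e}) \<subseteq> drawn (cycle_edges xs) \<inter> X"
      unfolding X_def using sub by (intro Int_greatest drawn_mono) auto
  qed
  then have "connected_component (- (drawn (cycle_edges xs) \<union> X)) z w"
    using compact_drawn[OF sub] closed_drawn[of "E - {e}"] g(1) side zwX
    by (intro Janiszewski) (auto simp: X_def)
  moreover have "drawn (cycle_edges xs) \<union> X = drawn E"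
    unfolding X_def drawn_Un[symmetric] using sub cyc(2) by (intro arg_cong[of _ _ drawn]) auto
  ultimately show ?thesis using sep z by (simp add: separated_def)
qed

text \<open>Each of the two sides of a cycle through \<open>e\<close> holds at most one sample point
  whose face touches \<open>e\<close>.\<close>

lemma card_touching_le_2:
  assumes sep: "separated E P" and cyc: "is_cycle E xs" "e \<in> cycle_edges xs"
  shows "card {z \<in> P. e \<in> touching z} \<le> 2"
proof -
  define C where "C = drawn (cycle_edges xs)"
  note jc = jordan_cycle[OF cyc(1) C_def]
  define A where "A = {z \<in> P. e \<in> touching z}"
  have finA: "finite A" using sep by (simp add: A_def separated_def)
  have "A \<subseteq> - C"
    using sep drawn_mono[of "cycle_edges xs" E] cyc(1)
    by (auto simp: A_def C_def separated_def is_cycle_iff)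
  then have A: "A = (A \<inter> inside C) \<union> (A \<inter> outside C)" using jc(2) by blast
  have eq: "z = w" if "z \<in> A \<inter> S" "w \<in> A \<inter> S" "connected S" "S \<subseteq> - C" for z w S
  proof -
    have "connected_component (- C) z w" using that by (auto simp: connected_component_def)
    with that show ?thesis using touching_same_side[OF sep, of z w e xs] cyc by (auto simp: A_def C_def)
  qed
  have "inside C \<subseteq> - C" "outside C \<subseteq> - C" using jc(2) by blast+
  then have "card (A \<inter> inside C) \<le> 1" "card (A \<inter> outside C) \<le> 1"
    using eq[of _ "inside C"] eq[of _ "outside C"] jc(5,6) finA
    by (auto simp: card_le_Suc0_iff_eq)
  then show ?thesis
    using card_Un_le[of "A \<inter> inside C" "A \<inter> outside C"] A by (simp add: A_def)
qed

text \<open>Euler's inequality: the cycles chosen here play the role of the face boundaries.\<close>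

theorem euler_cycles:
  assumes "V \<noteq> {}" "card V \<le> card E"
  shows "\<exists>(K :: complex set) C. finite K \<and> card E + 2 \<le> card K + card V \<and> (\<forall>z\<in>K. is_cycle E (C z)) \<and>
    (\<forall>e\<in>E. card {z \<in> K. e \<in> cycle_edges (C z)} \<le> 2)"
proof -
  define \<A> where "\<A> = {T. T \<subseteq> E \<and> (\<forall>xs. \<not> is_cycle T xs)}"
  have "\<not> is_cycle {} xs" for xs :: "'a list"
    using cycle_edges_eq_insert[of xs] by (cases xs) (auto simp: is_cycle_iff)
  then have emp: "{} \<in> \<A>" by (simp add: \<A>_def)
  have "\<A> \<subseteq> Pow E" by (auto simp: \<A>_def)
  then have fin: "finite \<A>" using finite_E by (meson finite_Pow_iff finite_subset)
  obtain T where T: "T \<in> \<A>" and "{} \<subseteq> T \<and> (\<forall>T'\<in>\<A>. T \<subseteq> T' \<longrightarrow> T = T')"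
    using finite_has_maximal2[OF fin emp] by (rule bexE)
  then have maxT: "\<And>T'. T' \<in> \<A> \<Longrightarrow> T \<subseteq> T' \<Longrightarrow> T = T'" by simp
  have TE: "T \<subseteq> E" and acyc: "\<And>xs. \<not> is_cycle T xs" using T by (auto simp: \<A>_def)
  have "\<exists>xs. is_cycle (insert e T) xs \<and> e \<in> cycle_edges xs" if e: "e \<in> E - T" for e
  proof -
    have "insert e T \<notin> \<A>"
    proof
      assume "insert e T \<in> \<A>"
      then have "T = insert e T" by (rule maxT) auto
      with e show False by auto
    qed
    then obtain xs where xs: "is_cycle (insert e T) xs" using e TE by (auto simp: \<A>_def)
    then have "e \<in> cycle_edges xs" using acyc[of xs] by (auto simp: is_cycle_iff)
    with xs show ?thesis by blast
  qed
  with TE obtain P where P: "separated E P" "Suc (card (E - T)) \<le> card P" by (rule separated_many)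
  have "card T < card V"
    using TE edge_subset card_edge by (intro acyclic_card_less finite_V assms(1) acyc) auto
  moreover have "card (E - T) = card E - card T" "card T \<le> card E"
    using TE finite_E by (auto simp: card_Diff_subset finite_subset card_mono)
  \<comment> \<open>The forest \<open>T\<close> has fewer than \<open>n\<close> edges, so the
    \<open>m - card T + 1\<close> sample points are at least \<open>m - n + 2\<close>. By
    \<open>n <= m\<close> there are two of them, as \<open>touching_cycle\<close> requires.\<close>
  ultimately have cardP: "card E + 2 \<le> card P + card V" "2 \<le> card P" using P(2) assms(2) by auto
  from touching_cycle[OF P(1) cardP(2)] obtain C
    where C: "\<And>z. z \<in> P \<Longrightarrow> is_cycle (touching z) (C z)" by metis
  have CE: "is_cycle E (C z)" if "z \<in> P" for z
    using C[OF that] by (rule is_cycle_mono) (auto simp: touching_def)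
  have "card {z \<in> P. e \<in> cycle_edges (C z)} \<le> 2" for e
  proof (cases "\<exists>z\<in>P. e \<in> cycle_edges (C z)")
    case True
    then obtain z where z: "z \<in> P" "e \<in> cycle_edges (C z)" by blast
    have "card {z \<in> P. e \<in> cycle_edges (C z)} \<le> card {z \<in> P. e \<in> touching z}"
      using P(1) C by (intro card_mono) (auto simp: separated_def is_cycle_iff)
    also have "\<dots> \<le> 2" using P(1) CE[OF z(1)] z(2) by (rule card_touching_le_2)
    finally show ?thesis .
  next
    case False
    then have "{z \<in> P. e \<in> cycle_edges (C z)} = {}" by auto
    then show ?thesis by (metis card.empty le0)
  qed
  with cardP CE P(1) show ?thesis
    by (intro exI[of _ P] exI[of _ C]) (simp add: separated_def)
qed

end

section \<open>Star colourings\<close>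

definition nbs :: "'a set set \<Rightarrow> 'a \<Rightarrow> 'a set" where
  "nbs E v = {u. {v, u} \<in> E}"

text \<open>Colour 3 is the independent class. Colours 0, 1, 2 are the depth modulo 3 in a forest, and the
  last condition says that a vertex has at most one parent (neighbour of colour one less) in it and at
  most one neighbour of colour 3.\<close>

definition star_coloring :: "'a set set \<Rightarrow> 'a set \<Rightarrow> ('a \<Rightarrow> nat) \<Rightarrow> bool" where
  "star_coloring E W c \<longleftrightarrow> (\<forall>u\<in>W. c u \<le> 3) \<and> (\<forall>u\<in>W. \<forall>w\<in>W \<inter> nbs E u. c u \<noteq> c w) \<and>
     (\<forall>u\<in>W. \<forall>w\<in>W \<inter> nbs E u. \<forall>w'\<in>W \<inter> nbs E u. w \<noteq> w' \<longrightarrow> c w = c w' \<longrightarrow>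
        c w \<noteq> 3 \<and> (c u \<noteq> 3 \<longrightarrow> c w = Suc (c u) mod 3))"

lemma Suc_mod_3_neq: "Suc n mod 3 \<noteq> n" "Suc n mod 3 \<noteq> (3::nat)" "Suc n mod 3 \<le> (3::nat)"
  "Suc (Suc n mod 3) mod 3 \<noteq> n"
  by presburger+

lemma nbs_commute: "u \<in> nbs E v \<longleftrightarrow> v \<in> nbs E u"
  by (simp add: nbs_def insert_commute)

lemma star_coloring_repeat:
  assumes "star_coloring E W c" "u \<in> W" "w \<in> W" "w' \<in> W" "w \<in> nbs E u" "w' \<in> nbs E u" "w \<noteq> w'" "c w = c w'"
  shows "c w \<noteq> 3 \<and> (c u \<noteq> 3 \<longrightarrow> c w = Suc (c u) mod 3)"
  using assms unfolding star_coloring_def by blast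

text \<open>Both colours would be repeated around a vertex, so neither is 3, and each would be the
  successor of the other modulo 3.\<close>

lemma star_coloring_no_bicolored_path:
  assumes col: "star_coloring E W c" and W: "{x, y, z, w} \<subseteq> W"
    and path: "y \<in> nbs E x" "z \<in> nbs E y" "w \<in> nbs E z" and ne: "x \<noteq> z" "y \<noteq> w"
  shows "\<not> (c x = c z \<and> c y = c w)"
proof
  assume eq: "c x = c z \<and> c y = c w"
  have "c x \<noteq> 3 \<and> (c y \<noteq> 3 \<longrightarrow> c x = Suc (c y) mod 3)"
    using star_coloring_repeat[OF col, of y x z] W path eq ne nbs_commute[of x E y] by auto
  moreover have "c y \<noteq> 3 \<and> (c z \<noteq> 3 \<longrightarrow> c y = Suc (c z) mod 3)"
    using star_coloring_repeat[OF col, of z y w] W path eq ne nbs_commute[of y E z] by auto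
  ultimately show False using eq Suc_mod_3_neq by metis
qed

text \<open>Equal pairs on the outer edges of a path \<open>x y z w\<close> mean an alternating
  pattern or \<open>c y = c z\<close>; a triangle is excluded because its three colours are
  distinct.\<close>

lemma star_coloring_injective_edge_coloring:
  assumes G: "finite_simple_graph V E" and col: "star_coloring E V c"
  shows "\<exists>k. injective_edge_coloring E 6 k"
proof -
  define \<P> where "\<P> = {A. A \<subseteq> {..3::nat} \<and> card A = 2}"
  have "card \<P> = 4 choose 2" unfolding \<P>_def by (subst n_subsets) auto
  also have "\<dots> = 6" by (simp add: eval_nat_numeral)
  finally have "card \<P> = card {1..6::nat}" by simp
  moreover have "finite \<P>" unfolding \<P>_def by (rule finite_subset[of _ "Pow {..3}"]) auto
  ultimately have "\<exists>h. bij_betw h \<P> {1..6::nat}"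
    by (intro finite_same_card_bij) auto
  then obtain h where h: "bij_betw h \<P> {1..6::nat}" ..
  define k where "k e = h (c ` e)" for e
  have VE: "e \<subseteq> V" "card e = 2" if "e \<in> E" for e
    using that G by (auto simp: finite_simple_graph_def)
  have neq: "c u \<noteq> c w" if "{u, w} \<in> E" for u w
  proof -
    have "u \<in> V" "w \<in> V \<inter> nbs E u" using VE[OF that] that by (auto simp: nbs_def)
    then show ?thesis using col unfolding star_coloring_def by blast
  qed
  have inP: "c ` e \<in> \<P>" if e: "e \<in> E" for e
  proof -
    from VE[OF e] obtain u w where uw: "e = {u, w}" "u \<noteq> w" by (meson card_2_iff)
    have "c u \<noteq> c w" using neq e uw by simp
    moreover have "c u \<le> 3" "c w \<le> 3" using col VE[OF e] uw by (auto simp: star_coloring_def)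
    ultimately show ?thesis by (simp add: \<P>_def uw)
  qed
  have "k e1 \<noteq> k e3" if con: "consecutive_edges E e1 e2 e3" for e1 e2 e3
  proof
    assume same: "k e1 = k e3"
    have "e1 \<in> E" "e3 \<in> E" using con by (auto simp: consecutive_edges_def)
    then have eq: "c ` e1 = c ` e3"
      using inj_onD[OF bij_betw_imp_inj_on[OF h]] same inP by (simp add: k_def)
    have "(\<exists>a b c d. distinct [a, b, c, d] \<and> e1 = {a, b} \<and> e2 = {b, c} \<and> e3 = {c, d}) \<or>
      (\<exists>a b c. distinct [a, b, c] \<and> e1 = {a, b} \<and> e2 = {b, c} \<and> e3 = {c, a})"
      using con unfolding consecutive_edges_def by (rule conjunct2)
    then show False
    proof (elim disjE exE conjE)
      fix x y z w assume path: "distinct [x, y, z, w]" "e1 = {x, y}" "e2 = {y, z}" "e3 = {z, w}"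
      have E: "{x, y} \<in> E" "{y, z} \<in> E" "{z, w} \<in> E" using con path by (auto simp: consecutive_edges_def)
      have "\<not> (c x = c z \<and> c y = c w)"
      proof (rule star_coloring_no_bicolored_path[OF col])
        show "{x, y, z, w} \<subseteq> V" using VE(1)[OF E(1)] VE(1)[OF E(3)] by auto
      qed (use E path(1) in \<open>auto simp: nbs_def\<close>)
      moreover have "c y \<noteq> c z" using neq E by auto
      ultimately show False using eq path by (auto simp: doubleton_eq_iff)
    next
      fix x y z assume triangle: "distinct [x, y, z]" "e1 = {x, y}" "e2 = {y, z}" "e3 = {z, x}"
      have E: "{x, y} \<in> E" "{y, z} \<in> E" "{z, x} \<in> E" using con triangle by (auto simp: consecutive_edges_def)
      show False using eq triangle neq[OF E(1)] neq[OF E(2)] neq[OF E(3)] by (auto simp: doubleton_eq_iff)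
    qed
  qed
  moreover have "k ` E \<subseteq> {1..6}"
  proof
    fix x assume "x \<in> k ` E"
    then obtain e where "e \<in> E" "x = h (c ` e)" unfolding k_def by (rule imageE)
    then show "x \<in> {1..6}" using bij_betw_apply[OF h inP] by simp
  qed
  ultimately show ?thesis
    unfolding injective_edge_coloring_def by (intro exI[of _ k] conjI allI impI)
qed

text \<open>Here \<open>R\<close> is a set of deleted vertices and \<open>I\<close> is the independent class of a colouring of the rest.
  Extension only looks at \<open>I\<close>: a vertex can rejoin the forest as soon as it has at most one present
  neighbour in \<open>I\<close> and at most one outside.\<close>

definition extendable :: "'a set set \<Rightarrow> 'a set \<Rightarrow> 'a set \<Rightarrow> 'a set \<Rightarrow> bool" where
  "extendable E V R I \<longleftrightarrow> (\<exists>c. star_coloring E (V - R) c \<and> (\<forall>v\<in>V - R. c v = 3 \<longleftrightarrow> v \<in> I))"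

text \<open>\<open>u\<close> joins the forest as a leaf below its only present forest neighbour and
  gets the next colour; without such a neighbour it becomes a root of colour 0. No cycle arises and
  nothing is recoloured.\<close>

lemma extendable_forest:
  assumes ext: "extendable E V (insert u R) I" and u: "u \<notin> R" "u \<notin> I" "u \<notin> nbs E u"
    and one: "\<And>w w'. w \<in> nbs E u - R \<Longrightarrow> w' \<in> nbs E u - R \<Longrightarrow> w \<in> I \<longleftrightarrow> w' \<in> I \<Longrightarrow> w = w'"
  shows "extendable E V R I"
proof -
  from ext obtain c where c: "star_coloring E (V - insert u R) c"
    and I: "\<forall>v\<in>V - insert u R. c v = 3 \<longleftrightarrow> v \<in> I"
    by (auto simp: extendable_def)
  define k where "k = (if \<exists>w\<in>(V - R) \<inter> nbs E u. w \<notin> I then Suc (c (THE w. w \<in> (V - R) \<inter> nbs E u \<and> w \<notin> I)) mod 3 else 0)"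
  have k: "k = Suc (c w) mod 3" if "w \<in> (V - R) \<inter> nbs E u" "w \<notin> I" for w
  proof -
    have "(THE w. w \<in> (V - R) \<inter> nbs E u \<and> w \<notin> I) = w"
      using that one by (intro the_equality) auto
    then show ?thesis using that by (auto simp: k_def)
  qed
  have k3: "k < 3" by (simp add: k_def)
  define c' where "c' = c(u := k)"
  have cI: "c' v = 3 \<longleftrightarrow> v \<in> I" if "v \<in> V - R" for v
    using that I u k3 by (auto simp: c'_def)
  have cV: "c v \<le> 3" if "v \<in> V - R" "v \<noteq> u" for v
    using that c by (auto simp: star_coloring_def)
  have proper_u: "c' w \<noteq> k" if "w \<in> (V - R) \<inter> nbs E u" for w
  proof (cases "w \<in> I")
    case True
    then show ?thesis using cI[of w] that k3 by auto
  next
    case False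
    with k[OF that] that u show ?thesis using Suc_mod_3_neq(1)[of "c w"] by (auto simp: c'_def)
  qed
  have "star_coloring E (V - R) c'"
    unfolding star_coloring_def
  proof (intro conjI ballI impI)
    fix v assume "v \<in> V - R"
    then show "c' v \<le> 3" using k3 cV by (auto simp: c'_def)
  next
    fix v w assume v: "v \<in> V - R" and w: "w \<in> (V - R) \<inter> nbs E v"
    show "c' v \<noteq> c' w"
    proof (cases "v = u \<or> w = u")
      case True
      then show ?thesis
        using proper_u[of w] proper_u[of v] v w nbs_commute[of w E v] by (auto simp: c'_def)
    next
      case False
      then show ?thesis using c v w by (auto simp: star_coloring_def c'_def)
    qed
  next
    fix v w w' assume v: "v \<in> V - R" and w: "w \<in> (V - R) \<inter> nbs E v"
      and w': "w' \<in> (V - R) \<inter> nbs E v" and ne: "w \<noteq> w'" and eq: "c' w = c' w'"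
    have same: "w \<in> I \<longleftrightarrow> w' \<in> I" using cI[of w] cI[of w'] eq w w' by auto
    show A: "c' w \<noteq> 3"
    proof (cases "v = u")
      case True
      then show ?thesis using one[of w w'] w w' ne same by auto
    next
      case False
      show ?thesis
      proof (cases "w = u \<or> w' = u")
        case True
        then show ?thesis using cI[of w] cI[of w'] eq w w' u by auto
      next
        case False
        then show ?thesis using star_coloring_repeat[OF c, of v w w'] v w w' ne eq \<open>v \<noteq> u\<close>
          by (auto simp: c'_def)
      qed
    qed
    assume v3: "c' v \<noteq> 3"
    have vI: "v \<notin> I" using v3 cI v by auto
    show "c' w = Suc (c' v) mod 3"
    proof (cases "v = u")
      case True
      then show ?thesis using one[of w w'] w w' ne same by auto
    next
      case vu: False
      consider "w = u" | "w' = u" | "w \<noteq> u" "w' \<noteq> u" by blast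
      then show ?thesis
      proof cases
        case 1
        then show ?thesis using k[of v] v w vI vu nbs_commute[of w E v] by (auto simp: c'_def)
      next
        case 2
        then show ?thesis using k[of v] v w' vI vu eq nbs_commute[of w' E v] by (auto simp: c'_def)
      next
        case 3
        then show ?thesis using star_coloring_repeat[OF c, of v w w'] v w w' ne eq vu v3
          by (auto simp: c'_def)
      qed
    qed
  qed
  then show ?thesis unfolding extendable_def using cI by (intro exI[of _ c'] conjI ballI)
qed

text \<open>With all neighbours of \<open>u\<close> absent there is no condition to check now; it is
  checked at each neighbour when that one returns.\<close>

lemma extendable_independent:
  assumes ext: "extendable E V (insert u R) I" and u: "u \<notin> R" "nbs E u \<subseteq> R"
  shows "extendable E V R (insert u I)"
proof -
  from ext obtain c where c: "star_coloring E (V - insert u R) c"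
    and I: "\<forall>v\<in>V - insert u R. c v = 3 \<longleftrightarrow> v \<in> I"
    by (auto simp: extendable_def)
  define c' where "c' = c(u := 3)"
  have nu: "u \<notin> nbs E v" if "v \<in> V - R" for v using that u nbs_commute[of u E v] by auto
  have "star_coloring E (V - R) c'"
    unfolding star_coloring_def
  proof (intro conjI ballI impI)
    fix v assume "v \<in> V - R"
    then show "c' v \<le> 3" using c by (auto simp: star_coloring_def c'_def)
  next
    fix v w assume v: "v \<in> V - R" and w: "w \<in> (V - R) \<inter> nbs E v"
    then have "v \<noteq> u" "w \<noteq> u" using u nu by auto
    with c v w show "c' v \<noteq> c' w" by (auto simp: star_coloring_def c'_def)
  next
    fix v w w' assume v: "v \<in> V - R" and w: "w \<in> (V - R) \<inter> nbs E v"
      and w': "w' \<in> (V - R) \<inter> nbs E v" and ne: "w \<noteq> w'" and eq: "c' w = c' w'"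
    then have *: "v \<noteq> u" "w \<noteq> u" "w' \<noteq> u" using u nu by auto
    with star_coloring_repeat[OF c, of v w w'] v w w' ne eq show "c' w \<noteq> 3" by (auto simp: c'_def)
    assume "c' v \<noteq> 3"
    with * star_coloring_repeat[OF c, of v w w'] v w w' ne eq show "c' w = Suc (c' v) mod 3"
      by (auto simp: c'_def)
  qed
  moreover have "\<forall>v\<in>V - R. c' v = 3 \<longleftrightarrow> v \<in> insert u I" using I by (auto simp: c'_def)
  ultimately show ?thesis unfolding extendable_def by (intro exI[of _ c'] conjI)
qed

text \<open>A list of instructions that restores deleted vertices one after another; the flag says whether
  the vertex joins the independent set.\<close>

fun restores :: "'a set set \<Rightarrow> 'a set \<Rightarrow> ('a \<times> bool) list \<Rightarrow> bool" where
  "restores E I [] \<longleftrightarrow> True"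
| "restores E I ((u, b) # rs) \<longleftrightarrow> u \<notin> fst ` set rs \<and>
     (if b then nbs E u \<subseteq> fst ` set rs \<and> restores E (insert u I) rs
      else u \<notin> I \<and> (\<forall>w\<in>nbs E u. w \<notin> fst ` set rs \<longrightarrow>
            (\<forall>w'\<in>nbs E u. w' \<notin> fst ` set rs \<longrightarrow> (w \<in> I \<longleftrightarrow> w' \<in> I) \<longrightarrow> w = w'))
        \<and> restores E I rs)"

lemma restores_extendable:
  assumes "extendable E V (fst ` set rs) I" "restores E I rs" "\<And>u. u \<notin> nbs E u"
  shows "\<exists>c. star_coloring E V c"
  using assms
proof (induction rs arbitrary: I)
  case Nil
  then show ?case by (auto simp: extendable_def)
next
  case (Cons a rs)
  obtain u b where a: "a = (u, b)" by (cases a)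
  show ?case
  proof (cases b)
    case True
    have "extendable E V (fst ` set rs) (insert u I)"
      using Cons.prems a True by (intro extendable_independent) auto
    with Cons a True show ?thesis by auto
  next
    case False
    have "extendable E V (fst ` set rs) I"
    proof (rule extendable_forest)
      show "extendable E V (insert u (fst ` set rs)) I" using Cons.prems a by simp
    next
      fix w w' assume "w \<in> nbs E u - fst ` set rs" "w' \<in> nbs E u - fst ` set rs" "(w \<in> I) = (w' \<in> I)"
      then show "w = w'" using Cons.prems(2) a False by auto
    qed (use Cons.prems a False in auto)
    with Cons a False show ?thesis by auto
  qed
qed

section \<open>Reducible configurations\<close>

locale critical_graph =
  fixes V :: "'a set" and E :: "'a set set"
  assumes simple: "finite_simple_graph V E"
    and long_cycles: "\<And>xs. is_cycle E xs \<Longrightarrow> 13 \<le> length xs"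
    and critical: "\<And>R. R \<subseteq> V \<Longrightarrow> R \<noteq> {} \<Longrightarrow> \<exists>c. star_coloring E (V - R) c"
    and not_colorable: "\<nexists>c. star_coloring E V c"
begin

abbreviation N :: "'a \<Rightarrow> 'a set" where "N \<equiv> nbs E"

lemma N_sym: "u \<in> N v \<Longrightarrow> v \<in> N u"
  by (simp add: nbs_commute)

lemma N_irrefl: "v \<notin> N v"
  using simple by (fastforce simp: nbs_def finite_simple_graph_def)

lemma N_subset: "N v \<subseteq> V"
  using simple by (fastforce simp: nbs_def finite_simple_graph_def)

lemma in_V: "u \<in> N v \<Longrightarrow> v \<in> V"
  using N_sym N_subset by blast

lemma N_insert_in_V: "N v = insert u S \<Longrightarrow> v \<in> V"
  using in_V by blast

lemma finite_N: "finite (N v)"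
  using simple by (intro finite_subset[OF N_subset]) (simp add: finite_simple_graph_def)

text \<open>The colouring of the rest comes from minimality and cannot be chosen, so every
  \<open>I\<close> must be handled; the list may depend on \<open>I\<close>.\<close>

lemma reducible:
  assumes R: "R \<subseteq> V" "R \<noteq> {}" and rs: "\<And>I. \<forall>u\<in>R. u \<notin> I \<Longrightarrow> \<exists>rs. R = fst ` set rs \<and> restores E I rs"
  shows False
proof -
  from critical[OF R] obtain c where c: "star_coloring E (V - R) c" ..
  define I where "I = {v \<in> V - R. c v = 3}"
  from rs[of I] obtain rs where "R = fst ` set rs" "restores E I rs" by (auto simp: I_def)
  moreover have "extendable E V R I"
    unfolding extendable_def using c by (intro exI[of _ c]) (auto simp: I_def)
  ultimately show False using restores_extendable[of E V rs I] N_irrefl not_colorable by auto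
qed

text \<open>Walks that never step back at once; below the girth they are paths.\<close>

fun nb_walk :: "'a list \<Rightarrow> bool" where
  "nb_walk (x # y # z # zs) \<longleftrightarrow> y \<in> N x \<and> x \<noteq> z \<and> nb_walk (y # z # zs)"
| "nb_walk [x, y] \<longleftrightarrow> y \<in> N x"
| "nb_walk _ \<longleftrightarrow> True"

lemma nb_walk_edges: "nb_walk xs \<Longrightarrow> walk_edges xs \<subseteq> E"
  by (induction xs rule: nb_walk.induct) (auto simp: nbs_def)

lemma nb_walk_tl: "nb_walk (x # xs) \<Longrightarrow> nb_walk xs"
  by (cases xs rule: nb_walk.cases) auto

text \<open>If the first vertex returns at position \<open>j\<close> of the tail,
  \<open>take (Suc j)\<close> of the tail is a cycle with at most 12 vertices.\<close>

lemma nb_walk_distinct: "nb_walk xs \<Longrightarrow> length xs \<le> 13 \<Longrightarrow> distinct xs"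
proof (induction xs)
  case (Cons x xs)
  have walk: "nb_walk xs" using Cons.prems(1) by (rule nb_walk_tl)
  have dist: "distinct xs" using Cons.IH[OF walk] Cons.prems(2) by simp
  have "x \<notin> set xs"
  proof
    assume "x \<in> set xs"
    then obtain j where j: "j < length xs" "x = xs ! j" by (auto simp: in_set_conv_nth)
    from j obtain y ys where xs: "xs = y # ys" by (cases xs) auto
    have yx: "y \<in> N x" using Cons.prems(1) by (cases ys) (auto simp: xs)
    have "j \<noteq> 0" using yx j(2) N_irrefl[of x] by (cases j) (auto simp: xs)
    moreover have "j \<noteq> 1" using Cons.prems(1) j by (cases ys) (auto simp: xs)
    ultimately have j2: "2 \<le> j" by simp
    define zs where "zs = take (Suc j) xs"
    have len: "length zs = Suc j" using j by (simp add: zs_def)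
    have "walk_edges zs \<subseteq> walk_edges (zs @ drop (Suc j) xs)"
      by (rule walk_edges_append)
    then have "walk_edges zs \<subseteq> E" using nb_walk_edges[OF walk] by (auto simp: zs_def)
    moreover have "zs \<noteq> []" "hd zs = y" "last zs = x"
      using len j by (auto simp: zs_def xs last_conv_nth)
    ultimately have "cycle_edges zs \<subseteq> E"
      using yx by (simp add: cycle_edges_eq_insert nbs_def)
    moreover have "distinct zs" using dist by (simp add: zs_def)
    ultimately have "is_cycle E zs" using j2 unfolding is_cycle_iff len by simp
    from long_cycles[OF this] have "13 \<le> Suc j" by (simp add: len)
    then show False using j Cons.prems(2) by simp
  qed
  with dist show ?case by simp
qed simp

text \<open>The reversed copy supplies each inequality in both orientations, for rewriting.\<close>

lemma nb_walk_neq: "nb_walk xs \<Longrightarrow> length xs \<le> 13 \<Longrightarrow> distinct xs \<and> distinct (rev xs)"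
  by (simp add: nb_walk_distinct)

section \<open>Configurations on a thread or around a vertex\<close>

lemma degree_ge_2:
  assumes "v \<in> V"
  shows "2 \<le> card (N v)"
proof (rule ccontr)
  assume "\<not> 2 \<le> card (N v)"
  then have one: "w = w'" if "w \<in> N v" "w' \<in> N v" for w w'
    using that finite_N[of v] by (auto simp: not_le less_2_cases_iff card_1_singleton_iff)
  show False
  proof (rule reducible[of "{v}"])
    fix I assume "\<forall>u\<in>{v}. u \<notin> I"
    then have "restores E I [(v, False)]" using one by auto
    then show "\<exists>rs. {v} = fst ` set rs \<and> restores E I rs" by (intro exI[of _ "[(v, False)]"]) simp
  qed (use assms in auto)
qed

text \<open>If an end lies in \<open>I\<close>, the whole thread joins the forest, the vertex next
  to this end last. Otherwise \<open>b\<close> joins \<open>I\<close>, and \<open>a\<close> and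
  \<open>c\<close> each see one vertex of either side.\<close>

lemma no_long_thread:
  assumes walk: "nb_walk [x, a, b, c, y]" and N: "N a = {x, b}" "N b = {a, c}" "N c = {b, y}"
  shows False
proof (rule reducible[of "{a, b, c}"])
  have d: "distinct [x, a, b, c, y]" "distinct (rev [x, a, b, c, y])" using nb_walk_neq[OF walk] by simp_all
  show "{a, b, c} \<subseteq> V" using N[THEN N_insert_in_V] by simp
  fix I assume I: "\<forall>u\<in>{a, b, c}. u \<notin> I"
  show "\<exists>rs. {a, b, c} = fst ` set rs \<and> restores E I rs"
  proof -
    consider "x \<in> I" | "y \<in> I" | "x \<notin> I" "y \<notin> I" by blast
    then show ?thesis
    proof cases
      case 1
      show ?thesis
        by (intro exI[of _ "[(c, False), (b, False), (a, False)]"] conjI; use I d 1 in \<open>simp add: N insert_commute\<close>)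
    next
      case 2
      show ?thesis
        by (intro exI[of _ "[(a, False), (b, False), (c, False)]"] conjI; use I d 2 in \<open>simp add: N insert_commute\<close>)
    next
      case 3
      show ?thesis
        by (intro exI[of _ "[(b, True), (a, False), (c, False)]"] conjI; use I d 3 in \<open>simp add: N insert_commute\<close>)
    qed
  qed
qed simp

text \<open>Two inner vertices put \<open>v\<close> at distance 3 from the far end of a thread, so
  \<open>v\<close> can join \<open>I\<close> whatever the far ends are.\<close>

lemma no_three_long:
  assumes walks: "nb_walk [A, a', a, v, b, b', B]" "nb_walk [A, a', a, v, c, c', C]" "nb_walk [B, b', b, v, c, c', C]"
    and N: "N v = {a, b, c}" "N a = {v, a'}" "N a' = {a, A}" "N b = {v, b'}" "N b' = {b, B}"
      "N c = {v, c'}" "N c' = {c, C}"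
  shows False
proof (rule reducible[of "{v, a, a', b, b', c, c'}"])
  note d = nb_walk_neq[OF walks(1)] nb_walk_neq[OF walks(2)] nb_walk_neq[OF walks(3)]
  show "{v, a, a', b, b', c, c'} \<subseteq> V" using N[THEN N_insert_in_V] by simp
  fix I assume I: "\<forall>u\<in>{v, a, a', b, b', c, c'}. u \<notin> I"
  show "\<exists>rs. {v, a, a', b, b', c, c'} = fst ` set rs \<and> restores E I rs"
    by (intro exI[of _ "[(v, True), (a', False), (a, False), (b', False), (b, False), (c', False), (c, False)]"] conjI; use I d in \<open>simp add: N insert_commute\<close>)
qed simp

lemma no_four_long:
  assumes walks: "nb_walk [A, a', a, v, b, b', B]" "nb_walk [A, a', a, v, c, c', C]" "nb_walk [B, b', b, v, c, c', C]"
    "nb_walk [A, a', a, v, d, d', D]" "nb_walk [B, b', b, v, d, d', D]" "nb_walk [C, c', c, v, d, d', D]"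
    and N: "N v = {a, b, c, d}" "N a = {v, a'}" "N a' = {a, A}" "N b = {v, b'}" "N b' = {b, B}"
      "N c = {v, c'}" "N c' = {c, C}" "N d = {v, d'}" "N d' = {d, D}"
  shows False
proof (rule reducible[of "{v, a, a', b, b', c, c', d, d'}"])
  note neq = nb_walk_neq[OF walks(1), simplified] nb_walk_neq[OF walks(2), simplified]
    nb_walk_neq[OF walks(3), simplified] nb_walk_neq[OF walks(4), simplified]
    nb_walk_neq[OF walks(5), simplified] nb_walk_neq[OF walks(6), simplified]
  show "{v, a, a', b, b', c, c', d, d'} \<subseteq> V" using N[THEN N_insert_in_V] by simp
  fix I assume I: "\<forall>u\<in>{v, a, a', b, b', c, c', d, d'}. u \<notin> I"
  show "\<exists>rs. {v, a, a', b, b', c, c', d, d'} = fst ` set rs \<and> restores E I rs"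
  proof (intro exI[of _ "[(v, True), (a', False), (a, False), (b', False), (b, False), (c', False), (c, False), (d', False), (d, False)]"] conjI)
    show "restores E I [(v, True), (a', False), (a, False), (b', False), (b, False), (c', False), (c, False), (d', False), (d, False)]"
      using I by (simp add: N neq)
  qed (simp add: insert_commute)
qed simp

text \<open>If \<open>C\<close> is outside \<open>I\<close>, then \<open>v\<close> joins
  \<open>I\<close>. Otherwise \<open>c\<close> already has its neighbour in \<open>I\<close>, and
  \<open>v\<close> joins the forest, hanging on the thread to \<open>B\<close>; the thread to
  \<open>A\<close> must then be cut, by \<open>A\<close> itself if it is in \<open>I\<close> and by
  \<open>a\<close> if not.\<close>

lemma no_two_long_one_mid:
  assumes walks: "nb_walk [A, a', a, v, b, b', B]" "nb_walk [A, a', a, v, c, C]" "nb_walk [B, b', b, v, c, C]"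
    and N: "N v = {a, b, c}" "N a = {v, a'}" "N a' = {a, A}" "N b = {v, b'}" "N b' = {b, B}" "N c = {v, C}"
  shows False
proof (rule reducible[of "{v, a, a', b, b', c}"])
  note d = nb_walk_neq[OF walks(1)] nb_walk_neq[OF walks(2)] nb_walk_neq[OF walks(3)]
  show "{v, a, a', b, b', c} \<subseteq> V" using N[THEN N_insert_in_V] by simp
  fix I assume I: "\<forall>u\<in>{v, a, a', b, b', c}. u \<notin> I"
  show "\<exists>rs. {v, a, a', b, b', c} = fst ` set rs \<and> restores E I rs"
  proof -
    consider "C \<notin> I" | "C \<in> I" "A \<in> I" | "C \<in> I" "A \<notin> I" by blast
    then show ?thesis
    proof cases
      case 1
      show ?thesis
        by (intro exI[of _ "[(v, True), (a', False), (a, False), (b', False), (b, False), (c, False)]"] conjI; use I d 1 in \<open>simp add: N insert_commute\<close>)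
    next
      case 2
      show ?thesis
        by (intro exI[of _ "[(b', False), (b, False), (v, False), (a, False), (a', False), (c, False)]"] conjI; use I d 2 in \<open>simp add: N insert_commute\<close>)
    next
      case 3
      show ?thesis
        by (intro exI[of _ "[(a, True), (a', False), (b', False), (b, False), (v, False), (c, False)]"] conjI; use I d 3 in \<open>simp add: N insert_commute\<close>)
    qed
  qed
qed simp

text \<open>As before, \<open>v\<close> joins \<open>I\<close> unless \<open>B\<close> or
  \<open>C\<close> is in \<open>I\<close>. In that case the thread to this end is restored last,
  \<open>v\<close> hangs on the other short thread, and the thread to \<open>A\<close> is
  cut.\<close>

lemma no_one_long_two_mid:
  assumes walks: "nb_walk [A, a', a, v, b, B]" "nb_walk [A, a', a, v, c, C]" "nb_walk [B, b, v, c, C]"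
    and N: "N v = {a, b, c}" "N a = {v, a'}" "N a' = {a, A}" "N b = {v, B}" "N c = {v, C}"
  shows False
proof (rule reducible[of "{v, a, a', b, c}"])
  note d = nb_walk_neq[OF walks(1)] nb_walk_neq[OF walks(2)] nb_walk_neq[OF walks(3)]
  show "{v, a, a', b, c} \<subseteq> V" using N[THEN N_insert_in_V] by simp
  fix I assume I: "\<forall>u\<in>{v, a, a', b, c}. u \<notin> I"
  show "\<exists>rs. {v, a, a', b, c} = fst ` set rs \<and> restores E I rs"
  proof -
    consider "B \<notin> I" "C \<notin> I" | "B \<in> I" "A \<in> I" | "B \<in> I" "A \<notin> I" | "C \<in> I" "A \<in> I" | "C \<in> I" "A \<notin> I" by blast
    then show ?thesis
    proof cases
      case 1
      show ?thesis
        by (intro exI[of _ "[(v, True), (a', False), (a, False), (b, False), (c, False)]"] conjI; use I d 1 in \<open>simp add: N insert_commute\<close>)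
    next
      case 2
      show ?thesis
        by (intro exI[of _ "[(c, False), (v, False), (a, False), (a', False), (b, False)]"] conjI; use I d 2 in \<open>simp add: N insert_commute\<close>)
    next
      case 3
      show ?thesis
        by (intro exI[of _ "[(a, True), (a', False), (c, False), (v, False), (b, False)]"] conjI; use I d 3 in \<open>simp add: N insert_commute\<close>)
    next
      case 4
      show ?thesis
        by (intro exI[of _ "[(b, False), (v, False), (a, False), (a', False), (c, False)]"] conjI; use I d 4 in \<open>simp add: N insert_commute\<close>)
    next
      case 5
      show ?thesis
        by (intro exI[of _ "[(a, True), (a', False), (b, False), (v, False), (c, False)]"] conjI; use I d 5 in \<open>simp add: N insert_commute\<close>)
    qed
  qed
qed simp

end

section \<open>Reducible 13-cycles\<close>

context critical_graph
begin

lemma step_F: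
  assumes "extendable E V (insert u R) I" "u \<notin> R" "u \<notin> I"
    and "\<forall>w\<in>N u. w \<notin> R \<longrightarrow> (\<forall>w'\<in>N u. w' \<notin> R \<longrightarrow> (w \<in> I \<longleftrightarrow> w' \<in> I) \<longrightarrow> w = w')"
  shows "extendable E V R I"
  using assms N_irrefl by (intro extendable_forest[of E V u R I]) blast+

text \<open>The present vertex \<open>w\<close> is in the forest and \<open>z\<close>, the next one
  on the cycle, is still absent. If \<open>y\<close> is outside \<open>I\<close>, putting
  \<open>q\<close> into \<open>I\<close> separates the tree of \<open>w\<close> from that of
  \<open>y\<close>. The upper bound on \<open>I'\<close> keeps all other membership facts
  valid.\<close>

lemma thread_step:
  assumes ext: "extendable E V (insert p (insert q (insert x R))) I"
    and N: "N p = {w, q}" "N q = {p, x}" "N x = {q, y, z}" and z: "z \<in> R"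
    and dist: "distinct [w, p, q, x, y]" and R: "\<forall>u\<in>{w, p, q, x, y}. u \<notin> R"
    and I: "\<forall>u\<in>{w, p, q, x}. u \<notin> I"
  obtains I' where "extendable E V R I'" "I \<subseteq> I'" "I' \<subseteq> insert q I"
proof (cases "y \<in> I")
  case True
  have "extendable E V (insert q (insert x R)) I"
    by (rule step_F[OF ext]) (use dist R I in \<open>auto simp: N\<close>)
  then have "extendable E V (insert x R) I"
    by (rule step_F) (use dist R I in \<open>auto simp: N\<close>)
  then have "extendable E V R I"
    by (rule step_F) (use dist R I True z in \<open>auto simp: N\<close>)
  then show ?thesis by (rule that) auto
next
  case False
  have "extendable E V (insert q (insert p (insert x R))) I"
    using ext by (simp add: insert_commute)
  then have "extendable E V (insert p (insert x R)) (insert q I)"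
    by (rule extendable_independent) (use dist R in \<open>auto simp: N\<close>)
  then have "extendable E V (insert x R) (insert q I)"
    by (rule step_F) (use dist R I in \<open>auto simp: N\<close>)
  then have "extendable E V R (insert q I)"
    by (rule step_F) (use dist R I False z in \<open>auto simp: N\<close>)
  then show ?thesis by (rule that) auto
qed

text \<open>The 13-cycle \<open>v w p1 p2 x1 q1 q2 x2 r1 r2 x3 s1 s2\<close>; the remaining neighbours of \<open>x1, x2, x3, v, w\<close>
  are \<open>y1, y2, y3, ov, ow\<close>.\<close>

definition ring ::
  "'a \<Rightarrow> 'a \<Rightarrow> 'a \<Rightarrow> 'a \<Rightarrow> 'a \<Rightarrow> 'a \<Rightarrow> 'a \<Rightarrow> 'a \<Rightarrow> 'a \<Rightarrow> 'a \<Rightarrow> 'a \<Rightarrow> 'a \<Rightarrow> 'a \<Rightarrow> 'a \<Rightarrow> 'a \<Rightarrow> 'a \<Rightarrow> 'a \<Rightarrow> 'a \<Rightarrow> bool" where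
  "ring v w p1 p2 x1 q1 q2 x2 r1 r2 x3 s1 s2 y1 y2 y3 ov ow \<longleftrightarrow>
     distinct [v, w, p1, p2, x1, q1, q2, x2, r1, r2, x3, s1, s2] \<and>
     (\<forall>u\<in>{y1, y2, y3, ov, ow}. u \<notin> {v, w, p1, p2, x1, q1, q2, x2, r1, r2, x3, s1, s2}) \<and>
     N v = {s2, w, ov} \<and> N w = {v, p1, ow} \<and>
     N p1 = {w, p2} \<and> N p2 = {p1, x1} \<and> N x1 = {p2, y1, q1} \<and>
     N q1 = {x1, q2} \<and> N q2 = {q1, x2} \<and> N x2 = {q2, y2, r1} \<and>
     N r1 = {x2, r2} \<and> N r2 = {r1, x3} \<and> N x3 = {r2, y3, s1} \<and>
     N s1 = {x3, s2} \<and> N s2 = {s1, v}"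

lemma ring_distinct:
  assumes "ring v w p1 p2 x1 q1 q2 x2 r1 r2 x3 s1 s2 y1 y2 y3 ov ow"
  shows "distinct [v, w, p1, p2, x1, q1, q2, x2, r1, r2, x3, s1, s2]"
    "distinct (rev [v, w, p1, p2, x1, q1, q2, x2, r1, r2, x3, s1, s2])"
    "\<forall>u\<in>{y1, y2, y3, ov, ow}. \<forall>t\<in>{v, w, p1, p2, x1, q1, q2, x2, r1, r2, x3, s1, s2}. u \<noteq> t \<and> t \<noteq> u"
proof -
  show d: "distinct [v, w, p1, p2, x1, q1, q2, x2, r1, r2, x3, s1, s2]"
    using assms unfolding ring_def by (rule conjunct1)
  show "distinct (rev [v, w, p1, p2, x1, q1, q2, x2, r1, r2, x3, s1, s2])"
    unfolding distinct_rev by (rule d)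
  have "\<forall>u\<in>{y1, y2, y3, ov, ow}. u \<notin> {v, w, p1, p2, x1, q1, q2, x2, r1, r2, x3, s1, s2}"
    using assms[unfolded ring_def, THEN conjunct2] by (rule conjunct1)
  then show "\<forall>u\<in>{y1, y2, y3, ov, ow}. \<forall>t\<in>{v, w, p1, p2, x1, q1, q2, x2, r1, r2, x3, s1, s2}. u \<noteq> t \<and> t \<noteq> u"
    by fast
qed

lemma ring_N:
  assumes "ring v w p1 p2 x1 q1 q2 x2 r1 r2 x3 s1 s2 y1 y2 y3 ov ow"
  shows "N v = {s2, w, ov}" "N w = {v, p1, ow}"
     "N p1 = {w, p2}" "N p2 = {p1, x1}" "N x1 = {p2, y1, q1}"
     "N q1 = {x1, q2}" "N q2 = {q1, x2}" "N x2 = {q2, y2, r1}"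
     "N r1 = {x2, r2}" "N r2 = {r1, x3}" "N x3 = {r2, y3, s1}"
     "N s1 = {x3, s2}" "N s2 = {s1, v}"
  using assms unfolding ring_def by - (elim conjE, assumption)+

text \<open>Reversing the cycle exchanges \<open>v\<close> and \<open>w\<close>, so an argument
  about the thread at one of them serves for both.\<close>

lemma ring_sym:
  assumes ring: "ring v w p1 p2 x1 q1 q2 x2 r1 r2 x3 s1 s2 y1 y2 y3 ov ow"
  shows "ring w v s2 s1 x3 r2 r1 x2 q2 q1 x1 p2 p1 y3 y2 y1 ow ov"
  unfolding ring_def
proof (intro conjI)
  show "distinct [w, v, s2, s1, x3, r2, r1, x2, q2, q1, x1, p2, p1]"
    using ring_distinct(1,2)[OF ring] by simp
  show "\<forall>u\<in>{y3, y2, y1, ow, ov}. u \<notin> {w, v, s2, s1, x3, r2, r1, x2, q2, q1, x1, p2, p1}"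
    using ring_distinct(3)[OF ring] by simp
qed (simp_all only: ring_N[OF ring] insert_commute)

lemma arc_steps:
  assumes ring: "ring v w p1 p2 x1 q1 q2 x2 r1 r2 x3 s1 s2 y1 y2 y3 ov ow"
    and ext: "extendable E V ({p1, p2, x1, q1, q2, x2, r1, r2, x3} \<union> R) I"
    and R: "s1 \<in> R" "\<forall>u\<in>{w, p1, p2, x1, q1, q2, x2, r1, r2, x3, y1, y2, y3}. u \<notin> R"
    and I: "\<forall>u\<in>{w, p1, p2, x1, q1, q2, x2, r1, r2, x3}. u \<notin> I"
  obtains I' where "extendable E V R I'" "I \<subseteq> I'" "I' \<subseteq> I \<union> {p2, q2, r2}"
proof -
  note N = ring_N(3-11)[OF ring]
  note d = ring_distinct(1,2)[OF ring, simplified] and y = ring_distinct(3)[OF ring, simplified]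
  let ?R1 = "{q1, q2, x2, r1, r2, x3} \<union> R" and ?R2 = "{r1, r2, x3} \<union> R"
  have A1: "extendable E V (insert p1 (insert p2 (insert x1 ?R1))) I"
    using ext by (simp only: Un_insert_left Un_empty_left)
  have D1: "distinct [w, p1, p2, x1, y1]" by (simp add: d y)
  have B1: "\<forall>u\<in>{w, p1, p2, x1, y1}. u \<notin> ?R1" using R by (simp add: d y)
  have C1: "\<forall>u\<in>{w, p1, p2, x1}. u \<notin> I" using I by simp
  have z1: "q1 \<in> ?R1" by simp
  obtain I1 where I1: "extendable E V ?R1 I1" "I \<subseteq> I1" "I1 \<subseteq> insert p2 I"
    by (rule thread_step[OF A1 N(1-3) z1 D1 B1 C1])
  have A2: "extendable E V (insert q1 (insert q2 (insert x2 ?R2))) I1"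
    using I1(1) by (simp only: Un_insert_left Un_empty_left)
  have D2: "distinct [x1, q1, q2, x2, y2]" by (simp add: d y)
  have B2: "\<forall>u\<in>{x1, q1, q2, x2, y2}. u \<notin> ?R2" using R by (simp add: d y)
  have n1: "u \<notin> I1" if "u \<notin> I" "u \<noteq> p2" for u using I1(3) that by auto
  have C2: "\<forall>u\<in>{x1, q1, q2, x2}. u \<notin> I1" using I by (simp add: d n1)
  have z2: "r1 \<in> ?R2" by simp
  obtain I2 where I2: "extendable E V ?R2 I2" "I1 \<subseteq> I2" "I2 \<subseteq> insert q2 I1"
    by (rule thread_step[OF A2 N(4-6) z2 D2 B2 C2])
  have A3: "extendable E V (insert r1 (insert r2 (insert x3 R))) I2"
    using I2(1) by (simp only: Un_insert_left Un_empty_left)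
  have D3: "distinct [x2, r1, r2, x3, y3]" by (simp add: d y)
  have B3: "\<forall>u\<in>{x2, r1, r2, x3, y3}. u \<notin> R" using R by simp
  have n2: "u \<notin> I2" if "u \<notin> I" "u \<noteq> p2" "u \<noteq> q2" for u using I2(3) n1 that by auto
  have C3: "\<forall>u\<in>{x2, r1, r2, x3}. u \<notin> I2" using I by (simp add: d n2)
  obtain I3 where I3: "extendable E V R I3" "I2 \<subseteq> I3" "I3 \<subseteq> insert r2 I2"
    by (rule thread_step[OF A3 N(7-9) R(1) D3 B3 C3])
  show ?thesis
    by (rule that[OF I3(1)]) (use I1 I2 I3 in auto)
qed

text \<open>Going round from \<open>v\<close>, the forest must be cut at least once, and before each vertex that is
  attached to the outside forest by a live third edge. At \<open>x1, x2, x3\<close> this is done in \<open>thread_step\<close>: either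
  \<open>y\<close> is in the independent set and the third edge is dead, or the vertex just before \<open>x\<close> joins the
  independent set. It remains to treat \<open>v\<close> and \<open>w\<close> with a single cut, at \<open>s2\<close> or at \<open>v\<close> itself.\<close>

lemma cut_before_v:
  assumes ring: "ring v w p1 p2 x1 q1 q2 x2 r1 r2 x3 s1 s2 y1 y2 y3 ov ow"
    and C: "C = {v, w, p1, p2, x1, q1, q2, x2, r1, r2, x3, s1, s2}"
    and ext: "extendable E V (C \<union> R) I"
    and R: "\<forall>u\<in>C \<union> {y1, y2, y3, ov}. u \<notin> R"
    and I: "\<forall>u\<in>insert ov C. u \<notin> I" and ow: "ow \<in> R \<or> ow \<in> I"
  obtains I' where "extendable E V R I'" "I \<subseteq> I'" "I' \<subseteq> I \<union> {s2, p2, q2, r2}"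
proof -
  note N = ring_N[OF ring]
  note d = ring_distinct(1,2)[OF ring, simplified] and y = ring_distinct(3)[OF ring, simplified]
  define A where "A = {p1, p2, x1, q1, q2, x2, r1, r2, x3}"
  have "extendable E V (insert s2 (insert v (insert w (A \<union> insert s1 R)))) I"
    using ext by (simp add: C A_def insert_commute)
  then have "extendable E V (insert v (insert w (A \<union> insert s1 R))) (insert s2 I)"
    by (rule extendable_independent) (use R in \<open>simp_all add: N A_def C d\<close>)
  then have "extendable E V (insert w (A \<union> insert s1 R)) (insert s2 I)"
    by (rule step_F) (use R I in \<open>simp_all add: N A_def C d y\<close>)
  then have "extendable E V (A \<union> insert s1 R) (insert s2 I)"
    by (cases "ow \<in> R"; rule step_F) (use R I ow in \<open>simp_all add: N A_def C d y\<close>)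
  then have A: "extendable E V ({p1, p2, x1, q1, q2, x2, r1, r2, x3} \<union> insert s1 R) (insert s2 I)"
    unfolding A_def .
  have B: "\<forall>u\<in>{w, p1, p2, x1, q1, q2, x2, r1, r2, x3, y1, y2, y3}. u \<notin> insert s1 R"
    using R by (simp add: C d y)
  have D: "\<forall>u\<in>{w, p1, p2, x1, q1, q2, x2, r1, r2, x3}. u \<notin> insert s2 I"
    using I by (simp add: C d)
  obtain I' where I': "extendable E V (insert s1 R) I'" "insert s2 I \<subseteq> I'" "I' \<subseteq> insert s2 I \<union> {p2, q2, r2}"
    by (rule arc_steps[OF ring A insertI1 B D])
  have *: "s1 \<notin> I'" "x3 \<notin> I'" "s2 \<in> I'" proof -
    have "u \<notin> I'" if "u \<notin> I" "u \<notin> {s2, p2, q2, r2}" for u using I'(3) that by auto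
    then show "s1 \<notin> I'" "x3 \<notin> I'" "s2 \<in> I'" using I'(2) I by (simp_all add: C d)
  qed
  \<comment> \<open>\<open>s1\<close> closes the cycle: it sees \<open>x3\<close> in the forest and
    \<open>s2\<close> in the independent set.\<close>
  have "extendable E V R I'"
    by (rule step_F[OF I'(1)]) (use R * in \<open>simp_all add: N C d\<close>)
  then show ?thesis by (rule that) (use I'(2,3) in auto)
qed

text \<open>As \<open>v\<close> joins the independent set, \<open>ov\<close> has to be absent. At
  the end \<open>s1\<close> hangs on \<open>x3\<close>, and \<open>s2\<close> sees \<open>s1\<close>
  in the forest and \<open>v\<close> in the independent set.\<close>

lemma cut_at_v:
  assumes ring: "ring v w p1 p2 x1 q1 q2 x2 r1 r2 x3 s1 s2 y1 y2 y3 ov ow"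
    and C: "C = {v, w, p1, p2, x1, q1, q2, x2, r1, r2, x3, s1, s2}"
    and ext: "extendable E V (C \<union> R) I"
    and R: "\<forall>u\<in>C \<union> {y1, y2, y3, ow}. u \<notin> R"
    and I: "\<forall>u\<in>insert ow C. u \<notin> I" and ov: "ov \<in> R"
  obtains I' where "extendable E V R I'" "insert v I \<subseteq> I'" "I' \<subseteq> I \<union> {v, p2, q2, r2}"
proof -
  note N = ring_N[OF ring]
  note d = ring_distinct(1,2)[OF ring, simplified] and y = ring_distinct(3)[OF ring, simplified]
  define A where "A = {p1, p2, x1, q1, q2, x2, r1, r2, x3}"
  have "extendable E V (insert v (insert w (A \<union> insert s1 (insert s2 R)))) I"
    using ext by (simp add: C A_def insert_commute)
  then have "extendable E V (insert w (A \<union> insert s1 (insert s2 R))) (insert v I)"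
    by (rule extendable_independent) (use R ov in \<open>simp_all add: N A_def C d\<close>)
  then have "extendable E V (A \<union> insert s1 (insert s2 R)) (insert v I)"
    by (rule step_F) (use R I in \<open>simp_all add: N A_def C d y\<close>)
  then have A: "extendable E V ({p1, p2, x1, q1, q2, x2, r1, r2, x3} \<union> insert s1 (insert s2 R)) (insert v I)"
    unfolding A_def .
  have B: "\<forall>u\<in>{w, p1, p2, x1, q1, q2, x2, r1, r2, x3, y1, y2, y3}. u \<notin> insert s1 (insert s2 R)"
    using R by (simp add: C d y)
  have D: "\<forall>u\<in>{w, p1, p2, x1, q1, q2, x2, r1, r2, x3}. u \<notin> insert v I"
    using I by (simp add: C d)
  obtain I' where I': "extendable E V (insert s1 (insert s2 R)) I'" "insert v I \<subseteq> I'" "I' \<subseteq> insert v I \<union> {p2, q2, r2}"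
    by (rule arc_steps[OF ring A insertI1 B D])
  have *: "s1 \<notin> I'" "s2 \<notin> I'" "x3 \<notin> I'" "v \<in> I'" proof -
    have "u \<notin> I'" if "u \<notin> I" "u \<notin> {v, p2, q2, r2}" for u using I'(3) that by auto
    then show "s1 \<notin> I'" "s2 \<notin> I'" "x3 \<notin> I'" "v \<in> I'" using I'(2) I by (simp_all add: C d)
  qed
  have "extendable E V (insert s2 R) I'"
    by (rule step_F[OF I'(1)]) (use R * in \<open>simp_all add: N C d\<close>)
  then have "extendable E V R I'"
    by (rule step_F) (use R * in \<open>simp_all add: N C d\<close>)
  then show ?thesis by (rule that) (use I' in auto)
qed

text \<open>\<open>T\<close> is the set of inner vertices of the thread that leaves \<open>u\<close> through \<open>a\<close>, and \<open>e\<close> is its other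
  end; \<open>e = a\<close> if there are no inner vertices.\<close>

definition off_thread :: "'a \<Rightarrow> 'a \<Rightarrow> 'a set \<Rightarrow> 'a \<Rightarrow> bool" where
  "off_thread u a T e \<longleftrightarrow> T = {} \<and> e = a \<or> T = {a} \<and> N a = {u, e} \<or>
     (\<exists>b. T = {a, b} \<and> a \<noteq> b \<and> N a = {u, b} \<and> N b = {a, e})"

text \<open>While \<open>u\<close> is absent, the inner vertices return from the far end and each
  sees a single present vertex, so \<open>e\<close> may lie on either side. If there are none,
  \<open>a\<close> is \<open>e\<close> itself.\<close>

lemma restore_before:
  assumes off: "off_thread u a T e" and ext: "extendable E V (T \<union> R) I"
    and T: "T \<inter> R = {}" "T \<inter> I = {}" and e: "e \<notin> T \<union> R" "T = {} \<Longrightarrow> e \<notin> I" and u: "u \<in> R"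
  shows "extendable E V R I" "a \<notin> R" "a \<notin> I"
proof -
  show "a \<notin> R" "a \<notin> I" using off T e by (auto simp: off_thread_def)
  from off consider "T = {}" | "T = {a}" "N a = {u, e}"
    | b where "T = {a, b}" "a \<noteq> b" "N a = {u, b}" "N b = {a, e}"
    by (auto simp: off_thread_def)
  then show "extendable E V R I"
  proof cases
    case 1
    with ext show ?thesis by simp
  next
    case 2
    show ?thesis by (rule step_F[of a]) (use ext 2 T u in auto)
  next
    case 3
    have "extendable E V (insert a R) I"
      by (rule step_F[of b]) (use ext 3 T u in \<open>auto simp: insert_commute\<close>)
    then show ?thesis by (rule step_F) (use 3 T u in auto)
  qed
qed

text \<open>Here the thread is the last thing to return, starting at \<open>u\<close>. The final
  inner vertex sees both ends of what remains; with two inner vertices its other neighbour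
  \<open>a\<close> is in the forest, so \<open>e\<close> must be the one in
  \<open>I\<close>.\<close>

lemma restore_after:
  assumes off: "off_thread u a T e" and ext: "extendable E V T I"
    and T: "T \<inter> I = {}" "u \<notin> T" "e \<notin> T" and I: "u \<in> I \<longleftrightarrow> e \<notin> I" "card T < 2 \<or> u \<notin> I"
  shows False
proof -
  from off consider "T = {}" | "T = {a}" "N a = {u, e}"
    | b where "T = {a, b}" "a \<noteq> b" "N a = {u, b}" "N b = {a, e}"
    by (auto simp: off_thread_def)
  then have "extendable E V {} I"
  proof cases
    case 1
    with ext show ?thesis by simp
  next
    case 2
    show ?thesis by (rule step_F[of a]) (use ext 2 T I in auto)
  next
    case 3
    have "extendable E V (insert b {}) I"
      by (rule step_F[of a]) (use ext 3 T I in auto)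
    then show ?thesis by (rule step_F) (use 3 T I in auto)
  qed
  then show False using not_colorable by (auto simp: extendable_def)
qed

definition ring_threads where
  "ring_threads v w p1 p2 x1 q1 q2 x2 r1 r2 x3 s1 s2 y1 y2 y3 ov ow C Tv ev Tw ew \<longleftrightarrow>
     ring v w p1 p2 x1 q1 q2 x2 r1 r2 x3 s1 s2 y1 y2 y3 ov ow \<and>
     C = {v, w, p1, p2, x1, q1, q2, x2, r1, r2, x3, s1, s2} \<and>
     off_thread v ov Tv ev \<and> off_thread w ow Tw ew \<and> Tv \<inter> Tw = {} \<and> (Tv \<union> Tw) \<inter> C = {} \<and>
     (\<forall>u\<in>{ev, ew, y1, y2, y3}. u \<notin> C \<union> Tv \<union> Tw)"

lemma ring_threadsD:
  assumes "ring_threads v w p1 p2 x1 q1 q2 x2 r1 r2 x3 s1 s2 y1 y2 y3 ov ow C Tv ev Tw ew"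
  shows "ring v w p1 p2 x1 q1 q2 x2 r1 r2 x3 s1 s2 y1 y2 y3 ov ow"
    "C = {v, w, p1, p2, x1, q1, q2, x2, r1, r2, x3, s1, s2}"
    "off_thread v ov Tv ev" "off_thread w ow Tw ew" "Tv \<inter> Tw = {}" "(Tv \<union> Tw) \<inter> C = {}"
    "\<forall>u\<in>{ev, ew, y1, y2, y3}. u \<notin> C \<union> Tv \<union> Tw"
  using assms unfolding ring_threads_def by - (elim conjE, assumption)+

lemma ring_threads_sym:
  assumes "ring_threads v w p1 p2 x1 q1 q2 x2 r1 r2 x3 s1 s2 y1 y2 y3 ov ow C Tv ev Tw ew"
  shows "ring_threads w v s2 s1 x3 r2 r1 x2 q2 q1 x1 p2 p1 y3 y2 y1 ow ov C Tw ew Tv ev"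
proof -
  note r = ring_threadsD[OF assms]
  show ?thesis
    unfolding ring_threads_def
  proof (intro conjI)
    show "C = {w, v, s2, s1, x3, r2, r1, x2, q2, q1, x1, p2, p1}"
      unfolding r(2) by (simp only: insert_commute)
    show "(Tw \<union> Tv) \<inter> C = {}" "Tw \<inter> Tv = {}" using r(5,6) by blast+
    show "\<forall>u\<in>{ew, ev, y3, y2, y1}. u \<notin> C \<union> Tw \<union> Tv" using r(7) by simp
  qed (rule ring_sym[OF r(1)] r(3,4))+
qed

lemma off_thread_end: "off_thread u a T e \<Longrightarrow> T = {} \<and> e = a \<or> a \<in> T"
  by (auto simp: off_thread_def)

text \<open>An end \<open>ew\<close> in \<open>I\<close> makes the third edge at \<open>w\<close>
  dead. So the thread at \<open>v\<close> returns first, the cycle is cut at \<open>s2\<close>, and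
  the thread at \<open>w\<close> is completed last towards \<open>ew\<close>.\<close>

lemma ring_forward:
  assumes ring: "ring_threads v w p1 p2 x1 q1 q2 x2 r1 r2 x3 s1 s2 y1 y2 y3 ov ow C Tv ev Tw ew"
    and ext: "extendable E V (C \<union> Tv \<union> Tw) I" and I: "\<forall>u\<in>C \<union> Tv \<union> Tw. u \<notin> I"
    and ew: "ew \<in> I" and ev: "Tv = {} \<Longrightarrow> ev \<notin> I"
  shows False
proof -
  note r = ring_threadsD[OF ring]
  have wC: "w \<in> C" "v \<in> C" by (simp_all add: r(2))
  have CT: "u \<notin> Tv" "u \<notin> Tw" if "u \<in> C" for u using r(6) that by blast+
  have e: "ev \<notin> C" "ev \<notin> Tv" "ev \<notin> Tw" "ew \<notin> C" "ew \<notin> Tv" "ew \<notin> Tw"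
    and y: "\<forall>u\<in>{y1, y2, y3}. u \<notin> Tv \<and> u \<notin> Tw" using r(7) by simp_all
  have e1: "extendable E V (Tv \<union> (C \<union> Tw)) I" using ext by (simp add: Un_commute Un_left_commute)
  have b: "extendable E V (C \<union> Tw) I" "ov \<notin> C \<union> Tw" "ov \<notin> I"
    by (rule restore_before[OF r(3) e1]; use r(5,6) I e ev wC in blast)+
  have B: "\<forall>u\<in>C \<union> {y1, y2, y3, ov}. u \<notin> Tw" using b(2) CT y by blast
  have D: "\<forall>u\<in>insert ov C. u \<notin> I" using I b(3) by blast
  have ow: "ow \<in> Tw \<or> ow \<in> I" using off_thread_end[OF r(4)] ew by auto
  obtain I' where I': "extendable E V Tw I'" "I \<subseteq> I'" "I' \<subseteq> I \<union> {s2, p2, q2, r2}"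
    by (rule cut_before_v[OF r(1,2) b(1) B D ow])
  have sub: "{s2, p2, q2, r2} \<subseteq> C" by (simp add: r(2))
  have w: "w \<notin> I'"
    using I wC(1) subsetD[OF I'(3), of w] by (auto simp: ring_distinct(1,2)[OF r(1), simplified])
  have "ew \<in> I'" "Tw \<inter> I' = {}" using I' I sub CT ew by blast+
  then show False
    by (intro restore_after[OF r(4) I'(1)]) (use CT e wC w in auto)
qed

text \<open>With two inner vertices, \<open>ow\<close> can join \<open>I\<close> and
  \<open>b\<close> separates it from \<open>ew\<close>; this kills the third edge at
  \<open>w\<close>.\<close>

lemma ring_long:
  assumes ring: "ring_threads v w p1 p2 x1 q1 q2 x2 r1 r2 x3 s1 s2 y1 y2 y3 ov ow C Tv ev Tw ew"
    and ext: "extendable E V (C \<union> Tv \<union> Tw) I" and I: "\<forall>u\<in>C \<union> Tv \<union> Tw. u \<notin> I"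
    and ew: "ew \<notin> I" and ev: "Tv = {} \<Longrightarrow> ev \<notin> I"
    and b: "Tw = {ow, b}" "ow \<noteq> b" "N ow = {w, b}" "N b = {ow, ew}"
  shows False
proof -
  note r = ring_threadsD[OF ring]
  have wC: "w \<in> C" "v \<in> C" by (simp_all add: r(2))
  have CT: "u \<notin> Tv" "u \<notin> Tw" if "u \<in> C" for u using r(6) that by blast+
  have e: "ev \<notin> C" "ev \<notin> Tv" "ev \<notin> Tw" "ew \<notin> C" "ew \<notin> Tv" "ew \<notin> Tw"
    and y: "\<forall>u\<in>{y1, y2, y3}. u \<notin> Tv \<and> u \<notin> Tw" using r(7) by simp_all
  have owb: "ow \<notin> C" "ow \<notin> Tv" "ow \<notin> I" "b \<notin> C" "b \<notin> Tv" "b \<notin> I" using b(1) r(5,6) I by auto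
  have "extendable E V (insert ow (insert b (C \<union> Tv))) I" using ext by (simp add: b(1) Un_commute)
  then have "extendable E V (insert b (C \<union> Tv)) (insert ow I)"
    by (rule extendable_independent) (use b owb wC in auto)
  then have e1: "extendable E V (Tv \<union> C) (insert ow I)"
    unfolding Un_commute[of C] by (rule step_F) (use b owb e ew in auto)
  have b: "extendable E V C (insert ow I)" "ov \<notin> C" "ov \<notin> insert ow I"
    by (rule restore_before[OF r(3) e1]; use r(5,6) I e ev wC b(1) owb in blast)+
  have e2: "extendable E V (C \<union> {}) (insert ow I)" using b(1) by simp
  have B: "\<forall>u\<in>C \<union> {y1, y2, y3, ov}. u \<notin> {}" by simp
  have D: "\<forall>u\<in>insert ov C. u \<notin> insert ow I" using I b(2,3) owb by blast
  have ow: "ow \<in> {} \<or> ow \<in> insert ow I" by simp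
  obtain I' where "extendable E V {} I'" by (rule cut_before_v[OF r(1,2) e2 B D ow])
  then show False using not_colorable by (auto simp: extendable_def)
qed

text \<open>Here the cut is at \<open>v\<close>: then \<open>ov\<close> can return last, between
  \<open>v\<close> in the independent set and \<open>ev\<close> outside it.\<close>

lemma ring_mid:
  assumes ring: "ring_threads v w p1 p2 x1 q1 q2 x2 r1 r2 x3 s1 s2 y1 y2 y3 ov ow C Tv ev Tw ew"
    and ext: "extendable E V (C \<union> Tv \<union> Tw) I" and I: "\<forall>u\<in>C \<union> Tv \<union> Tw. u \<notin> I"
    and ev: "ev \<notin> I" and ew: "Tw = {} \<Longrightarrow> ew \<notin> I" and Tv: "Tv = {ov}"
  shows False
proof -
  note r = ring_threadsD[OF ring]
  have wC: "w \<in> C" "v \<in> C" by (simp_all add: r(2))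
  have CT: "u \<notin> Tv" "u \<notin> Tw" if "u \<in> C" for u using r(6) that by blast+
  have e: "ev \<notin> C" "ev \<notin> Tv" "ev \<notin> Tw" "ew \<notin> C" "ew \<notin> Tv" "ew \<notin> Tw"
    and y: "\<forall>u\<in>{y1, y2, y3}. u \<notin> Tv \<and> u \<notin> Tw" using r(7) by simp_all
  have e1: "extendable E V (Tw \<union> (C \<union> Tv)) I" using ext by (simp add: Un_commute Un_left_commute)
  have b: "extendable E V (C \<union> Tv) I" "ow \<notin> C \<union> Tv" "ow \<notin> I"
    by (rule restore_before[OF r(4) e1]; use r(5,6) I e ew wC in blast)+
  have B: "\<forall>u\<in>C \<union> {y1, y2, y3, ow}. u \<notin> Tv" using b(2) CT y by blast
  have D: "\<forall>u\<in>insert ow C. u \<notin> I" using I b(3) by blast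
  have ov: "ov \<in> Tv" by (simp add: Tv)
  obtain I' where I': "extendable E V Tv I'" "insert v I \<subseteq> I'" "I' \<subseteq> I \<union> {v, p2, q2, r2}"
    by (rule cut_at_v[OF r(1,2) b(1) B D ov])
  have sub: "{v, p2, q2, r2} \<subseteq> C" by (simp add: r(2))
  have "v \<in> I'" "Tv \<inter> I' = {}" "ev \<notin> I'" using I' I sub CT ev e by blast+
  then show False
    by (intro restore_after[OF r(3) I'(1)]) (use CT e wC Tv in auto)
qed

lemma no_ring:
  assumes ring: "ring_threads v w p1 p2 x1 q1 q2 x2 r1 r2 x3 s1 s2 y1 y2 y3 ov ow C Tv ev Tw ew"
    and ne: "Tv \<noteq> {} \<or> Tw \<noteq> {}"
  shows False
proof -
  note r = ring_threadsD[OF ring] and sym = ring_threads_sym[OF ring]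
  define R where "R = C \<union> Tv \<union> Tw"
  have "{v, w, p1, p2, x1, q1, q2, x2, r1, r2, x3, s1, s2} \<subseteq> V"
    using ring_N[OF r(1), THEN N_insert_in_V] by (simp only: insert_subset empty_subsetI simp_thms)
  moreover have "Tv \<subseteq> V" "Tw \<subseteq> V"
    using r(3,4) by (auto simp: off_thread_def intro: N_insert_in_V)
  ultimately have "R \<subseteq> V" "R \<noteq> {}" by (auto simp: R_def r(2))
  from critical[OF this] obtain c where c: "star_coloring E (V - R) c" ..
  define I where "I = {v \<in> V - R. c v = 3}"
  have ext: "extendable E V (C \<union> Tv \<union> Tw) I"
    unfolding extendable_def R_def[symmetric] using c by (intro exI[of _ c]) (auto simp: I_def)
  have I: "\<forall>u\<in>C \<union> Tv \<union> Tw. u \<notin> I" by (auto simp: I_def R_def)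
  have ext': "extendable E V (C \<union> Tw \<union> Tv) I" and I': "\<forall>u\<in>C \<union> Tw \<union> Tv. u \<notin> I"
    using ext I by (simp_all add: Un_ac)
  \<comment> \<open>If both ends lie in \<open>I\<close>, the nonempty thread decides which
    orientation of the cycle is used.\<close>
  consider "ew \<in> I" "Tv = {} \<longrightarrow> ev \<notin> I" | "ev \<in> I" "Tw = {} \<longrightarrow> ew \<notin> I" | "ew \<notin> I" "ev \<notin> I"
    using ne by blast
  then show False
  proof cases
    case 1
    then show False using ring_forward[OF ring ext I] by blast
  next
    case 2
    then show False using ring_forward[OF sym ext' I'] by blast
  next
    case 3
    consider "Tv = {ov}" | "Tw = {ow}" | b where "Tw = {ow, b}" "ow \<noteq> b" "N ow = {w, b}" "N b = {ow, ew}"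
      | b where "Tv = {ov, b}" "ov \<noteq> b" "N ov = {v, b}" "N b = {ov, ev}"
      using r(3,4) ne unfolding off_thread_def by blast
    then show False
    proof cases
      case 1
      then show False using ring_mid[OF ring ext I] 3 by blast
    next
      case 2
      then show False using ring_mid[OF sym ext' I'] 3 by blast
    next
      case (3 b)
      then show False using ring_long[OF ring ext I _ _ 3] \<open>ew \<notin> I\<close> \<open>ev \<notin> I\<close> by blast
    next
      case (4 b)
      then show False using ring_long[OF sym ext' I' _ _ 4] \<open>ew \<notin> I\<close> \<open>ev \<notin> I\<close> by blast
    qed
  qed
qed

section \<open>Separating a ring from its surroundings by the girth\<close>

lemma nb_walk_join:
  "nb_walk (u # es) \<Longrightarrow> nb_walk (u # zs) \<Longrightarrow> es = [] \<or> zs = [] \<or> hd es \<noteq> hd zs \<Longrightarrow>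
    nb_walk (rev es @ u # zs)"
proof (induction es arbitrary: u zs)
  case (Cons e es)
  have "nb_walk (e # es)" using Cons.prems(1) by (rule nb_walk_tl)
  moreover have "nb_walk (e # u # zs)"
    using Cons.prems N_sym by (cases zs; cases es) auto
  moreover have "es = [] \<or> u # zs = [] \<or> hd es \<noteq> hd (u # zs)"
    using Cons.prems(1) by (cases es) auto
  ultimately have "nb_walk (rev es @ e # u # zs)" by (rule Cons.IH)
  then show ?case by simp
qed simp

text \<open>Glued at \<open>u\<close>, the two walks have at most 13 vertices in all and form a
  path.\<close>

lemma nb_walk_join_disjoint:
  assumes "nb_walk (u # es)" "nb_walk (u # zs)" "es = [] \<or> zs = [] \<or> hd es \<noteq> hd zs"
    "length es + length zs \<le> 12"
  shows "set es \<inter> set (u # zs) = {}"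
  using nb_walk_distinct[OF nb_walk_join[OF assms(1-3)]] assms(4) by auto

lemma ring_threads_intro:
  assumes dist: "distinct [v, w, p1, p2, x1, q1, q2, x2, r1, r2, x3, s1, s2]"
    and N: "N v = {s2, w, ov}" "N w = {v, p1, ow}"
     "N p1 = {w, p2}" "N p2 = {p1, x1}" "N x1 = {p2, y1, q1}"
     "N q1 = {x1, q2}" "N q2 = {q1, x2}" "N x2 = {q2, y2, r1}"
     "N r1 = {x2, r2}" "N r2 = {r1, x3}" "N x3 = {r2, y3, s1}"
     "N s1 = {x3, s2}" "N s2 = {s1, v}"
    and ne: "ov \<noteq> s2" "ov \<noteq> w" "ow \<noteq> v" "ow \<noteq> p1" "y1 \<noteq> p2" "y1 \<noteq> q1" "y2 \<noteq> q2" "y2 \<noteq> r1"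
      "y3 \<noteq> r2" "y3 \<noteq> s1"
    and off: "off_thread v ov Tv ev" "off_thread w ow Tw ew"
    and es: "nb_walk (v # es)" "es \<noteq> []" "hd es = ov" "length es \<le> 3" "set es = insert ev Tv" "ev \<notin> Tv"
    and fs: "nb_walk (w # fs)" "fs \<noteq> []" "hd fs = ow" "length fs \<le> 3" "set fs = insert ew Tw" "ew \<notin> Tw"
    and C: "C = {v, w, p1, p2, x1, q1, q2, x2, r1, r2, x3, s1, s2}"
  shows "ring_threads v w p1 p2 x1 q1 q2 x2 r1 r2 x3 s1 s2 y1 y2 y3 ov ow C Tv ev Tw ew"
proof -
  have "distinct (rev [v, w, p1, p2, x1, q1, q2, x2, r1, r2, x3, s1, s2])"
    using dist by (simp only: distinct_rev)
  note d = dist[simplified] this[simplified] and n = ne ne[symmetric]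
  have y: "y1 \<notin> C" "y2 \<notin> C" "y3 \<notin> C"
  proof -
    \<comment> \<open>These are 13 vertices, the most that \<open>nb_walk_distinct\<close> admits.
      The only ring vertex left out is \<open>p2\<close>, a neighbour of \<open>x1\<close> already
      known to differ from \<open>y1\<close>.\<close>
    have "nb_walk [y1, x1, q1, q2, x2, r1, r2, x3, s1, s2, v, w, p1]" by (simp add: N d n N_sym[of y1 x1])
    from nb_walk_distinct[OF this] show "y1 \<notin> C" by (simp add: C n)
    have "nb_walk [y2, x2, r1, r2, x3, s1, s2, v, w, p1, p2, x1, q1]" by (simp add: N d n N_sym[of y2 x2])
    from nb_walk_distinct[OF this] show "y2 \<notin> C" by (simp add: C n)
    have "nb_walk [y3, x3, s1, s2, v, w, p1, p2, x1, q1, q2, x2, r1]" by (simp add: N d n N_sym[of y3 x3])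
    from nb_walk_distinct[OF this] show "y3 \<notin> C" by (simp add: C n)
  qed
  \<comment> \<open>Three thread vertices and nine ring vertices reach the limit 12. Going round in
    both directions covers the whole ring.\<close>
  have fwd: "set es \<inter> set (v # [w, p1, p2, x1, q1, q2, x2, r1, r2]) = {}"
    by (rule nb_walk_join_disjoint[OF es(1)]) (use es in \<open>simp_all add: N d n\<close>)
  have bwd: "set es \<inter> set (v # [s2, s1, x3, r2, r1, x2, q2, q1, x1]) = {}"
    by (rule nb_walk_join_disjoint[OF es(1)]) (use es in \<open>simp_all add: N d n\<close>)
  have esC: "set es \<inter> C = {}" using fwd bwd by (auto simp: C)
  have fwd: "set fs \<inter> set (w # [p1, p2, x1, q1, q2, x2, r1, r2, x3]) = {}"
    by (rule nb_walk_join_disjoint[OF fs(1)]) (use fs in \<open>simp_all add: N d n\<close>)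
  have bwd: "set fs \<inter> set (w # [v, s2, s1, x3, r2, r1, x2, q2, q1]) = {}"
    by (rule nb_walk_join_disjoint[OF fs(1)]) (use fs in \<open>simp_all add: N d n\<close>)
  have fsC: "set fs \<inter> C = {}" using fwd bwd by (auto simp: C)
  have "set es \<inter> set (v # [w, p1, p2, x1, y1]) = {}"
    by (rule nb_walk_join_disjoint[OF es(1)]) (use es in \<open>simp_all add: N d n\<close>)
  moreover have "set es \<inter> set (v # [w, p1, p2, x1, q1, q2, x2, y2]) = {}"
    by (rule nb_walk_join_disjoint[OF es(1)]) (use es in \<open>simp_all add: N d n\<close>)
  moreover have "set es \<inter> set (v # [s2, s1, x3, y3]) = {}"
    by (rule nb_walk_join_disjoint[OF es(1)]) (use es in \<open>simp_all add: N d n\<close>)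
  moreover have "set fs \<inter> set (w # [p1, p2, x1, y1]) = {}"
    by (rule nb_walk_join_disjoint[OF fs(1)]) (use fs in \<open>simp_all add: N d n\<close>)
  moreover have "set fs \<inter> set (w # [p1, p2, x1, q1, q2, x2, y2]) = {}"
    by (rule nb_walk_join_disjoint[OF fs(1)]) (use fs in \<open>simp_all add: N d n\<close>)
  moreover have "set fs \<inter> set (w # [v, s2, s1, x3, y3]) = {}"
    by (rule nb_walk_join_disjoint[OF fs(1)]) (use fs in \<open>simp_all add: N d n\<close>)
  ultimately have yT: "\<forall>u\<in>{y1, y2, y3}. u \<notin> set es \<and> u \<notin> set fs" by auto
  have "nb_walk (v # w # fs)" using fs(1-3) n by (cases fs) (auto simp: N)
  then have "set es \<inter> set (v # w # fs) = {}"
    by (intro nb_walk_join_disjoint[OF es(1)]) (use es fs in \<open>simp_all add: n\<close>)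
  then have esfs: "set es \<inter> set fs = {}" by auto
  have ovow: "ov \<in> set es" "ow \<in> set fs" using es fs by (metis hd_in_set)+
  have "ring v w p1 p2 x1 q1 q2 x2 r1 r2 x3 s1 s2 y1 y2 y3 ov ow"
    unfolding ring_def C[symmetric]
  proof (intro conjI)
    show "\<forall>u\<in>{y1, y2, y3, ov, ow}. u \<notin> C" using y esC fsC ovow by auto
  qed (rule dist N)+
  then show ?thesis
    unfolding ring_threads_def C[symmetric] using off es(5,6) fs(5,6) esC fsC esfs y yT
    by (intro conjI) auto
qed

end

section \<open>Discharging\<close>

text \<open>Runs of false have length exactly 2, runs of true length 1 or 2. So 13 is a sum of
  blocks 3 and 4, and \<open>4 + 3 + 3 + 3\<close> is the only way.\<close>

lemma period_13_pattern:
  fixes B :: "nat \<Rightarrow> bool"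
  assumes per: "\<And>i. B (i + 13) = B i"
    and one: "\<And>i. \<not> B (i + 1) \<Longrightarrow> B i \<noteq> B (i + 2)"
    and two: "\<And>i. B (i + 1) \<Longrightarrow> \<not> (B i \<and> B (i + 2))"
  obtains k where "B k" "B (k + 1)" "\<not> B (k + 2)" "\<not> B (k + 3)" "B (k + 4)" "\<not> B (k + 5)" "\<not> B (k + 6)"
    "B (k + 7)" "\<not> B (k + 8)" "\<not> B (k + 9)" "B (k + 10)" "\<not> B (k + 11)" "\<not> B (k + 12)"
proof -
  have "\<exists>k. B k \<and> B (k + 1)"
  proof (rule ccontr)
    assume none: "\<nexists>k. B k \<and> B (k + 1)"
    have step: "B (i + 3)" if "B i" for i
    proof -
      have "\<not> B (i + 1)" using none that by auto
      then have "\<not> B (i + 2)" using one[of i] that by auto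
      then show "B (i + 3)" using one[of "i + 1"] \<open>\<not> B (i + 1)\<close> by (simp add: eval_nat_numeral)
    qed
    have "B (i + 3 * n)" if "B i" for i n
      by (induction n) (use that step in \<open>auto simp: algebra_simps\<close>, metis add.assoc add.commute)
    \<comment> \<open>Nine steps of 3 make \<open>27 = 2 * 13 + 1\<close>, a shift by one.\<close>
    then have shift: "B (i + 1)" if "B i" for i
      using per[of "i + 14"] per[of "i + 1"] that[THEN \<open>\<And>i n. B i \<Longrightarrow> B (i + 3 * n)\<close>, of 9] by (simp add: eval_nat_numeral)
    obtain i where "B i" using one[of 0] by auto
    then show False using shift none by blast
  qed
  then obtain k where k: "B k" "B (k + 1)" by blast
  have o: "\<not> B (k + 2) \<Longrightarrow> B (k + 1) \<noteq> B (k + 3)" "\<not> B (k + 3) \<Longrightarrow> B (k + 2) \<noteq> B (k + 4)"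
    "\<not> B (k + 4) \<Longrightarrow> B (k + 3) \<noteq> B (k + 5)" "\<not> B (k + 5) \<Longrightarrow> B (k + 4) \<noteq> B (k + 6)"
    "\<not> B (k + 6) \<Longrightarrow> B (k + 5) \<noteq> B (k + 7)" "\<not> B (k + 7) \<Longrightarrow> B (k + 6) \<noteq> B (k + 8)"
    "\<not> B (k + 8) \<Longrightarrow> B (k + 7) \<noteq> B (k + 9)" "\<not> B (k + 9) \<Longrightarrow> B (k + 8) \<noteq> B (k + 10)"
    "\<not> B (k + 10) \<Longrightarrow> B (k + 9) \<noteq> B (k + 11)" "\<not> B (k + 11) \<Longrightarrow> B (k + 10) \<noteq> B (k + 12)"
    "\<not> B (k + 12) \<Longrightarrow> B (k + 11) \<noteq> B k"
    using one[of "k + 1"] one[of "k + 2"] one[of "k + 3"] one[of "k + 4"] one[of "k + 5"] one[of "k + 6"]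
      one[of "k + 7"] one[of "k + 8"] one[of "k + 9"] one[of "k + 10"] one[of "k + 11"] per[of k]
    by (simp_all add: eval_nat_numeral)
  have t: "B (k + 1) \<Longrightarrow> \<not> (B k \<and> B (k + 2))" "B (k + 12) \<Longrightarrow> \<not> (B (k + 11) \<and> B k)"
    "B k \<Longrightarrow> \<not> (B (k + 12) \<and> B (k + 1))"
    "B (k + 4) \<Longrightarrow> \<not> (B (k + 3) \<and> B (k + 5))" "B (k + 5) \<Longrightarrow> \<not> (B (k + 4) \<and> B (k + 6))"
    "B (k + 8) \<Longrightarrow> \<not> (B (k + 7) \<and> B (k + 9))" "B (k + 9) \<Longrightarrow> \<not> (B (k + 8) \<and> B (k + 10))"
    using two[of k] two[of "k + 11"] two[of "k + 12"] two[of "k + 3"] two[of "k + 4"] two[of "k + 7"] two[of "k + 8"]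
      per[of k] per[of "k + 1"]
    by (simp_all add: eval_nat_numeral)
  have n2: "\<not> B (k + 2)" "\<not> B (k + 12)" using t(1,3) k by blast+
  then have n3: "\<not> B (k + 3)" "\<not> B (k + 11)" using o(1,11) k by blast+
  then have n4: "B (k + 4)" "B (k + 10)" using o(2,10) n2 by blast+
  have n5: "\<not> B (k + 5)" using t(5,7) o(5,6,8) n4 by blast
  have n9: "\<not> B (k + 9)" using t(6,7) o(5,7,4) n4 n5 by blast
  then have "\<not> B (k + 6)" "\<not> B (k + 8)" using o(4,8) n4 n5 by blast+
  moreover have "B (k + 7)" using o(5) n5 calculation by blast
  ultimately show ?thesis using that[of k] k n2 n3 n4 n5 n9 by blast
qed

section \<open>Threads at a vertex and the charge of the vertices\<close>

context critical_graph
begin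

definition big :: "'a \<Rightarrow> bool" where "big v \<longleftrightarrow> 3 \<le> card (N v)"

definition long_dart :: "'a \<Rightarrow> 'a \<Rightarrow> bool" where
  "long_dart v u \<longleftrightarrow> (\<exists>b e. N u = {v, b} \<and> N b = {u, e})"

definition mid_dart :: "'a \<Rightarrow> 'a \<Rightarrow> bool" where
  "mid_dart v u \<longleftrightarrow> (\<exists>e. N u = {v, e} \<and> big e)"

lemma not_big_iff: "v \<in> V \<Longrightarrow> \<not> big v \<longleftrightarrow> card (N v) = 2"
  using degree_ge_2[of v] by (auto simp: big_def)

lemma small_neighbours:
  assumes "u \<in> N v" "\<not> big u"
  obtains b where "N u = {v, b}" "v \<noteq> b"
proof -
  have "u \<in> V" using assms(1) N_subset by auto
  then have "card (N u) = 2" using assms(2) not_big_iff by blast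
  then obtain x y where "N u = {x, y}" "x \<noteq> y" by (auto simp: card_2_iff)
  moreover have "v \<in> N u" using assms(1) N_sym by blast
  ultimately show ?thesis using that[of x] that[of y] by (auto simp: insert_commute)
qed

lemma not_big_pair: "N v = {a, b} \<Longrightarrow> \<not> big v"
  unfolding big_def by (cases "a = b") auto

lemma dart_cases:
  assumes "u \<in> N v"
  shows "big u \<or> mid_dart v u \<or> long_dart v u"
proof (cases "big u")
  case False
  with assms obtain b where b: "N u = {v, b}" by (rule small_neighbours)
  show ?thesis
  proof (cases "big b")
    case True
    with b show ?thesis by (auto simp: mid_dart_def)
  next
    case False
    have "b \<in> N u" using b by simp
    then obtain e where "N b = {u, e}" using False by (rule small_neighbours)
    with b show ?thesis by (auto simp: long_dart_def)
  qed
qed simp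

lemma dart_exclusive:
  assumes "u \<in> N v"
  shows "mid_dart v u \<Longrightarrow> \<not> big u" "long_dart v u \<Longrightarrow> \<not> big u" "long_dart v u \<Longrightarrow> \<not> mid_dart v u"
proof -
  show "mid_dart v u \<Longrightarrow> \<not> big u" "long_dart v u \<Longrightarrow> \<not> big u"
    by (auto simp: mid_dart_def long_dart_def dest: not_big_pair)
  show "\<not> mid_dart v u" if long: "long_dart v u"
  proof
    assume "mid_dart v u"
    then obtain e where e: "N u = {v, e}" "big e" by (auto simp: mid_dart_def)
    from long obtain b e' where b: "N u = {v, b}" "N b = {u, e'}" by (auto simp: long_dart_def)
    have "\<not> big u" using b(1) by (rule not_big_pair)
    then obtain a where "N u = {v, a}" "v \<noteq> a" using assms small_neighbours by blast
    with e(1) b(1) have "b = e" by (auto simp: doubleton_eq_iff)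
    with e(2) not_big_pair[OF b(2)] show False by simp
  qed
qed

lemma off_thread_exists:
  assumes u: "u \<in> N v"
  obtains T e es where "off_thread v u T e" "nb_walk (v # es)" "es \<noteq> []" "hd es = u" "length es \<le> 3"
    "set es = insert e T" "e \<notin> T" "T = {} \<longrightarrow> big u"
proof -
  have uv: "v \<in> N u" using u N_sym by blast
  from dart_cases[OF u] consider "big u" | "\<not> big u" "mid_dart v u" | "\<not> big u" "long_dart v u" by blast
  then show ?thesis
  proof cases
    case 1
    then show ?thesis using u that[of "{}" u "[u]"] by (auto simp: off_thread_def)
  next
    case 2
    from 2(2) obtain e where e: "N u = {v, e}" "big e" by (auto simp: mid_dart_def)
    from small_neighbours[OF u 2(1)] e(1) have "v \<noteq> e" by (metis doubleton_eq_iff)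
    moreover have "e \<noteq> u" using e 2(1) by auto
    ultimately show ?thesis using u e that[of "{u}" e "[u, e]"] by (auto simp: off_thread_def)
  next
    case 3
    from 3(2) obtain b e where b: "N u = {v, b}" "N b = {u, e}" by (auto simp: long_dart_def)
    from small_neighbours[OF u 3(1)] b(1) have vb: "v \<noteq> b" by (metis doubleton_eq_iff)
    have bu: "b \<in> N u" using b by simp
    from small_neighbours[OF bu not_big_pair[OF b(2)]] b(2) have ue: "u \<noteq> e" by (metis doubleton_eq_iff)
    have "b \<noteq> u" "b \<noteq> e" using bu N_irrefl[of u] N_irrefl[of b] b by auto
    then show ?thesis using u b vb ue that[of "{u, b}" e "[u, b, e]"] by (auto simp: off_thread_def)
  qed
qed

lemma long_dart_walk:
  assumes "u \<in> N v" "long_dart v u"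
  obtains b e where "N u = {v, b}" "N b = {u, e}" "nb_walk [v, u, b, e]"
proof -
  from assms(2) obtain b e where b: "N u = {v, b}" "N b = {u, e}" by (auto simp: long_dart_def)
  from small_neighbours[OF assms(1) not_big_pair[OF b(1)]] b(1) have vb: "v \<noteq> b" by (metis doubleton_eq_iff)
  have bu: "b \<in> N u" using b by simp
  from small_neighbours[OF bu not_big_pair[OF b(2)]] b(2) have ue: "u \<noteq> e" by (metis doubleton_eq_iff)
  show ?thesis by (rule that[OF b]) (use assms(1) b vb ue in auto)
qed

lemma mid_dart_walk:
  assumes "u \<in> N v" "mid_dart v u"
  obtains e where "N u = {v, e}" "nb_walk [v, u, e]"
proof -
  from assms(2) obtain e where e: "N u = {v, e}" by (auto simp: mid_dart_def)
  from small_neighbours[OF assms(1) not_big_pair[OF e]] e have "v \<noteq> e" by (metis doubleton_eq_iff)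
  then show ?thesis by (intro that[OF e]) (use assms(1) e in auto)
qed

text \<open>Two threads glued at \<open>v\<close> form a walk of at most 7 vertices, so the girth
  provides the distinctness that the reducible configurations require.\<close>

lemma three_long_darts:
  assumes N: "N v = {a, b, c}" and neq: "a \<noteq> b" "a \<noteq> c" "b \<noteq> c"
  shows "\<not> (long_dart v a \<and> long_dart v b \<and> long_dart v c)"
    "\<not> (long_dart v a \<and> long_dart v b \<and> mid_dart v c)"
    "\<not> (long_dart v a \<and> mid_dart v b \<and> mid_dart v c)"
proof -
  have in_N: "a \<in> N v" "b \<in> N v" "c \<in> N v" by (simp_all add: N)
  show "\<not> (long_dart v a \<and> long_dart v b \<and> long_dart v c)"
  proof
    assume "long_dart v a \<and> long_dart v b \<and> long_dart v c"
    then obtain a' A b' B c' C where "N a = {v, a'}" "N a' = {a, A}" "nb_walk [v, a, a', A]"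
      "N b = {v, b'}" "N b' = {b, B}" "nb_walk [v, b, b', B]"
      "N c = {v, c'}" "N c' = {c, C}" "nb_walk [v, c, c', C]"
      using in_N by (metis long_dart_walk)
    then show False
      using no_three_long[of A a' a v b b' B c c' C] N neq
        nb_walk_join[of v "[a, a', A]" "[b, b', B]"] nb_walk_join[of v "[a, a', A]" "[c, c', C]"]
        nb_walk_join[of v "[b, b', B]" "[c, c', C]"] by simp
  qed
  show "\<not> (long_dart v a \<and> long_dart v b \<and> mid_dart v c)"
  proof
    assume "long_dart v a \<and> long_dart v b \<and> mid_dart v c"
    then obtain a' A b' B C where "N a = {v, a'}" "N a' = {a, A}" "nb_walk [v, a, a', A]"
      "N b = {v, b'}" "N b' = {b, B}" "nb_walk [v, b, b', B]"
      "N c = {v, C}" "nb_walk [v, c, C]"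
      using in_N by (metis long_dart_walk mid_dart_walk)
    then show False
      using no_two_long_one_mid[of A a' a v b b' B c C] N neq
        nb_walk_join[of v "[a, a', A]" "[b, b', B]"] nb_walk_join[of v "[a, a', A]" "[c, C]"]
        nb_walk_join[of v "[b, b', B]" "[c, C]"] by simp
  qed
  show "\<not> (long_dart v a \<and> mid_dart v b \<and> mid_dart v c)"
  proof
    assume "long_dart v a \<and> mid_dart v b \<and> mid_dart v c"
    then obtain a' A B C where "N a = {v, a'}" "N a' = {a, A}" "nb_walk [v, a, a', A]"
      "N b = {v, B}" "nb_walk [v, b, B]" "N c = {v, C}" "nb_walk [v, c, C]"
      using in_N by (metis long_dart_walk mid_dart_walk)
    then show False
      using no_one_long_two_mid[of A a' a v b B c C] N neq
        nb_walk_join[of v "[a, a', A]" "[b, B]"] nb_walk_join[of v "[a, a', A]" "[c, C]"]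
        nb_walk_join[of v "[b, B]" "[c, C]"] by simp
  qed
qed

lemma four_long_darts:
  assumes N: "N v = {a, b, c, d}" and neq: "distinct [a, b, c, d]"
  shows "\<not> (long_dart v a \<and> long_dart v b \<and> long_dart v c \<and> long_dart v d)"
proof
  have in_N: "a \<in> N v" "b \<in> N v" "c \<in> N v" "d \<in> N v" by (simp_all add: N)
  assume "long_dart v a \<and> long_dart v b \<and> long_dart v c \<and> long_dart v d"
  then obtain a' A b' B c' C d' D where "N a = {v, a'}" "N a' = {a, A}" "nb_walk [v, a, a', A]"
    "N b = {v, b'}" "N b' = {b, B}" "nb_walk [v, b, b', B]"
    "N c = {v, c'}" "N c' = {c, C}" "nb_walk [v, c, c', C]"
    "N d = {v, d'}" "N d' = {d, D}" "nb_walk [v, d, d', D]"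
    using in_N by (metis long_dart_walk)
  then show False
    using no_four_long[of A a' a v b b' B c c' C d d' D] N neq
      nb_walk_join[of v "[a, a', A]" "[b, b', B]"] nb_walk_join[of v "[a, a', A]" "[c, c', C]"]
      nb_walk_join[of v "[b, b', B]" "[c, c', C]"] nb_walk_join[of v "[a, a', A]" "[d, d', D]"]
      nb_walk_join[of v "[b, b', B]" "[d, d', D]"] nb_walk_join[of v "[c, c', C]" "[d, d', D]"] by simp
qed

definition long_degree :: "'a \<Rightarrow> nat" where "long_degree v = card {u \<in> N v. long_dart v u}"
definition mid_degree :: "'a \<Rightarrow> nat" where "mid_degree v = card {u \<in> N v. mid_dart v u}"
definition short_degree :: "'a \<Rightarrow> nat" where "short_degree v = card {u \<in> N v. big u}"

text \<open>All weights are three times the charge that a 13-cycle receives from a vertex for an edge at that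
  vertex, depending on the number of inner vertices of the thread (2, 1 or 0) that starts with this edge.
  An edge lies on at most two of the cycles.\<close>

definition long_weight :: "'a \<Rightarrow> nat" where
  "long_weight v = (if card (N v) = 3 then 0 else 3)"
text \<open>Degree 3 with three mid darts keeps \<open>8 - 6 = 2\<close>, a third for each of the
  six sides of its edges. Degree 4 with three long darts and a mid dart keeps
  \<open>20 - 14 = 6\<close>, which goes to the sides of the long ones.\<close>

definition mid_weight :: "'a \<Rightarrow> nat" where
  "mid_weight v = (if card (N v) = 3 \<and> mid_degree v = 3 then 1
     else if card (N v) = 4 \<and> long_degree v = 3 then 0 else 3)"
definition short_weight :: "'a \<Rightarrow> nat" where
  "short_weight v = (if card (N v) = 3 \<and> short_degree v < 2 then 0 else 3)"

definition weight :: "'a \<Rightarrow> 'a \<Rightarrow> nat" where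
  "weight v u = (if big v then if big u then short_weight v else if mid_dart v u then mid_weight v
     else long_weight v else 0)"

text \<open>A vertex of degree 2 lacks 4. It gets 2 from both neighbours if it is alone on its
  thread, and all 4 from its one big neighbour otherwise.\<close>

definition cost :: "'a \<Rightarrow> 'a \<Rightarrow> nat" where
  "cost v u = (if big v then if big u then 0 else if mid_dart v u then 2 else 4 else 0)"

lemma N_partition:
  "N v = {u \<in> N v. long_dart v u} \<union> {u \<in> N v. mid_dart v u} \<union> {u \<in> N v. big u}"
  using dart_cases by blast

lemma sum_darts:
  fixes F :: "'a \<Rightarrow> nat"
  assumes "\<And>u. u \<in> N v \<Longrightarrow> F u = (if big u then s else if mid_dart v u then m else l)"
  shows "(\<Sum>u\<in>N v. F u) = l * long_degree v + m * mid_degree v + s * short_degree v"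
proof -
  let ?L = "{u \<in> N v. long_dart v u}" and ?M = "{u \<in> N v. mid_dart v u}" and ?S = "{u \<in> N v. big u}"
  have fin: "finite ?L" "finite ?M" "finite ?S" using finite_N by auto
  have disj: "?L \<inter> ?M = {}" "(?L \<union> ?M) \<inter> ?S = {}" using dart_exclusive by blast+
  have "(\<Sum>u\<in>N v. F u) = (\<Sum>u\<in>?L \<union> ?M \<union> ?S. F u)" by (rule sum.cong[OF N_partition]) simp
  also have "\<dots> = (\<Sum>u\<in>?L. F u) + (\<Sum>u\<in>?M. F u) + (\<Sum>u\<in>?S. F u)"
    using fin disj by (simp add: sum.union_disjoint)
  also have "(\<Sum>u\<in>?L. F u) = (\<Sum>u\<in>?L. l)"
    using assms dart_exclusive by (intro sum.cong) auto
  also have "(\<Sum>u\<in>?M. F u) = (\<Sum>u\<in>?M. m)"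
    using assms dart_exclusive by (intro sum.cong) auto
  also have "(\<Sum>u\<in>?S. F u) = (\<Sum>u\<in>?S. s)"
    using assms by (intro sum.cong) auto
  finally show ?thesis by (simp add: long_degree_def mid_degree_def short_degree_def)
qed

lemma degree_split: "card (N v) = long_degree v + mid_degree v + short_degree v"
proof -
  have "(\<Sum>u\<in>N v. 1) = 1 * long_degree v + 1 * mid_degree v + 1 * short_degree v"
    by (rule sum_darts) simp
  then show ?thesis by simp
qed

lemma degree_3_restriction:
  assumes "card (N v) = 3"
  shows "\<not> (long_degree v = 3 \<and> mid_degree v = 0)" "\<not> (long_degree v = 2 \<and> mid_degree v = 1)"
    "\<not> (long_degree v = 1 \<and> mid_degree v = 2)"
proof -
  from assms obtain a b c where N: "N v = {a, b, c}" "a \<noteq> b" "a \<noteq> c" "b \<noteq> c" by (auto simp: card_3_iff)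
  have N': "N v = {b, a, c}" "N v = {c, a, b}" "N v = {a, c, b}" "N v = {b, c, a}" "N v = {c, b, a}"
    using N(1) by auto
  note t = three_long_darts[OF N] three_long_darts[OF N'(1) N(2)[symmetric] N(4,3)]
    three_long_darts[OF N'(2) N(3,4)[symmetric] N(2)] three_long_darts[OF N'(3) N(3,2) N(4)[symmetric]]
    three_long_darts[OF N'(4) N(4) N(2,3)[symmetric]]
  have l: "long_degree v = of_bool (long_dart v a) + of_bool (long_dart v b) + of_bool (long_dart v c)"
  proof -
    have "long_degree v = (\<Sum>u\<in>N v. of_bool (long_dart v u))"
      using finite_N by (simp add: long_degree_def Int_def)
    then show ?thesis using N(2-4) by (simp add: N(1))
  qed
  have m: "mid_degree v = of_bool (mid_dart v a) + of_bool (mid_dart v b) + of_bool (mid_dart v c)"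
  proof -
    have "mid_degree v = (\<Sum>u\<in>N v. of_bool (mid_dart v u))"
      using finite_N by (simp add: mid_degree_def Int_def)
    then show ?thesis using N(2-4) by (simp add: N(1))
  qed
  have ex: "\<not> (long_dart v a \<and> mid_dart v a)" "\<not> (long_dart v b \<and> mid_dart v b)" "\<not> (long_dart v c \<and> mid_dart v c)"
    using dart_exclusive(3)[of _ v] N(1) by blast+
  show "\<not> (long_degree v = 3 \<and> mid_degree v = 0)" "\<not> (long_degree v = 2 \<and> mid_degree v = 1)"
    "\<not> (long_degree v = 1 \<and> mid_degree v = 2)"
    unfolding l m
    by (cases "long_dart v a"; cases "long_dart v b"; cases "long_dart v c"; cases "mid_dart v a";
        cases "mid_dart v b"; cases "mid_dart v c"; use t ex in simp)+
qed

lemma degree_4_restriction: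
  assumes "card (N v) = 4"
  shows "long_degree v \<le> 3"
proof (rule ccontr)
  assume "\<not> long_degree v \<le> 3"
  moreover have "long_degree v \<le> card (N v)" using degree_split by simp
  ultimately have "card {u \<in> N v. long_dart v u} = card (N v)" using assms by (simp add: long_degree_def)
  then have all: "{u \<in> N v. long_dart v u} = N v" using finite_N by (intro card_subset_eq) auto
  from assms have "card (N v) = Suc 3" by simp
  then obtain a M where a: "N v = insert a M" "a \<notin> M" "card M = 3"
    unfolding card_Suc_eq by blast
  then obtain b c d where "M = {b, c, d}" "b \<noteq> c" "b \<noteq> d" "c \<noteq> d" by (auto simp: card_3_iff)
  with a have N: "N v = {a, b, c, d}" "distinct [a, b, c, d]" by auto
  then have "a \<in> N v" "b \<in> N v" "c \<in> N v" "d \<in> N v" by auto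
  then show False using four_long_darts[OF N] all by blast
qed

text \<open>Everything is scaled by 3. Unscaled, a dart takes at most 4 for its thread and 1 for
  each of its two sides, and \<open>12 d - 28 >= 6 d\<close> for \<open>d >= 5\<close>. Degrees 3
  and 4 are finite checks; the excluded patterns are those that would overdraw the charges 8 and
  20.\<close>

lemma charge_arith:
  fixes d l m s :: nat
  assumes "d = l + m + s" "3 \<le> d"
    and "d = 3 \<Longrightarrow> \<not> (l = 3 \<and> m = 0) \<and> \<not> (l = 2 \<and> m = 1) \<and> \<not> (l = 1 \<and> m = 2)"
    and "d = 4 \<Longrightarrow> l \<le> 3"
  shows "84 + 3 * (4 * l + 2 * m) + 2 * ((if d = 3 then 0 else 3) * l +
     (if d = 3 \<and> m = 3 then 1 else if d = 4 \<and> l = 3 then 0 else 3) * m +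
     (if d = 3 \<and> s < 2 then 0 else 3) * s) \<le> 36 * d"
proof -
  consider "d = 3" | "d = 4" | "5 \<le> d" using assms(2) by linarith
  then show ?thesis
  proof cases
    case 1
    then have "l = 0 \<or> l = 1 \<or> l = 2 \<or> l = 3" "m = 0 \<or> m = 1 \<or> m = 2 \<or> m = 3" "s = 3 - l - m"
      using assms(1) by auto
    then show ?thesis using assms(1,3) 1 by auto
  next
    case 2
    then have "l = 0 \<or> l = 1 \<or> l = 2 \<or> l = 3" using assms(4) by auto
    then show ?thesis using assms(1) 2 by auto
  next
    case 3
    then show ?thesis using assms(1) by auto
  qed
qed

lemma charge_big:
  assumes "big v"
  shows "84 + 3 * (\<Sum>u\<in>N v. cost v u) + 2 * (\<Sum>u\<in>N v. weight v u) \<le> 36 * card (N v)"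
proof -
  have c: "(\<Sum>u\<in>N v. cost v u) = 4 * long_degree v + 2 * mid_degree v + 0 * short_degree v"
    by (rule sum_darts) (use assms in \<open>simp add: cost_def\<close>)
  have w: "(\<Sum>u\<in>N v. weight v u) = long_weight v * long_degree v + mid_weight v * mid_degree v
      + short_weight v * short_degree v"
    by (rule sum_darts) (use assms in \<open>simp add: weight_def\<close>)
  show ?thesis
    unfolding c w long_weight_def mid_weight_def short_weight_def
    using charge_arith[of "card (N v)" "long_degree v" "mid_degree v" "short_degree v"]
      degree_split[of v] degree_3_restriction[of v] degree_4_restriction[of v] assms
    by (simp add: big_def)
qed

lemma sum_darts_swap:
  fixes F :: "'a \<Rightarrow> 'a \<Rightarrow> nat"
  shows "(\<Sum>v\<in>V. \<Sum>u\<in>N v. F v u) = (\<Sum>u\<in>V. \<Sum>v\<in>N u. F v u)"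
proof -
  have fin: "finite V" using simple by (simp add: finite_simple_graph_def)
  have N: "{u. u \<in> V \<and> u \<in> N v} = N v" "{u. u \<in> V \<and> v \<in> N u} = N v" for v
    using N_subset[of v] nbs_commute[of _ E v] by auto
  have "(\<Sum>v\<in>V. \<Sum>u | u \<in> V \<and> u \<in> N v. F v u) = (\<Sum>u\<in>V. \<Sum>v | v \<in> V \<and> u \<in> N v. F v u)"
    by (rule sum.swap_restrict[OF fin fin])
  then show ?thesis by (simp only: N)
qed

lemma cost_into_small:
  assumes u: "u \<in> V" "\<not> big u"
  shows "4 \<le> (\<Sum>v\<in>N u. cost v u)"
proof -
  have "card (N u) = 2" using u not_big_iff by blast
  then obtain x y where N: "N u = {x, y}" "x \<noteq> y" by (auto simp: card_2_iff)
  have md: "mid_dart x u \<longleftrightarrow> big y" "mid_dart y u \<longleftrightarrow> big x"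
    using N by (auto simp: mid_dart_def doubleton_eq_iff)
  have "\<not> (\<not> big x \<and> \<not> big y)"
  proof
    assume "\<not> big x \<and> \<not> big y"
    moreover have "x \<in> N u" "y \<in> N u" using N by auto
    ultimately obtain x' y' where x': "N x = {u, x'}" "u \<noteq> x'" "N y = {u, y'}" "u \<noteq> y'"
      by (meson small_neighbours)
    have "x' \<in> N x" using x'(1) by simp
    then have "nb_walk [x', x, u, y, y']" using x' N N_sym[of x' x] by simp
    then show False
      by (rule no_long_thread) (use x' N in \<open>simp_all add: insert_commute\<close>)
  qed
  then show ?thesis using u N(2) md by (auto simp: N(1) cost_def)
qed

lemma sum_cost: "4 * card {u \<in> V. \<not> big u} \<le> (\<Sum>v\<in>V. \<Sum>u\<in>N v. cost v u)"
proof -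
  have fin: "finite V" using simple by (simp add: finite_simple_graph_def)
  have "4 * card {u \<in> V. \<not> big u} = (\<Sum>u | u \<in> V \<and> \<not> big u. 4)" by simp
  also have "\<dots> \<le> (\<Sum>u | u \<in> V \<and> \<not> big u. \<Sum>v\<in>N u. cost v u)"
    by (rule sum_mono) (use cost_into_small in auto)
  also have "\<dots> \<le> (\<Sum>u\<in>V. \<Sum>v\<in>N u. cost v u)"
    using fin by (intro sum_mono2) auto
  also have "\<dots> = (\<Sum>v\<in>V. \<Sum>u\<in>N v. cost v u)" by (rule sum_darts_swap[symmetric])
  finally show ?thesis .
qed

lemma charge_total:
  "84 * card V + 2 * (\<Sum>v\<in>V. \<Sum>u\<in>N v. weight v u) \<le> 36 * (\<Sum>v\<in>V. card (N v))"
proof -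
  have fin: "finite V" using simple by (simp add: finite_simple_graph_def)
  \<comment> \<open>At degree 2 both sides equal 84; the correction 12 is three times the missing 4
    and is balanced by \<open>sum_cost\<close>.\<close>
  have "84 + 3 * (\<Sum>u\<in>N v. cost v u) + 2 * (\<Sum>u\<in>N v. weight v u) \<le> 36 * card (N v) + 12 * of_bool (\<not> big v)"
    if "v \<in> V" for v
  proof (cases "big v")
    case True
    then show ?thesis using charge_big by simp
  next
    case False
    then show ?thesis using not_big_iff[OF that] by (simp add: cost_def weight_def)
  qed
  then have "(\<Sum>v\<in>V. 84 + 3 * (\<Sum>u\<in>N v. cost v u) + 2 * (\<Sum>u\<in>N v. weight v u))
    \<le> (\<Sum>v\<in>V. 36 * card (N v) + 12 * of_bool (\<not> big v))"
    by (rule sum_mono)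
  moreover have "(\<Sum>v\<in>V. of_bool (\<not> big v)) = card {u \<in> V. \<not> big u}"
    using fin by (simp add: Int_def)
  ultimately show ?thesis
    using sum_cost by (simp add: sum.distrib sum_distrib_left[symmetric])
qed

text \<open>Both orientations of \<open>e\<close> are added, without choosing an order of its
  ends.\<close>

definition edge_weight :: "'a set \<Rightarrow> nat" where
  "edge_weight e = (\<Sum>v\<in>e. \<Sum>u\<in>e - {v}. weight v u)"

lemma edge_weight_pair: "u \<noteq> v \<Longrightarrow> edge_weight {u, v} = weight u v + weight v u"
  by (simp add: edge_weight_def insert_Diff_if)

lemma sum_over_edges:
  fixes F :: "'a \<Rightarrow> 'a \<Rightarrow> nat"
  shows "(\<Sum>e\<in>E. \<Sum>v\<in>e. \<Sum>u\<in>e - {v}. F v u) = (\<Sum>v\<in>V. \<Sum>u\<in>N v. F v u)"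
proof -
  have fin: "finite V" and EV: "\<And>e. e \<in> E \<Longrightarrow> e \<subseteq> V" "\<And>e. e \<in> E \<Longrightarrow> card e = 2"
    using simple by (auto simp: finite_simple_graph_def)
  have finE: "finite E" using fin EV(1) by (meson Pow_iff finite_Pow_iff finite_subset subsetI)
  have "(\<Sum>e\<in>E. \<Sum>v\<in>e. \<Sum>u\<in>e - {v}. F v u) = (\<Sum>e\<in>E. \<Sum>v | v \<in> V \<and> v \<in> e. \<Sum>u\<in>e - {v}. F v u)"
  proof (rule sum.cong[OF refl])
    fix e assume "e \<in> E"
    then have "{v. v \<in> V \<and> v \<in> e} = e" using EV(1) by auto
    then show "(\<Sum>v\<in>e. \<Sum>u\<in>e - {v}. F v u) = (\<Sum>v | v \<in> V \<and> v \<in> e. \<Sum>u\<in>e - {v}. F v u)" by simp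
  qed
  also have "\<dots> = (\<Sum>v\<in>V. \<Sum>e | e \<in> E \<and> v \<in> e. \<Sum>u\<in>e - {v}. F v u)"
    by (rule sum.swap_restrict[OF finE fin])
  also have "\<dots> = (\<Sum>v\<in>V. \<Sum>u\<in>N v. F v u)"
  proof (rule sum.cong[OF refl])
    fix v assume "v \<in> V"
    have img: "{e. e \<in> E \<and> v \<in> e} = (\<lambda>u. {v, u}) ` N v"
    proof (intro equalityI subsetI)
      fix e assume "e \<in> {e. e \<in> E \<and> v \<in> e}"
      then have e: "e \<in> E" "v \<in> e" by auto
      from EV(2)[OF e(1)] obtain x y where "e = {x, y}" by (meson card_2_iff)
      with e have "e = {v, x} \<or> e = {v, y}" by auto
      with e show "e \<in> (\<lambda>u. {v, u}) ` N v" by (auto simp: nbs_def)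
    qed (auto simp: nbs_def)
    have inj: "inj_on (\<lambda>u. {v, u}) (N v)" by (auto simp: inj_on_def doubleton_eq_iff)
    have "(\<Sum>e | e \<in> E \<and> v \<in> e. \<Sum>u\<in>e - {v}. F v u) = (\<Sum>u\<in>N v. \<Sum>w\<in>{v, u} - {v}. F v w)"
      unfolding img by (subst sum.reindex[OF inj]) simp
    also have "\<dots> = (\<Sum>u\<in>N v. F v u)"
    proof (rule sum.cong[OF refl])
      fix u assume "u \<in> N v"
      then have "{v, u} - {v} = {u}" using N_irrefl by auto
      then show "(\<Sum>w\<in>{v, u} - {v}. F v w) = F v u" by simp
    qed
    finally show "(\<Sum>e | e \<in> E \<and> v \<in> e. \<Sum>u\<in>e - {v}. F v u) = (\<Sum>u\<in>N v. F v u)" .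
  qed
  finally show ?thesis .
qed

lemma degree_sum: "(\<Sum>v\<in>V. card (N v)) = 2 * card E"
proof -
  have "(\<Sum>v\<in>e. \<Sum>u\<in>e - {v}. 1) = (2::nat)" if "e \<in> E" for e
  proof -
    have "card e = 2" using that simple by (auto simp: finite_simple_graph_def)
    then obtain x y where "e = {x, y}" "x \<noteq> y" by (meson card_2_iff)
    then show ?thesis by (simp add: insert_Diff_if)
  qed
  then have "(\<Sum>e\<in>E. \<Sum>v\<in>e. \<Sum>u\<in>e - {v}. 1) = (\<Sum>e\<in>E. 2::nat)" by (rule sum.cong[OF refl])
  then show ?thesis using sum_over_edges[of "\<lambda>_ _. 1"] by simp
qed

text \<open>The factor 2 reserves the weight of every edge for two cycles.\<close>

lemma sum_edge_weight: "84 * card V + 2 * (\<Sum>e\<in>E. edge_weight e) \<le> 72 * card E"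
  using charge_total sum_over_edges[of weight] degree_sum by (simp add: edge_weight_def)

section \<open>The weight of a 13-cycle\<close>

lemma weight_mid:
  assumes v: "big v" and u: "u \<in> N v" "u' \<in> N v" "u \<noteq> u'" and mid: "mid_dart v u"
  shows "3 \<le> weight v u + weight v u' \<or> 2 \<le> weight v u + weight v u' \<and> mid_dart v u'"
proof -
  have wu: "weight v u = mid_weight v" using v mid dart_exclusive(1)[OF u(1)] by (simp add: weight_def)
  show ?thesis
  proof (cases "mid_weight v = 3")
    case True
    then show ?thesis using wu by simp
  next
    case False
    \<comment> \<open>In the first exceptional case all darts are mid and give 1 each; in the second
      all the other darts are long and give 3.\<close>
    then consider "card (N v) = 3" "mid_degree v = 3" "mid_weight v = 1"
      | "card (N v) = 4" "long_degree v = 3"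
      by (auto simp: mid_weight_def split: if_splits)
    then show ?thesis
    proof cases
      case 1
      have "{u \<in> N v. mid_dart v u} = N v"
        using 1 finite_N by (intro card_subset_eq) (auto simp: mid_degree_def)
      then have "mid_dart v u'" using u(2) by blast
      then have "weight v u' = 1" using v dart_exclusive(1)[OF u(2)] 1(3) by (simp add: weight_def)
      with \<open>mid_dart v u'\<close> wu 1(3) show ?thesis by simp
    next
      case 2
      have "\<not> long_dart v u" using mid dart_exclusive(3)[OF u(1)] by blast
      then have "{u \<in> N v. long_dart v u} \<subseteq> N v - {u}" by blast
      moreover have "card (N v - {u}) = 3" using 2(1) u(1) by (simp add: finite_N)
      ultimately have "{u \<in> N v. long_dart v u} = N v - {u}"
        using 2(2) finite_N by (intro card_subset_eq) (auto simp: long_degree_def)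
      then have "long_dart v u'" using u(2,3) by blast
      then have "weight v u' = 3"
        using v dart_exclusive(2,3)[OF u(2)] 2(1) by (simp add: weight_def long_weight_def)
      then show ?thesis by simp
    qed
  qed
qed

lemma weight_not_mid:
  assumes "big v" "u \<in> N v" "u' \<in> N v" "\<not> mid_dart v u" "\<not> mid_dart v u'" "card (N v) \<noteq> 3"
  shows "6 \<le> weight v u + weight v u'"
  using assms by (simp add: weight_def long_weight_def short_weight_def)

lemma weight_short:
  assumes "big v" "u \<in> N v" "u' \<in> N v" "u \<noteq> u'" "big u" "big u'"
  shows "weight v u = 3"
proof -
  have "card {u, u'} \<le> short_degree v"
    unfolding short_degree_def using assms finite_N by (intro card_mono) auto
  then show ?thesis using assms by (simp add: weight_def short_weight_def)
qed

lemma third_neighbour: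
  assumes "card (N v) = 3" "a \<in> N v" "b \<in> N v" "a \<noteq> b"
  obtains y where "N v = {a, b, y}" "y \<noteq> a" "y \<noteq> b"
proof -
  have "card (N v - {a, b}) = 1" using assms finite_N by (simp add: card_Diff_subset)
  then obtain y where y: "N v - {a, b} = {y}" by (auto simp: card_1_singleton_iff)
  then have "N v = {a, b, y}" "y \<noteq> a" "y \<noteq> b" using assms by blast+
  then show ?thesis by (rule that)
qed

text \<open>A light cycle has no thread with exactly one inner vertex, no vertex of degree above 3 and no
  three consecutive vertices of degree at least 3. As its length 13 is \<open>4 + 3 + 3 + 3\<close>, the vertices of
  degree at least 3 then form the pattern of a ring.\<close>

lemma cycle_weight:
  assumes cyc: "is_cycle E xs" and len: "length xs = 13"
  shows "6 \<le> (\<Sum>e\<in>cycle_edges xs. edge_weight e)"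
proof (rule ccontr)
  assume light: "\<not> 6 \<le> (\<Sum>e\<in>cycle_edges xs. edge_weight e)"
  \<comment> \<open>Indices are read modulo 13 and only increase: \<open>i + 12\<close> is the
    predecessor of \<open>i\<close>. Accordingly \<open>t i\<close> collects what the vertex
    \<open>c (i + 1)\<close> gives for its two cycle edges.\<close>
  define c where "c i = xs ! (i mod 13)" for i
  define B where "B i = big (c i)" for i
  define t where "t i = weight (c (i + 1)) (c (i + 2)) + weight (c (i + 1)) (c i)" for i
  have dist: "distinct xs" using cyc by (simp add: is_cycle_def)
  have c13_0: "c (i + 13) = c i" for i by (simp add: c_def)
  have c13: "c (i + 13) = c i" "c (i + 14) = c (i + 1)" "c (i + 15) = c (i + 2)" for i
    using c13_0[of i] c13_0[of "i + 1"] c13_0[of "i + 2"] by (simp_all add: eval_nat_numeral)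
  have c_eq: "c i = c j \<longleftrightarrow> i mod 13 = j mod 13" for i j
    using dist len by (simp add: c_def nth_eq_iff_index_eq)
  have residue: "(i + a) mod 13 \<noteq> (i + b) mod 13" if "a \<le> b" "\<not> 13 dvd b - a" for i a b :: nat
    using that mod_eq_dvd_iff_nat[of "i + a" "i + b" 13] by auto
  have edge: "{c i, c (i + 1)} = {xs ! (i mod 13), xs ! ((i mod 13 + 1) mod length xs)}" for i
    by (simp add: c_def len mod_Suc_eq)
  have adj1: "c (i + 1) \<in> N (c i)" for i
  proof -
    have "i mod 13 < length xs" using len by simp
    then have "{xs ! (i mod 13), xs ! ((i mod 13 + 1) mod length xs)} \<in> E"
      using cyc unfolding is_cycle_def by blast
    then show ?thesis unfolding edge[symmetric] by (simp add: nbs_def)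
  qed
  have adj2: "c (i + 2) \<in> N (c (i + 1))" "c i \<in> N (c (i + 1))" for i
    using adj1[of "i + 1"] adj1[of i] N_sym by (simp_all add: eval_nat_numeral)
  have ne2: "c i \<noteq> c (i + 2)" for i unfolding c_eq using residue[of 0 2 i] by simp
  have small: "N (c (i + 1)) = {c i, c (i + 2)}" if nB: "\<not> B (i + 1)" for i
  proof -
    obtain b where "N (c (i + 1)) = {c i, b}"
      using adj1 nB unfolding B_def by (rule small_neighbours)
    with adj2(1)[of i] ne2[of i] show ?thesis by auto
  qed
  have total: "(\<Sum>e\<in>cycle_edges xs. edge_weight e) = (\<Sum>i<13. t i)"
  proof -
    let ?f = "\<lambda>i. {xs ! i, xs ! ((i + 1) mod length xs)}"
    have "inj_on ?f {..<length xs}"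
      using card_cycle_edges[of xs] dist len
      by (intro eq_card_imp_inj_on) (simp_all add: cycle_edges_def)
    then have "(\<Sum>e\<in>cycle_edges xs. edge_weight e) = (\<Sum>i<13. edge_weight (?f i))"
      unfolding cycle_edges_def by (subst sum.reindex) (simp_all add: len)
    also have "\<dots> = (\<Sum>i<13. weight (c i) (c (i + 1)) + weight (c (i + 1)) (c i))"
    proof (rule sum.cong[OF refl])
      fix i :: nat assume "i \<in> {..<13}"
      then have "?f i = {c i, c (i + 1)}" using edge[of i] by simp
      moreover have "c i \<noteq> c (i + 1)" using adj1[of i] N_irrefl by metis
      ultimately show "edge_weight (?f i) = weight (c i) (c (i + 1)) + weight (c (i + 1)) (c i)"
        by (simp add: edge_weight_pair)
    qed
    also have "\<dots> = (\<Sum>i<13. weight (c i) (c (i + 1))) + (\<Sum>i<13. weight (c (i + 1)) (c i))"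
      by (rule sum.distrib)
    \<comment> \<open>A cyclic shift of one of the two sums groups the weights by vertex instead of
      by edge.\<close>
    also have "(\<Sum>i<13. weight (c i) (c (i + 1))) = (\<Sum>i<13. weight (c (i + 1)) (c (i + 2)))"
    proof -
      let ?g = "\<lambda>i. weight (c i) (c (i + 1))"
      have "?g 0 + (\<Sum>i<13. ?g (Suc i)) = (\<Sum>i<13. ?g i) + ?g 13"
        using sum.lessThan_Suc_shift[of ?g 13] sum.lessThan_Suc[of ?g 13] by simp
      moreover have "?g 13 = ?g 0" using c13(1,2)[of 0] by simp
      ultimately show ?thesis by (simp add: eval_nat_numeral)
    qed
    finally show ?thesis by (simp add: t_def sum.distrib)
  qed
  have t_mod: "t i = t (i mod 13)" for i
    by (simp add: t_def c_def mod_simps)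
  have sub: "(\<Sum>i\<in>S. t i) < 6" if "S \<subseteq> {..<13}" for S
  proof -
    have "(\<Sum>i\<in>S. t i) \<le> (\<Sum>i<13. t i)" using that by (intro sum_mono2) auto
    with light total show ?thesis by simp
  qed
  have t1: "t i < 6" for i using sub[of "{i mod 13}"] t_mod[of i] by simp
  have t2: "t i + t j < 6" if "i mod 13 \<noteq> j mod 13" for i j
    using sub[of "{i mod 13, j mod 13}"] that t_mod[of i] t_mod[of j] by simp
  have t3: "t i + t j + t k < 6"
    if "i mod 13 \<noteq> j mod 13" "i mod 13 \<noteq> k mod 13" "j mod 13 \<noteq> k mod 13" for i j k
    using sub[of "{i mod 13, j mod 13, k mod 13}"] that t_mod[of i] t_mod[of j] t_mod[of k] by simp
  \<comment> \<open>The cycle vertex \<open>c (i + 1)\<close> is the only inner vertex of its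
    thread.\<close>
  define M where "M i \<longleftrightarrow> B i \<and> \<not> B (i + 1) \<and> B (i + 2)" for i
  have mid_up: "M i" if "B i" "mid_dart (c i) (c (i + 1))" for i
  proof -
    from that(2) obtain e where e: "N (c (i + 1)) = {c i, e}" "big e" by (auto simp: mid_dart_def)
    then have nB: "\<not> B (i + 1)" unfolding B_def using not_big_pair by blast
    from small[OF this] e ne2[of i] have "e = c (i + 2)" by (metis doubleton_eq_iff)
    with that(1) nB e(2) show ?thesis by (simp add: M_def B_def)
  qed
  have mid_down: "M i" if "B (i + 2)" "mid_dart (c (i + 2)) (c (i + 1))" for i
  proof -
    from that(2) obtain e where e: "N (c (i + 1)) = {c (i + 2), e}" "big e" by (auto simp: mid_dart_def)
    then have nB: "\<not> B (i + 1)" unfolding B_def using not_big_pair by blast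
    from small[OF this] e ne2[of i] have "e = c i" by (metis doubleton_eq_iff)
    with that(1) nB e(2) show ?thesis by (simp add: M_def B_def)
  qed
  have M_mid: "mid_dart (c i) (c (i + 1))" "mid_dart (c (i + 2)) (c (i + 1))" if "M i" for i
    using that small[of i] by (auto simp: M_def B_def mid_dart_def insert_commute)
  have up: "3 \<le> t (i + 1) \<or> 2 \<le> t (i + 1) \<and> M (i + 2)" if M: "M i" for i
  proof -
    have B2: "B (i + 2)" using M by (simp add: M_def)
    have "c (i + 1) \<in> N (c (i + 2))" "c (i + 3) \<in> N (c (i + 2))" "c (i + 1) \<noteq> c (i + 3)"
      using adj2[of "i + 1"] ne2[of "i + 1"] by (simp_all add: eval_nat_numeral)
    from weight_mid[OF _ this M_mid(2)[OF M]] B2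
    have "3 \<le> t (i + 1) \<or> 2 \<le> t (i + 1) \<and> mid_dart (c (i + 2)) (c (i + 3))"
      by (simp add: t_def B_def eval_nat_numeral add.commute)
    then show ?thesis using mid_up[OF B2] by (auto simp: eval_nat_numeral)
  qed
  have down: "3 \<le> t (i + 12) \<or> 2 \<le> t (i + 12) \<and> M (i + 11)" if M: "M i" for i
  proof -
    have B0: "B (i + 13)" using M c13 by (simp add: M_def B_def)
    have n: "c (i + 14) \<in> N (c (i + 13))" "c (i + 12) \<in> N (c (i + 13))" "c (i + 14) \<noteq> c (i + 12)"
      using adj2[of "i + 12"] ne2[of "i + 12"] by (simp_all add: eval_nat_numeral)
    have "mid_dart (c (i + 13)) (c (i + 14))" using M_mid(1)[OF M] by (simp add: c13)
    from weight_mid[OF _ n this] B0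
    have "3 \<le> t (i + 12) \<or> 2 \<le> t (i + 12) \<and> mid_dart (c (i + 13)) (c (i + 12))"
      by (simp add: t_def B_def eval_nat_numeral)
    then show ?thesis using mid_down[of "i + 11"] B0 by (auto simp: eval_nat_numeral)
  qed
  \<comment> \<open>Either both ends of the thread give 3, or one of them gives only 2 and the
    thread beyond it is of the same kind. The far end of that one gives at least 2 again, and three
    vertices together give 6.\<close>
  have no_mid: "\<not> M i" for i
  proof
    assume M: "M i"
    have m: "(i + 1) mod 13 \<noteq> (i + 12) mod 13" "(i + 1) mod 13 \<noteq> (i + 3) mod 13"
      "(i + 3) mod 13 \<noteq> (i + 12) mod 13" "(i + 1) mod 13 \<noteq> (i + 23) mod 13"
      "(i + 23) mod 13 \<noteq> (i + 12) mod 13"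
      using residue[of 1 12 i] residue[of 1 3 i] residue[of 3 12 i] residue[of 1 23 i] residue[of 12 23 i]
      by simp_all
    consider "3 \<le> t (i + 1)" "3 \<le> t (i + 12)" | "M (i + 2)" | "M (i + 11)"
      using up[OF M] down[OF M] by blast
    then show False
    proof cases
      case 1
      then show False using t2[OF m(1)] by simp
    next
      case 2
      from up[OF this] have "2 \<le> t (i + 3)" by (auto simp: eval_nat_numeral)
      then show False using t3[OF m(2,1,3)] up[OF M] down[OF M] by auto
    next
      case 3
      from down[OF this] have "2 \<le> t (i + 23)" by (auto simp: eval_nat_numeral)
      then show False using t3[OF m(4,1,5)] up[OF M] down[OF M] by auto
    qed
  qed
  have nm: "\<not> mid_dart (c (i + 1)) (c (i + 2))" "\<not> mid_dart (c (i + 1)) (c i)" if "B (i + 1)" for i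
  proof -
    show "\<not> mid_dart (c (i + 1)) (c (i + 2))"
      using mid_up[of "i + 1"] no_mid[of "i + 1"] that by (auto simp: eval_nat_numeral)
    show "\<not> mid_dart (c (i + 1)) (c i)"
      using mid_down[of "i + 12"] no_mid[of "i + 12"] that c13[of i] by (auto simp: B_def algebra_simps)
  qed
  have deg: "card (N (c (i + 1))) = 3" if "B (i + 1)" for i
  proof (rule ccontr)
    assume "card (N (c (i + 1))) \<noteq> 3"
    with weight_not_mid[of "c (i + 1)" "c (i + 2)" "c i"] nm[OF that] adj2[of i] that
    have "6 \<le> t i" by (simp add: t_def B_def)
    then show False using t1[of i] by simp
  qed
  have two: "\<not> (B i \<and> B (i + 2))" if "B (i + 1)" for i
  proof
    assume "B i \<and> B (i + 2)"
    with weight_short[of "c (i + 1)" "c (i + 2)" "c i"] weight_short[of "c (i + 1)" "c i" "c (i + 2)"]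
      adj2[of i] that ne2[of i]
    have "6 \<le> t i" by (simp add: t_def B_def)
    then show False using t1[of i] by simp
  qed
  \<comment> \<open>Two big neighbours would make a thread with one inner vertex, two small ones a
    thread with three.\<close>
  have one: "B i \<noteq> B (i + 2)" if "\<not> B (i + 1)" for i
  proof
    assume eq: "B i = B (i + 2)"
    then have nB: "\<not> B i" "\<not> B (i + 2)" using no_mid[of i] that by (auto simp: M_def)
    have N: "N (c (i + 1)) = {c i, c (i + 2)}" "N (c (i + 2)) = {c (i + 1), c (i + 3)}"
      "N (c i) = {c (i + 12), c (i + 1)}"
      using small[of i] small[of "i + 1"] small[of "i + 12"] that nB c13[of i]
      by (simp_all add: B_def eval_nat_numeral)
    have "nb_walk [c (i + 12), c i, c (i + 1), c (i + 2), c (i + 3)]"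
      using adj1[of "i + 12"] adj1[of i] adj1[of "i + 1"] adj1[of "i + 2"] ne2[of i] ne2[of "i + 1"]
        ne2[of "i + 12"] c13[of i] by (simp add: eval_nat_numeral)
    then show False by (rule no_long_thread) (rule N)+
  qed
  have perB: "B (i + 13) = B i" for i by (simp add: B_def c13)
  obtain k where k: "B k" "B (k + 1)" "\<not> B (k + 2)" "\<not> B (k + 3)" "B (k + 4)" "\<not> B (k + 5)" "\<not> B (k + 6)"
    "B (k + 7)" "\<not> B (k + 8)" "\<not> B (k + 9)" "B (k + 10)" "\<not> B (k + 11)" "\<not> B (k + 12)"
    by (rule period_13_pattern[of B, OF perB one two]) auto
  have third: "\<exists>y. N (c (i + 1)) = {c i, c (i + 2), y} \<and> y \<noteq> c i \<and> y \<noteq> c (i + 2)" if "B (i + 1)" for i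
    using third_neighbour[OF deg[OF that] adj2(2,1) ne2] by metis
  have third': "\<exists>y. N (c (k + 1)) = {c k, c (k + 2), y} \<and> y \<noteq> c k \<and> y \<noteq> c (k + 2)"
    "\<exists>y. N (c (k + 4)) = {c (k + 3), c (k + 5), y} \<and> y \<noteq> c (k + 3) \<and> y \<noteq> c (k + 5)"
    "\<exists>y. N (c (k + 7)) = {c (k + 6), c (k + 8), y} \<and> y \<noteq> c (k + 6) \<and> y \<noteq> c (k + 8)"
    "\<exists>y. N (c (k + 10)) = {c (k + 9), c (k + 11), y} \<and> y \<noteq> c (k + 9) \<and> y \<noteq> c (k + 11)"
    "\<exists>y. N (c k) = {c (k + 12), c (k + 1), y} \<and> y \<noteq> c (k + 12) \<and> y \<noteq> c (k + 1)"
    using third[of k] third[of "k + 3"] third[of "k + 6"] third[of "k + 9"] third[of "k + 12"] k c13[of k]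
    by (simp_all add: eval_nat_numeral B_def)
  from third' obtain ow y1 y2 y3 ov where
    o: "N (c (k + 1)) = {c k, c (k + 2), ow}" "ow \<noteq> c k" "ow \<noteq> c (k + 2)"
      "N (c (k + 4)) = {c (k + 3), c (k + 5), y1}" "y1 \<noteq> c (k + 3)" "y1 \<noteq> c (k + 5)"
      "N (c (k + 7)) = {c (k + 6), c (k + 8), y2}" "y2 \<noteq> c (k + 6)" "y2 \<noteq> c (k + 8)"
      "N (c (k + 10)) = {c (k + 9), c (k + 11), y3}" "y3 \<noteq> c (k + 9)" "y3 \<noteq> c (k + 11)"
      "N (c k) = {c (k + 12), c (k + 1), ov}" "ov \<noteq> c (k + 12)" "ov \<noteq> c (k + 1)"
    by (elim exE conjE) (rule that)
  have sm: "N (c (k + 2)) = {c (k + 1), c (k + 3)}" "N (c (k + 3)) = {c (k + 2), c (k + 4)}"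
    "N (c (k + 5)) = {c (k + 4), c (k + 6)}" "N (c (k + 6)) = {c (k + 5), c (k + 7)}"
    "N (c (k + 8)) = {c (k + 7), c (k + 9)}" "N (c (k + 9)) = {c (k + 8), c (k + 10)}"
    "N (c (k + 11)) = {c (k + 10), c (k + 12)}" "N (c (k + 12)) = {c (k + 11), c k}"
    using small[of "k + 1"] small[of "k + 2"] small[of "k + 4"] small[of "k + 5"] small[of "k + 7"]
      small[of "k + 8"] small[of "k + 10"] small[of "k + 11"] k c13[of k]
    by (simp_all add: eval_nat_numeral)
  have "ov \<in> N (c k)" using o by auto
  then obtain Tv ev es where v: "off_thread (c k) ov Tv ev" "nb_walk (c k # es)" "es \<noteq> []" "hd es = ov"
    "length es \<le> 3" "set es = insert ev Tv" "ev \<notin> Tv" "Tv = {} \<longrightarrow> big ov"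
    by (rule off_thread_exists)
  have "ow \<in> N (c (k + 1))" using o by auto
  then obtain Tw ew fs where w: "off_thread (c (k + 1)) ow Tw ew" "nb_walk (c (k + 1) # fs)" "fs \<noteq> []"
    "hd fs = ow" "length fs \<le> 3" "set fs = insert ew Tw" "ew \<notin> Tw" "Tw = {} \<longrightarrow> big ow"
    by (rule off_thread_exists)
  have dist13: "distinct [c k, c (k + 1), c (k + 2), c (k + 3), c (k + 4), c (k + 5), c (k + 6), c (k + 7),
    c (k + 8), c (k + 9), c (k + 10), c (k + 11), c (k + 12)]"
  proof -
    have le: "i = j" if "i \<le> j" "j < 13" "c (k + i) = c (k + j)" for i j
    proof -
      have "13 dvd j - i" using residue[of i j k] that(1,3) c_eq by blast
      with that(1,2) show ?thesis using nat_dvd_not_less[of "j - i" 13] by linarith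
    qed
    have "i = j" if "i < 13" "j < 13" "c (k + i) = c (k + j)" for i j
      using le[of i j] le[of j i] that by (cases "i \<le> j") simp_all
    then have "distinct (map (\<lambda>i. c (k + i)) [0..<13])"
      unfolding distinct_map by (auto simp: inj_on_def)
    moreover have "[0..<13] = [0, 1, 2, 3, 4, 5, 6, 7, 8, 9, 10, 11, 12::nat]" by (simp add: upt_rec)
    ultimately show ?thesis by (simp only: list.map add_0_right)
  qed
  have "ring_threads (c k) (c (k + 1)) (c (k + 2)) (c (k + 3)) (c (k + 4)) (c (k + 5)) (c (k + 6)) (c (k + 7))
    (c (k + 8)) (c (k + 9)) (c (k + 10)) (c (k + 11)) (c (k + 12)) y1 y2 y3 ov ow
    {c k, c (k + 1), c (k + 2), c (k + 3), c (k + 4), c (k + 5), c (k + 6), c (k + 7),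
    c (k + 8), c (k + 9), c (k + 10), c (k + 11), c (k + 12)} Tv ev Tw ew"
    by (rule ring_threads_intro[OF dist13 _ _ _ _ _ _ _ _ _ _ _ _ _ _ _ _ _ _ _ _ _ _ _ v(1) w(1) v(2-7) w(2-7) refl])
      (use o sm in \<open>simp_all only: insert_commute not_False_eq_True\<close>)
  moreover have "Tv \<noteq> {} \<or> Tw \<noteq> {}"
  proof (rule ccontr)
    \<comment> \<open>Then both ends of the edge between \<open>c k\<close> and
      \<open>c (k + 1)\<close> have two big neighbours, and each gives 3 for this edge.\<close>
    assume "\<not> (Tv \<noteq> {} \<or> Tw \<noteq> {})"
    then have b: "big ov" "big ow" using v(8) w(8) by auto
    have "weight (c k) (c (k + 1)) = 3"
      by (rule weight_short[of "c k" "c (k + 1)" ov]) (use k b o in \<open>auto simp: B_def\<close>)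
    moreover have "t (k + 12) = weight (c (k + 13)) (c (k + 14)) + weight (c (k + 13)) (c (k + 12))"
      by (simp add: t_def eval_nat_numeral)
    ultimately have "3 \<le> t (k + 12)" unfolding c13 by linarith
    moreover have "weight (c (k + 1)) (c k) = 3"
      by (rule weight_short[of "c (k + 1)" "c k" ow]) (use k b o in \<open>auto simp: B_def\<close>)
    then have "3 \<le> t k" by (simp add: t_def)
    moreover have "(k + 12) mod 13 \<noteq> k mod 13" using residue[of 0 12 k] by simp
    ultimately show False using t2[of "k + 12" k] by simp
  qed
  ultimately show False by (rule no_ring)
qed

lemma not_planar:
  assumes "plane_graph V E p \<gamma>"
  shows False
proof -
  interpret plane_graph V E p \<gamma> by (rule assms)
  have ne: "V \<noteq> {}" using not_colorable by (auto simp: star_coloring_def)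
  \<comment> \<open>Minimum degree 2 gives \<open>n <= m\<close>, the hypothesis of
    \<open>euler_cycles\<close>.\<close>
  have "(\<Sum>v\<in>V. 2) \<le> (\<Sum>v\<in>V. card (N v))" using degree_ge_2 by (rule sum_mono)
  then have VE: "card V \<le> card E" using degree_sum by simp
  from euler_cycles[OF ne VE] obtain K :: "complex set" and C
    where K: "finite K" "card E + 2 \<le> card K + card V" "\<And>z. z \<in> K \<Longrightarrow> is_cycle E (C z)"
      "\<And>e. e \<in> E \<Longrightarrow> card {z \<in> K. e \<in> cycle_edges (C z)} \<le> 2"
    by blast
  have sub: "cycle_edges (C z) \<subseteq> E" if "z \<in> K" for z using K(3)[OF that] by (simp add: is_cycle_iff)
  have swap: "(\<Sum>z\<in>K. \<Sum>e\<in>cycle_edges (C z). F e) \<le> 2 * (\<Sum>e\<in>E. F e)" for F :: "'a set \<Rightarrow> nat"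
  proof -
    have "(\<Sum>z\<in>K. \<Sum>e\<in>cycle_edges (C z). F e) = (\<Sum>z\<in>K. \<Sum>e | e \<in> E \<and> e \<in> cycle_edges (C z). F e)"
    proof (rule sum.cong[OF refl])
      fix z assume "z \<in> K"
      then have "{e. e \<in> E \<and> e \<in> cycle_edges (C z)} = cycle_edges (C z)" using sub by auto
      then show "(\<Sum>e\<in>cycle_edges (C z). F e) = (\<Sum>e | e \<in> E \<and> e \<in> cycle_edges (C z). F e)" by simp
    qed
    also have "\<dots> = (\<Sum>e\<in>E. \<Sum>z | z \<in> K \<and> e \<in> cycle_edges (C z). F e)"
      by (rule sum.swap_restrict[OF K(1) finite_E])
    also have "\<dots> \<le> (\<Sum>e\<in>E. 2 * F e)"
    proof (rule sum_mono)
      fix e assume "e \<in> E"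
      then show "(\<Sum>z | z \<in> K \<and> e \<in> cycle_edges (C z). F e) \<le> 2 * F e" using K(4) by simp
    qed
    finally show ?thesis by (simp add: sum_distrib_left)
  qed
  define K' where "K' = {z \<in> K. length (C z) = 13}"
  have "14 * card K \<le> (\<Sum>z\<in>K. card (cycle_edges (C z))) + card K'"
  proof -
    have "(\<Sum>z\<in>K. 14) \<le> (\<Sum>z\<in>K. card (cycle_edges (C z)) + of_bool (length (C z) = 13))"
    proof (rule sum_mono)
      fix z assume "z \<in> K"
      from K(3)[OF this] have "card (cycle_edges (C z)) = length (C z)" "13 \<le> length (C z)"
        by (auto intro: card_cycle_edges long_cycles simp: is_cycle_def)
      then show "14 \<le> card (cycle_edges (C z)) + of_bool (length (C z) = 13)" by simp
    qed
    also have "\<dots> = (\<Sum>z\<in>K. card (cycle_edges (C z))) + card K'"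
      using K(1) by (simp add: sum.distrib K'_def Int_def)
    finally show ?thesis by simp
  qed
  moreover have "(\<Sum>z\<in>K. card (cycle_edges (C z))) \<le> 2 * card E"
    using swap[of "\<lambda>_. 1"] by simp
  moreover have "6 * card K' \<le> 2 * (\<Sum>e\<in>E. edge_weight e)"
  proof -
    have "6 * card K' = (\<Sum>z\<in>K'. 6)" by simp
    also have "\<dots> \<le> (\<Sum>z\<in>K'. \<Sum>e\<in>cycle_edges (C z). edge_weight e)"
      using K(3) by (intro sum_mono cycle_weight) (auto simp: K'_def)
    also have "\<dots> \<le> (\<Sum>z\<in>K. \<Sum>e\<in>cycle_edges (C z). edge_weight e)"
      using K(1) by (intro sum_mono2) (auto simp: K'_def)
    also have "\<dots> \<le> 2 * (\<Sum>e\<in>E. edge_weight e)" by (rule swap)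
    finally show ?thesis .
  qed
  \<comment> \<open>With \<open>k\<close> for \<open>card K'\<close>, six times
    \<open>12 m + 28 <= 14 n + k\<close> is \<open>72 m + 168 <= 84 n + 6 k\<close>, against
    \<open>84 n + 6 k <= 72 m\<close>.\<close>
  ultimately show False using sum_edge_weight K(2) by linarith
qed

end

section \<open>Passage to a minimal counterexample\<close>

lemma star_coloring_induced:
  assumes "W \<subseteq> U"
  shows "star_coloring {e \<in> E. e \<subseteq> U} W c \<longleftrightarrow> star_coloring E W c"
proof -
  have "W \<inter> nbs {e \<in> E. e \<subseteq> U} u = W \<inter> nbs E u" if "u \<in> W" for u
    using that assms by (auto simp: nbs_def)
  then show ?thesis unfolding star_coloring_def by simp
qed

lemma plane_drawing_subset:
  assumes D: "plane_drawing V E p \<gamma>" and sub: "W \<subseteq> V" "F \<subseteq> E"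
  shows "plane_drawing W F p \<gamma>"
proof -
  have "inj_on p V" and E: "\<And>e. e \<in> E \<Longrightarrow> arc (\<gamma> e) \<and> {pathstart (\<gamma> e), pathfinish (\<gamma> e)} = p ` e"
    "\<And>e. e \<in> E \<Longrightarrow> (path_image (\<gamma> e) - p ` e) \<inter> p ` V = {}"
    "\<And>e f. e \<in> E \<Longrightarrow> f \<in> E \<Longrightarrow> e \<noteq> f \<Longrightarrow> (path_image (\<gamma> e) - p ` e) \<inter> path_image (\<gamma> f) = {}"
    using D by (simp_all add: plane_drawing_def)
  have FE: "e \<in> E" if "e \<in> F" for e using sub(2) that by blast
  show ?thesis
    unfolding plane_drawing_def
  proof (intro conjI[of "inj_on p W"] conjI[of "Ball F _"] ballI impI)
    show "inj_on p W" using \<open>inj_on p V\<close> sub(1) by (rule inj_on_subset)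
    show "(path_image (\<gamma> e) - p ` e) \<inter> p ` W = {}" if "e \<in> F" for e
      using E(2)[OF FE[OF that]] sub(1) by blast
  qed (intro E FE; assumption)+
qed

text \<open>Induction over the subsets \<open>W\<close> with \<open>E\<close> fixed. A subset that
  cannot be coloured, while its proper subsets can, induces a critical graph drawn by the same
  arcs.\<close>

lemma star_4_coloring_exists:
  assumes G: "finite_simple_graph V E" and D: "plane_drawing V E p \<gamma>"
    and girth: "\<And>xs. is_cycle E xs \<Longrightarrow> 13 \<le> length xs"
  shows "\<exists>c. star_coloring E V c"
proof -
  have "finite V" using G by (simp add: finite_simple_graph_def)
  moreover have "\<exists>c. star_coloring E W c" if "finite W" "W \<subseteq> V" for W
    using that
  proof (induction W rule: finite_psubset_induct)
    case (psubset W)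
    define F where "F = {e \<in> E. e \<subseteq> W}"
    have FE: "F \<subseteq> E" by (auto simp: F_def)
    have WF: "finite_simple_graph W F"
      using G psubset.hyps by (auto simp: finite_simple_graph_def F_def)
    have "plane_drawing W F p \<gamma>"
      using D psubset.prems FE by (rule plane_drawing_subset)
    then have plane: "plane_graph W F p \<gamma>" using WF by (simp add: plane_graph_def)
    show ?case
    proof (rule ccontr)
      assume non: "\<nexists>c. star_coloring E W c"
      have "critical_graph W F"
      proof
        show "finite_simple_graph W F" by (rule WF)
        show "13 \<le> length xs" if "is_cycle F xs" for xs
          using girth is_cycle_mono[OF that FE] by blast
        show "\<nexists>c. star_coloring F W c"
          using non star_coloring_induced[of W W E] by (simp add: F_def)
        show "\<exists>c. star_coloring F (W - R) c" if "R \<subseteq> W" "R \<noteq> {}" for R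
        proof -
          have "W - R \<subset> W" "W - R \<subseteq> V" using that psubset.prems by auto
          then show ?thesis
            using psubset.IH star_coloring_induced[of "W - R" W E] by (simp add: F_def)
        qed
      qed
      then show False using plane by (rule critical_graph.not_planar)
    qed
  qed
  ultimately show ?thesis by blast
qed

theorem corollary1p7:
  fixes V :: "'a set" and E :: "'a set set"
  assumes "finite_simple_graph V E"
    and "planar V E"
    and "girth E \<ge> 13"
  shows "injective_chromatic_index E \<le> 6"
proof -
  from assms(2) obtain p \<gamma> where D: "plane_drawing V E p \<gamma>" by (auto simp: planar_def)
  have "13 \<le> length xs" if "is_cycle E xs" for xs
  proof -
    have "girth E \<le> enat (length xs)" unfolding girth_def using that by (intro INF_lower) simp
    with assms(3) have "13 \<le> enat (length xs)" by (rule order_trans)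
    then show ?thesis by (simp add: numeral_eq_enat)
  qed
  with assms(1) D have "\<exists>c. star_coloring E V c" by (rule star_4_coloring_exists)
  then have "\<exists>k. injective_edge_coloring E 6 k"
    using star_coloring_injective_edge_coloring[OF assms(1)] by blast
  then show ?thesis unfolding injective_chromatic_index_def by (rule Least_le)
qed

end
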